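(* For every integer $n\ge1$, the Green ring $r(K_{2n})$ is isomorphic as a ring to the subring $r(DK_n)_0\subset r(DK_n)$. Further, the indecomposable $K_{2n}$-modules are precisely the indecomposable $DK_n$-modules on which $K$ and $\overline K$ define the same endomorphism.
   Context: $DK_n$ (the Drinfeld double of the Nichols Hopf algebra $K_n$) is the Hopf algebra over $\mathbb{C}$ generated by $K,\overline{K},\xi_1,\dots,\xi_n,\overline{\xi}_1,\dots,\overline{\xi}_n$ with relations: $K^2=\overline{K}^2=1$, $K\overline{K}=\overline{K}K$; $K$ and $\overline K$ anticommute with every $\xi_i$ and every $\overline\xi_i$; $\xi_i^2=\overline\xi_i^2=0$; $\xi_i\xi_j=-\xi_j\xi_i$ and $\overline\xi_i\overline\xi_j=-\overline\xi_j\overline\xi_i$ for $i\neq j$; $\overline\xi_i\xi_j+\xi_j\overline\xi_i=\delta_{i,j}(1-K\overline K)$; and coproduct $\Delta(K)=K\otimes K$, $\Delta(\overline K)=\overline K\otimes\overline K$, $\Delta(\xi_i)=K\otimes\xi_i+\xi_i\otimes1$, $\Delta(\overline\xi_i)=\overline K\otimes\overline\xi_i+\overline\xi_i\otimes1$. The Nichols Hopf algebra $K_{2n}$ is generated by $[K],[\xi_1],\dots,[\xi_{2n}]$ with $[K]^2=1$, $[\xi_i]^2=0$, $[K][\xi_i]=-[\xi_i][K]$, $[\xi_i][\xi_j]=-[\xi_j][\xi_i]$ ($i\neq j$), $\Delta([K])=[K]\otimes[K]$, $\Delta([\xi_i])=[K]\otimes[\xi_i]+[\xi_i]\otimes1$;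 write $[\overline\xi_i]=[\xi_{n+i}]$. There is a surjective Hopf algebra map $\pi:DK_n\to K_{2n}=DK_n/\langle K-\overline K\rangle$ with $K,\overline K\mapsto[K]$, $\xi_i\mapsto[\xi_i]$, $\overline\xi_i\mapsto[\overline\xi_i]$, through which $K_{2n}$-modules are regarded as $DK_n$-modules. Modules are finite-dimensional left modules. The Green ring $r(H)$ of a Hopf algebra $H$ is the abelian group generated by isomorphism classes $[M]$ of $H$-modules modulo $[M\oplus N]=[M]+[N]$, with product $[M][N]=[M\otimes N]$. $r(DK_n)_0$ is the subring of $r(DK_n)$ additively generated by the classes $[M]$ of $DK_n$-modules $M$ such that $K.m=\overline K.m$ for all $m\in M$. *)

theory Defs
  imports
    "HOL-Algebra.QuotRing"
    "HOL-Algebra.Generated_Groups"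
    "HOL-Algebra.Subrings"
    "HOL-Algebra.Module"
    "HOL-Library.Poly_Mapping"
    "Jordan_Normal_Form.Matrix"
begin

section \<open>Algebras over the complex numbers\<close>

text \<open>
  A (unital, associative, not necessarily commutative) algebra over the complex numbers is
  represented by the record \<^type>\<open>module\<close>, a ring together with a scalar multiplication.
\<close>

definition alg_hom :: "(complex, 'a, 'm) module_scheme \<Rightarrow> (complex, 'b, 'n) module_scheme \<Rightarrow> ('a \<Rightarrow> 'b) set"
  where "alg_hom A B =
    {f \<in> Ring.ring_hom A B. \<forall>c. \<forall>x \<in> carrier A. f (c \<odot>\<^bsub>A\<^esub> x) = c \<odot>\<^bsub>B\<^esub> f x}"

definition complex_alg :: "(complex, complex) module"
  where "complex_alg =
    \<lparr>carrier = UNIV, monoid.mult = (*), one = 1, ring.zero = 0, add = (+), smult = (*)\<rparr>"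

definition mat_alg :: "nat \<Rightarrow> (complex, complex mat) module"
  where "mat_alg d =
    \<lparr>carrier = carrier_mat d d, monoid.mult = (*), one = 1\<^sub>m d, ring.zero = 0\<^sub>m d d, add = (+), smult = (\<cdot>\<^sub>m)\<rparr>"

text \<open>The monoid ring of \<open>M\<close> with coefficients in the ground type \<open>'c\<close>, i.e. formal linear
  combinations of elements of \<open>M\<close>.\<close>

definition monoid_ring :: "('m, 'e) monoid_scheme \<Rightarrow> ('c::comm_ring_1, 'm \<Rightarrow>\<^sub>0 'c) module"
  where "monoid_ring M =
    \<lparr>carrier = {p. Poly_Mapping.keys p \<subseteq> carrier M},
     monoid.mult = (\<lambda>p q. \<Sum>a\<in>Poly_Mapping.keys p. \<Sum>b\<in>Poly_Mapping.keys q.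
        Poly_Mapping.single (a \<otimes>\<^bsub>M\<^esub> b) (Poly_Mapping.lookup p a * Poly_Mapping.lookup q b)),
     one = Poly_Mapping.single \<one>\<^bsub>M\<^esub> 1,
     ring.zero = 0,
     add = (+),
     smult = (\<lambda>c. Poly_Mapping.map ((*) c))\<rparr>"

definition quot_alg :: "('c, 'a, 'm) module_scheme \<Rightarrow> 'a set \<Rightarrow> ('c, 'a set) module"
  where "quot_alg A I =
    \<lparr>carrier = carrier (A Quot I), monoid.mult = monoid.mult (A Quot I), one = one (A Quot I),
     ring.zero = ring.zero (A Quot I), add = add (A Quot I),
     smult = (\<lambda>c S. \<Union>s\<in>S. I +>\<^bsub>A\<^esub> (c \<odot>\<^bsub>A\<^esub> s))\<rparr>"

text \<open>The linear map into \<open>B\<close> that is induced on a quotient of a space of formal linear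
  combinations by prescribing the value \<open>f a\<close> on every basis element \<open>a\<close>.
  It is applied only where the linear extension of \<open>f\<close> is constant on the coset \<open>S\<close>.\<close>

definition induced :: "(complex, 'b, 'n) module_scheme \<Rightarrow> ('a \<Rightarrow> 'b) \<Rightarrow> ('a \<Rightarrow>\<^sub>0 complex) set \<Rightarrow> 'b"
  where "induced B f S =
    the_elem ((\<lambda>p. \<Oplus>\<^bsub>B\<^esub>a\<in>Poly_Mapping.keys p. Poly_Mapping.lookup p a \<odot>\<^bsub>B\<^esub> f a) ` S)"


section \<open>Tensor products of algebras\<close>

text \<open>Formal linear combinations of pairs, with
  \<open>\<langle>a, b\<rangle> \<langle>a', b'\<rangle> = \<langle>a a', b b'\<rangle>\<close>, modulo bilinearity. The span of the bilinearity relations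
  is stable under multiplication by pairs, so it coincides with the ideal used here.\<close>

definition pair_alg :: "(complex, 'a, 'm) module_scheme \<Rightarrow> (complex, 'b, 'n) module_scheme
    \<Rightarrow> (complex, ('a \<times> 'b) \<Rightarrow>\<^sub>0 complex) module"
  where "pair_alg A B = monoid_ring (A \<times>\<times> B)"

abbreviation fpair :: "complex \<Rightarrow> 'a \<Rightarrow> 'b \<Rightarrow> ('a \<times> 'b) \<Rightarrow>\<^sub>0 complex"
  where "fpair c a b \<equiv> Poly_Mapping.single (a, b) c"

definition bilinear_rels :: "(complex, 'a, 'm) module_scheme \<Rightarrow> (complex, 'b, 'n) module_scheme
    \<Rightarrow> (('a \<times> 'b) \<Rightarrow>\<^sub>0 complex) set"
  where "bilinear_rels A B =
      {fpair 1 (a \<oplus>\<^bsub>A\<^esub> a') b - fpair 1 a b - fpair 1 a' b | a a' b.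
         a \<in> carrier A \<and> a' \<in> carrier A \<and> b \<in> carrier B}
    \<union> {fpair 1 a (b \<oplus>\<^bsub>B\<^esub> b') - fpair 1 a b - fpair 1 a b' | a b b'.
         a \<in> carrier A \<and> b \<in> carrier B \<and> b' \<in> carrier B}
    \<union> {fpair 1 (c \<odot>\<^bsub>A\<^esub> a) b - fpair c a b | c a b. a \<in> carrier A \<and> b \<in> carrier B}
    \<union> {fpair 1 a (c \<odot>\<^bsub>B\<^esub> b) - fpair c a b | c a b. a \<in> carrier A \<and> b \<in> carrier B}"

definition tensor_ideal :: "(complex, 'a, 'm) module_scheme \<Rightarrow> (complex, 'b, 'n) module_scheme
    \<Rightarrow> (('a \<times> 'b) \<Rightarrow>\<^sub>0 complex) set"
  where "tensor_ideal A B = Idl\<^bsub>pair_alg A B\<^esub> (bilinear_rels A B)"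

definition tensor_alg :: "(complex, 'a, 'm) module_scheme \<Rightarrow> (complex, 'b, 'n) module_scheme
    \<Rightarrow> (complex, (('a \<times> 'b) \<Rightarrow>\<^sub>0 complex) set) module"
  where "tensor_alg A B = quot_alg (pair_alg A B) (tensor_ideal A B)"

definition tens :: "(complex, 'a, 'm) module_scheme \<Rightarrow> (complex, 'b, 'n) module_scheme
    \<Rightarrow> 'a \<Rightarrow> 'b \<Rightarrow> (('a \<times> 'b) \<Rightarrow>\<^sub>0 complex) set"
  where "tens A B a b = tensor_ideal A B +>\<^bsub>pair_alg A B\<^esub> fpair 1 a b"


section \<open>Hopf algebras\<close>

text \<open>Only the bialgebra data are recorded: the antipode is determined by them and enters
  neither modules nor their tensor products.\<close>

record 'h hopf = "(complex, 'h) module" +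
  comult :: "'h \<Rightarrow> (('h \<times> 'h) \<Rightarrow>\<^sub>0 complex) set"
  counit :: "'h \<Rightarrow> complex"

text \<open>Algebras presented by generators \<open>X\<close> and relators \<open>R\<close>.\<close>

definition free_alg :: "'g set \<Rightarrow> (complex, 'g list \<Rightarrow>\<^sub>0 complex) module"
  where "free_alg X = monoid_ring \<lparr>carrier = lists X, monoid.mult = (@), one = []\<rparr>"

abbreviation word :: "'g list \<Rightarrow> ('g list \<Rightarrow>\<^sub>0 complex)"
  where "word w \<equiv> Poly_Mapping.single w 1"

definition presented_alg :: "'g set \<Rightarrow> ('g list \<Rightarrow>\<^sub>0 complex) set
    \<Rightarrow> (complex, ('g list \<Rightarrow>\<^sub>0 complex) set) module"
  where "presented_alg X R = quot_alg (free_alg X) (Idl\<^bsub>free_alg X\<^esub> R)"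

definition presented_gen :: "'g set \<Rightarrow> ('g list \<Rightarrow>\<^sub>0 complex) set \<Rightarrow> 'g \<Rightarrow> ('g list \<Rightarrow>\<^sub>0 complex) set"
  where "presented_gen X R x = (Idl\<^bsub>free_alg X\<^esub> R) +>\<^bsub>free_alg X\<^esub> word [x]"

text \<open>The algebra map on a presented algebra with prescribed values \<open>f x\<close> on the generators.\<close>

definition alg_map :: "(complex, 'b, 'n) module_scheme \<Rightarrow> ('g \<Rightarrow> 'b) \<Rightarrow> ('g list \<Rightarrow>\<^sub>0 complex) set \<Rightarrow> 'b"
  where "alg_map B f = induced B (\<lambda>w. foldr (\<lambda>x y. f x \<otimes>\<^bsub>B\<^esub> y) w \<one>\<^bsub>B\<^esub>)"

definition presented_hopf :: "(complex, ('g list \<Rightarrow>\<^sub>0 complex) set) module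
    \<Rightarrow> ('g \<Rightarrow> ((('g list \<Rightarrow>\<^sub>0 complex) set \<times> ('g list \<Rightarrow>\<^sub>0 complex) set) \<Rightarrow>\<^sub>0 complex) set)
    \<Rightarrow> ('g \<Rightarrow> complex) \<Rightarrow> ('g list \<Rightarrow>\<^sub>0 complex) set hopf"
  where "presented_hopf A \<Delta> \<epsilon> =
    \<lparr>carrier = carrier A, monoid.mult = monoid.mult A, one = one A, ring.zero = ring.zero A, add = add A,
     smult = smult A,
     comult = alg_map (tensor_alg A A) \<Delta>,
     counit = alg_map complex_alg \<epsilon>\<rparr>"


subsection \<open>The Nichols Hopf algebra\<close>

datatype nichols_gen = NK | NXi nat

definition nichols_gens :: "nat \<Rightarrow> nichols_gen set"
  where "nichols_gens m = {NK} \<union> NXi ` {1..m}"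

definition nichols_rels :: "nat \<Rightarrow> (nichols_gen list \<Rightarrow>\<^sub>0 complex) set"
  where "nichols_rels m =
      {word [NK, NK] - word []}
    \<union> {word [NXi i, NXi i] | i. i \<in> {1..m}}
    \<union> {word [NK, NXi i] + word [NXi i, NK] | i. i \<in> {1..m}}
    \<union> {word [NXi i, NXi j] + word [NXi j, NXi i] | i j. i \<in> {1..m} \<and> j \<in> {1..m} \<and> i \<noteq> j}"

definition nichols_alg :: "nat \<Rightarrow> (complex, (nichols_gen list \<Rightarrow>\<^sub>0 complex) set) module"
  where "nichols_alg m = presented_alg (nichols_gens m) (nichols_rels m)"

definition nichols_el :: "nat \<Rightarrow> nichols_gen \<Rightarrow> (nichols_gen list \<Rightarrow>\<^sub>0 complex) set"
  where "nichols_el m = presented_gen (nichols_gens m) (nichols_rels m)"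

definition nichols :: "nat \<Rightarrow> (nichols_gen list \<Rightarrow>\<^sub>0 complex) set hopf"
  where "nichols m =
    (let A = nichols_alg m; T = tensor_alg A A; e = nichols_el m in
     presented_hopf A
       (\<lambda>x. case x of
          NK \<Rightarrow> tens A A (e NK) (e NK)
        | NXi i \<Rightarrow> tens A A (e NK) (e (NXi i)) \<oplus>\<^bsub>T\<^esub> tens A A (e (NXi i)) \<one>\<^bsub>A\<^esub>)
       (\<lambda>x. case x of NK \<Rightarrow> 1 | NXi i \<Rightarrow> 0))"


subsection \<open>The Drinfeld double of the Nichols Hopf algebra\<close>

text \<open>\<open>DK'\<close> and \<open>DXi' i\<close> stand for the barred generators.\<close>

datatype dk_gen = DK | DK' | DXi nat | DXi' nat

definition dk_gens :: "nat \<Rightarrow> dk_gen set"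
  where "dk_gens n = {DK, DK'} \<union> DXi ` {1..n} \<union> DXi' ` {1..n}"

definition dk_rels :: "nat \<Rightarrow> (dk_gen list \<Rightarrow>\<^sub>0 complex) set"
  where "dk_rels n =
      {word [DK, DK] - word [], word [DK', DK'] - word [], word [DK, DK'] - word [DK', DK]}
    \<union> {word [k, x i] + word [x i, k] | k x i. k \<in> {DK, DK'} \<and> x \<in> {DXi, DXi'} \<and> i \<in> {1..n}}
    \<union> {word [x i, x i] | x i. x \<in> {DXi, DXi'} \<and> i \<in> {1..n}}
    \<union> {word [x i, x j] + word [x j, x i] | x i j.
         x \<in> {DXi, DXi'} \<and> i \<in> {1..n} \<and> j \<in> {1..n} \<and> i \<noteq> j}
    \<union> {word [DXi' i, DXi j] + word [DXi j, DXi' i]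
         - (if i = j then word [] - word [DK, DK'] else 0) | i j. i \<in> {1..n} \<and> j \<in> {1..n}}"

definition dk_alg :: "nat \<Rightarrow> (complex, (dk_gen list \<Rightarrow>\<^sub>0 complex) set) module"
  where "dk_alg n = presented_alg (dk_gens n) (dk_rels n)"

definition dk_el :: "nat \<Rightarrow> dk_gen \<Rightarrow> (dk_gen list \<Rightarrow>\<^sub>0 complex) set"
  where "dk_el n = presented_gen (dk_gens n) (dk_rels n)"

definition nichols_double :: "nat \<Rightarrow> (dk_gen list \<Rightarrow>\<^sub>0 complex) set hopf"
  where "nichols_double n =
    (let A = dk_alg n; T = tensor_alg A A; e = dk_el n in
     presented_hopf A
       (\<lambda>x. case x of
          DK \<Rightarrow> tens A A (e DK) (e DK)
        | DK' \<Rightarrow> tens A A (e DK') (e DK')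
        | DXi i \<Rightarrow> tens A A (e DK) (e (DXi i)) \<oplus>\<^bsub>T\<^esub> tens A A (e (DXi i)) \<one>\<^bsub>A\<^esub>
        | DXi' i \<Rightarrow> tens A A (e DK') (e (DXi' i)) \<oplus>\<^bsub>T\<^esub> tens A A (e (DXi' i)) \<one>\<^bsub>A\<^esub>)
       (\<lambda>x. case x of DK \<Rightarrow> 1 | DK' \<Rightarrow> 1 | DXi i \<Rightarrow> 0 | DXi' i \<Rightarrow> 0))"

definition dk_proj :: "nat \<Rightarrow> (dk_gen list \<Rightarrow>\<^sub>0 complex) set \<Rightarrow> (nichols_gen list \<Rightarrow>\<^sub>0 complex) set"
  where "dk_proj n =
    (let e = nichols_el (2 * n) in
     alg_map (nichols_alg (2 * n))
       (\<lambda>x. case x of DK \<Rightarrow> e NK | DK' \<Rightarrow> e NK | DXi i \<Rightarrow> e (NXi i) | DXi' i \<Rightarrow> e (NXi (n + i))))"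


section \<open>Finite-dimensional modules\<close>

text \<open>
  A finite-dimensional left module is taken to have underlying space \<open>\<complex>\<^sup>d\<close>. It is a pair
  \<open>(d, \<rho>)\<close> where the algebra map \<open>\<rho>\<close> into the \<open>d \<times> d\<close> matrices gives the action \<open>h \<cdot> v = \<rho> h *\<^sub>v v\<close>.
  As \<open>\<rho>\<close> is required to be extensional, two pairs are equal iff they are the same module structure.
\<close>

type_synonym 'h fdmod = "nat \<times> ('h \<Rightarrow> complex mat)"

definition fd_module :: "'h hopf \<Rightarrow> 'h fdmod \<Rightarrow> bool"
  where "fd_module H M \<longleftrightarrow>
    snd M \<in> alg_hom H (mat_alg (fst M)) \<and> snd M \<in> extensional (carrier H)"

definition mod_act :: "'h fdmod \<Rightarrow> 'h \<Rightarrow> complex vec \<Rightarrow> complex vec"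
  where "mod_act M h v = snd M h *\<^sub>v v"

definition mod_iso :: "'h hopf \<Rightarrow> 'h fdmod \<Rightarrow> 'h fdmod \<Rightarrow> bool"
  where "mod_iso H M N \<longleftrightarrow> fst M = fst N \<and>
    (\<exists>P \<in> carrier_mat (fst M) (fst M). invertible_mat P \<and>
       (\<forall>h \<in> carrier H. P * snd M h = snd N h * P))"

definition mod_sum :: "'h hopf \<Rightarrow> 'h fdmod \<Rightarrow> 'h fdmod \<Rightarrow> 'h fdmod"
  where "mod_sum H M N =
    (fst M + fst N,
     \<lambda>h\<in>carrier H. four_block_mat (snd M h) (0\<^sub>m (fst M) (fst N)) (0\<^sub>m (fst N) (fst M)) (snd N h))"

text \<open>The Kronecker product is the matrix of the tensor product of two endomorphisms, in the
  lexicographically ordered basis of elementary tensors.\<close>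

definition kron :: "complex mat \<Rightarrow> complex mat \<Rightarrow> complex mat"
  where "kron A B =
    mat (dim_row A * dim_row B) (dim_col A * dim_col B)
      (\<lambda>(i, j). A $$ (i div dim_row B, j div dim_col B) * B $$ (i mod dim_row B, j mod dim_col B))"

text \<open>On \<open>M \<otimes> N\<close>, \<open>h\<close> acts by the image of its coproduct under the linear map on the tensor
  square of \<open>H\<close> that sends \<open>a \<otimes> b\<close> to the tensor product of the actions of \<open>a\<close> and \<open>b\<close>.\<close>

definition mod_tensor :: "'h hopf \<Rightarrow> 'h fdmod \<Rightarrow> 'h fdmod \<Rightarrow> 'h fdmod"
  where "mod_tensor H M N =
    (fst M * fst N,
     \<lambda>h\<in>carrier H. induced (mat_alg (fst M * fst N)) (\<lambda>(a, b). kron (snd M a) (snd N b)) (comult H h))"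

definition mod_unit :: "'h hopf \<Rightarrow> 'h fdmod"
  where "mod_unit H = (1, \<lambda>h\<in>carrier H. counit H h \<cdot>\<^sub>m 1\<^sub>m 1)"

definition indecomposable :: "'h hopf \<Rightarrow> 'h fdmod \<Rightarrow> bool"
  where "indecomposable H M \<longleftrightarrow> fd_module H M \<and> fst M \<noteq> 0 \<and>
    (\<forall>N P. fd_module H N \<and> fd_module H P \<and> mod_iso H M (mod_sum H N P) \<longrightarrow> fst N = 0 \<or> fst P = 0)"

definition pullback :: "'h hopf \<Rightarrow> ('h \<Rightarrow> 'k) \<Rightarrow> 'k fdmod \<Rightarrow> 'h fdmod"
  where "pullback H f M = (fst M, \<lambda>h\<in>carrier H. snd M (f h))"


section \<open>Green rings\<close>

definition iso_class :: "'h hopf \<Rightarrow> 'h fdmod \<Rightarrow> 'h fdmod set"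
  where "iso_class H M = {N. fd_module H N \<and> mod_iso H M N}"

definition iso_monoid :: "'h hopf \<Rightarrow> 'h fdmod set monoid"
  where "iso_monoid H =
    \<lparr>carrier = {iso_class H M | M. fd_module H M},
     monoid.mult = (\<lambda>C D. \<Union>M\<in>C. \<Union>N\<in>D. iso_class H (mod_tensor H M N)),
     one = iso_class H (mod_unit H)\<rparr>"

text \<open>The free abelian group on the isomorphism classes, with the product extended bilinearly
  from \<open>[M] [N] = [M \<otimes> N]\<close>.\<close>

definition free_green :: "'h hopf \<Rightarrow> (int, 'h fdmod set \<Rightarrow>\<^sub>0 int) module"
  where "free_green H = monoid_ring (iso_monoid H)"

definition green_rels :: "'h hopf \<Rightarrow> ('h fdmod set \<Rightarrow>\<^sub>0 int) set"
  where "green_rels H =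
    {Poly_Mapping.single (iso_class H (mod_sum H M N)) 1
       - Poly_Mapping.single (iso_class H M) 1 - Poly_Mapping.single (iso_class H N) 1 | M N.
     fd_module H M \<and> fd_module H N}"

definition green_sub :: "'h hopf \<Rightarrow> ('h fdmod set \<Rightarrow>\<^sub>0 int) set"
  where "green_sub H = generate (add_monoid (free_green H)) (green_rels H)"

definition green_ring :: "'h hopf \<Rightarrow> ('h fdmod set \<Rightarrow>\<^sub>0 int) set ring"
  where "green_ring H = free_green H Quot green_sub H"

definition green_class :: "'h hopf \<Rightarrow> 'h fdmod \<Rightarrow> ('h fdmod set \<Rightarrow>\<^sub>0 int) set"
  where "green_class H M =
    green_sub H +>\<^bsub>free_green H\<^esub> Poly_Mapping.single (iso_class H M) 1"

definition K_eq_K' :: "nat \<Rightarrow> (dk_gen list \<Rightarrow>\<^sub>0 complex) set fdmod \<Rightarrow> bool"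
  where "K_eq_K' n M \<longleftrightarrow>
    (\<forall>v \<in> carrier_vec (fst M). mod_act M (dk_el n DK) v = mod_act M (dk_el n DK') v)"

text \<open>The carrier of the subring additively generated by the classes of the modules on which
  the two group-like generators act by the same endomorphism.\<close>

definition green_ring_DK0 :: "nat \<Rightarrow> ((dk_gen list \<Rightarrow>\<^sub>0 complex) set fdmod set \<Rightarrow>\<^sub>0 int) set set"
  where "green_ring_DK0 n =
    generate (add_monoid (green_ring (nichols_double n)))
      {green_class (nichols_double n) M | M. fd_module (nichols_double n) M \<and> K_eq_K' n M}"

end

theory Submission
  imports Defs "Jordan_Normal_Form.Determinant"
begin

text \<open>
  Pulling back along the projection identifies the modules over the Nichols Hopf algebra with the
  modules over the double on which \<open>K\<close> and \<open>K'\<close> act equally, and it respects direct sums and tensor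
  products on the nose. It therefore induces a ring homomorphism from the free ring on the
  isomorphism classes onto \<open>r(DK\<^sub>n)\<^sub>0\<close>, and only its kernel is at stake. Since \<open>K K'\<close> is a central
  involution of the double, \<open>M \<mapsto> (1 + K K')/2 \<cdot> M\<close> is an additive functor back to modules over the
  Nichols Hopf algebra, left inverse to the pullback. It sends the relations \<open>[M \<oplus> N] = [M] + [N]\<close>
  of the double to relations of the same kind, so an element that dies in the Green ring of
  the double is already zero in \<open>r(K\<^sub>2\<^sub>n)\<close>; the Krull-Schmidt theorem is not needed.
\<close>


section \<open>Kronecker products and splittings of idempotent matrices\<close>

text \<open>The retraction can only be additive. \<open>K K'\<close> is group-like, so on a tensor
  product it acts by the tensor product of its actions, and two modules on which it acts as -1 have
  a tensor product on which it acts as 1. Taking the summand therefore does not commute with tensor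
  products; it is used as a map of abelian groups, with the single purpose of detecting the kernel
  of a ring homomorphism that comes from the pullback. The summand is the image of an idempotent
  matrix and has no preferred basis, while modules here are families of matrices. So the summand is
  handled as a relation, a splitting of the idempotent that is unique up to isomorphism, and a
  choice is made only at the level of isomorphism classes. The pullback keeps the dimension, and
  what it respects it respects as an equality of matrices. Neither tensor products nor the
  projection make sense until the prescribed values on generators are known to satisfy the relators;
  these checks go through the universal properties of monoid rings, quotients and tensor
  products.\<close>

lemma kron_carrier [simp, intro]:
  assumes "A \<in> carrier_mat a b" "B \<in> carrier_mat c d"
  shows "kron A B \<in> carrier_mat (a * c) (b * d)"
  using assms by (auto simp: kron_def)

lemma dim_kron [simp]:
  "dim_row (kron A B) = dim_row A * dim_row B" "dim_col (kron A B) = dim_col A * dim_col B"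
  by (simp_all add: kron_def)

lemma index_kron:
  assumes "A \<in> carrier_mat a b" "B \<in> carrier_mat c d" "i < a * c" "j < b * d"
  shows "kron A B $$ (i, j) = A $$ (i div c, j div d) * B $$ (i mod c, j mod d)"
  using assms by (auto simp: kron_def)

lemma div_mod_less:
  fixes i :: nat
  assumes "i < a * c"
  shows "i div c < a" "i mod c < c"
proof -
  have "c > 0" using assms by (cases c) auto
  then show "i div c < a" "i mod c < c" using assms
    by (simp_all add: less_mult_imp_div_less)
qed

lemma kron_add_left:
  assumes "A \<in> carrier_mat a b" "A' \<in> carrier_mat a b" "B \<in> carrier_mat c d"
  shows "kron (A + A') B = kron A B + kron A' B"
  using assms by (intro eq_matI) (auto simp: kron_def div_mod_less algebra_simps)

lemma kron_add_right:
  assumes "A \<in> carrier_mat a b" "B \<in> carrier_mat c d" "B' \<in> carrier_mat c d"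
  shows "kron A (B + B') = kron A B + kron A B'"
proof (intro eq_matI)
  fix i j assume "i < dim_row (kron A B + kron A B')" "j < dim_col (kron A B + kron A B')"
  then have ij: "i < a * c" "j < b * d" using assms by auto
  show "kron A (B + B') $$ (i, j) = (kron A B + kron A B') $$ (i, j)"
    using assms ij div_mod_less[OF ij(1)] div_mod_less[OF ij(2)]
    by (simp add: kron_def algebra_simps)
qed (use assms in auto)

lemma kron_smult_left:
  assumes "A \<in> carrier_mat a b" "B \<in> carrier_mat c d"
  shows "kron (k \<cdot>\<^sub>m A) B = k \<cdot>\<^sub>m kron A B"
  using assms by (intro eq_matI) (auto simp: kron_def div_mod_less)

lemma kron_smult_right:
  assumes "A \<in> carrier_mat a b" "B \<in> carrier_mat c d"
  shows "kron A (k \<cdot>\<^sub>m B) = k \<cdot>\<^sub>m kron A B"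
  using assms by (intro eq_matI) (auto simp: kron_def div_mod_less)

lemma kron_zero_left [simp]:
  assumes "B \<in> carrier_mat c d"
  shows "kron (0\<^sub>m a b) B = 0\<^sub>m (a * c) (b * d)"
  using assms by (intro eq_matI) (auto simp: kron_def div_mod_less)

lemma kron_zero_right [simp]:
  assumes "A \<in> carrier_mat a b"
  shows "kron A (0\<^sub>m c d) = 0\<^sub>m (a * c) (b * d)"
  using assms by (intro eq_matI) (auto simp: kron_def div_mod_less)

lemma kron_one [simp]: "kron (1\<^sub>m a) (1\<^sub>m b) = 1\<^sub>m (a * b)"
proof (intro eq_matI)
  fix i j assume "i < dim_row (1\<^sub>m (a * b) :: complex mat)" "j < dim_col (1\<^sub>m (a * b) :: complex mat)"
  then have ij: "i < a * b" "j < a * b" by auto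
  have "i = j \<longleftrightarrow> i div b = j div b \<and> i mod b = j mod b"
    by (metis mult_div_mod_eq)
  then show "kron (1\<^sub>m a) (1\<^sub>m b) $$ (i, j) = 1\<^sub>m (a * b) $$ (i, j)"
    using ij by (simp add: kron_def div_mod_less)
qed auto

text \<open>Writing \<open>k\<close> as \<open>(k div d) * d + k mod d\<close> splits the inner
  index of a product of Kronecker products into one inner index per factor.\<close>

lemma sum_div_mod:
  fixes f :: "nat \<Rightarrow> nat \<Rightarrow> 'x::comm_monoid_add"
  shows "(\<Sum>k<b * d. f (k div d) (k mod d)) = (\<Sum>i<b. \<Sum>j<d. f i j)"
proof -
  have "(\<Sum>k<b * d. f (k div d) (k mod d)) = (\<Sum>i<b. sum (\<lambda>k. f (k div d) (k mod d)) {i * d..<i * d + d})"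
    by (simp add: sum.nat_group)
  also have "\<dots> = (\<Sum>i<b. \<Sum>j<d. f i j)"
  proof (rule sum.cong[OF refl])
    fix i
    have "sum (\<lambda>k. f (k div d) (k mod d)) {i * d..<i * d + d} = (\<Sum>j<d. f ((j + i * d) div d) ((j + i * d) mod d))"
      using sum.shift_bounds_nat_ivl[of "\<lambda>k. f (k div d) (k mod d)" 0 "i * d" d]
      by (simp add: add.commute lessThan_atLeast0)
    also have "\<dots> = (\<Sum>j<d. f i j)" by (intro sum.cong) auto
    finally show "sum (\<lambda>k. f (k div d) (k mod d)) {i * d..<i * d + d} = (\<Sum>j<d. f i j)" .
  qed
  finally show ?thesis .
qed

lemma kron_mult:
  assumes "A \<in> carrier_mat a b" "B \<in> carrier_mat c d" "A' \<in> carrier_mat b e" "B' \<in> carrier_mat d f"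
  shows "kron A B * kron A' B' = kron (A * A') (B * B')"
proof (intro eq_matI)
  fix i j assume "i < dim_row (kron (A * A') (B * B'))" "j < dim_col (kron (A * A') (B * B'))"
  then have ij: "i < a * c" "j < e * f" using assms by auto
  note dm = div_mod_less[OF ij(1)] div_mod_less[OF ij(2)]
  have "(kron A B * kron A' B') $$ (i, j) = (\<Sum>k<b * d. kron A B $$ (i, k) * kron A' B' $$ (k, j))"
    using assms ij by (simp add: scalar_prod_def lessThan_atLeast0)
  also have "\<dots> = (\<Sum>k<b * d. (A $$ (i div c, k div d) * A' $$ (k div d, j div f))
      * (B $$ (i mod c, k mod d) * B' $$ (k mod d, j mod f)))"
    using assms ij by (intro sum.cong) (auto simp: index_kron)
  also have "\<dots> = (\<Sum>k<b. \<Sum>l<d. (A $$ (i div c, k) * A' $$ (k, j div f))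
      * (B $$ (i mod c, l) * B' $$ (l, j mod f)))"
    by (rule sum_div_mod)
  also have "\<dots> = (\<Sum>k<b. A $$ (i div c, k) * A' $$ (k, j div f)) * (\<Sum>l<d. B $$ (i mod c, l) * B' $$ (l, j mod f))"
    by (simp add: sum_product)
  also have "\<dots> = kron (A * A') (B * B') $$ (i, j)"
    using assms ij dm by (simp add: kron_def scalar_prod_def lessThan_atLeast0)
  finally show "(kron A B * kron A' B') $$ (i, j) = kron (A * A') (B * B') $$ (i, j)" .
qed (use assms in auto)

text \<open>The lexicographic order on triples of indices does not depend on the bracketing. This
  equality, rather than an isomorphism, is what makes tensor products of modules strictly
  associative later on.\<close>

lemma kron_assoc: "kron (kron A B) C = kron A (kron B C)"
proof (intro eq_matI)
  define a b c d e f where "a = dim_row A" "b = dim_col A" "c = dim_row B" "d = dim_col B"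
    "e = dim_row C" "f = dim_col C"
  note defs = this
  fix i j assume "i < dim_row (kron A (kron B C))" "j < dim_col (kron A (kron B C))"
  then have i: "i < a * (c * e)" and j: "j < b * (d * f)" using defs by auto
  have i': "i < (a * c) * e" and j': "j < (b * d) * f" using i j by (simp_all add: mult.assoc)
  note dm = div_mod_less[OF i] div_mod_less[OF j] div_mod_less[OF i'] div_mod_less[OF j']
  \<comment> \<open>The digits of \<open>k\<close> in mixed radix: both bracketings read off the
    same three digits of an index.\<close>
  have x: "k div (p * q) = k div q div p" "k mod (p * q) div q = k div q mod p"
    "k mod (p * q) mod q = k mod q" if "q > 0" for k p q :: nat
  proof -
    show "k div (p * q) = k div q div p" by (metis div_mult2_eq mult.commute)
    have *: "k mod (p * q) = q * (k div q mod p) + k mod q" by (metis mod_mult2_eq mult.commute)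
    show "k mod (p * q) div q = k div q mod p" unfolding * using that by simp
    show "k mod (p * q) mod q = k mod q" unfolding * by simp
  qed
  have "e > 0" "f > 0" using i j by (auto intro!: Nat.gr0I)
  with i j i' j' dm show "kron (kron A B) C $$ (i, j) = kron A (kron B C) $$ (i, j)"
    unfolding kron_def defs[symmetric] by (simp add: x defs[symmetric])
qed (simp_all add: mult.assoc)

lemma kron_one_left [simp]:
  assumes "A \<in> carrier_mat a b"
  shows "kron (1\<^sub>m 1) A = A"
  using assms by (intro eq_matI) (auto simp: kron_def)

lemma kron_one_right [simp]:
  assumes "A \<in> carrier_mat a b"
  shows "kron A (1\<^sub>m 1) = A"
  using assms by (intro eq_matI) (auto simp: kron_def)

text \<open>Both products have the same trace, and in characteristic zero the trace of an identity
  matrix determines its size. This lets isomorphisms be described by rectangular intertwiners, with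
  no prior knowledge that the dimensions agree.\<close>

lemma inverse_mats_dim_eq:
  fixes P Q :: "complex mat"
  assumes P: "P \<in> carrier_mat a b" and Q: "Q \<in> carrier_mat b a"
    and "P * Q = 1\<^sub>m a" "Q * P = 1\<^sub>m b"
  shows "a = b"
proof -
  have "(\<Sum>i<a. (P * Q) $$ (i, i)) = (\<Sum>i<a. \<Sum>j<b. P $$ (i, j) * Q $$ (j, i))"
    using P Q by (intro sum.cong) (auto simp: scalar_prod_def lessThan_atLeast0)
  also have "\<dots> = (\<Sum>j<b. \<Sum>i<a. Q $$ (j, i) * P $$ (i, j))"
    by (subst sum.swap) (simp add: mult.commute)
  also have "\<dots> = (\<Sum>j<b. (Q * P) $$ (j, j))"
    using P Q by (intro sum.cong) (auto simp: scalar_prod_def lessThan_atLeast0)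
  finally have "(of_nat a :: complex) = of_nat b" by (simp add: assms)
  then show ?thesis by simp
qed

text \<open>A kernel vector \<open>v\<close> with nonzero entry at \<open>i\<close> expresses column
  \<open>i\<close> of \<open>W\<close> through the other columns. \<open>A\<close> is
  \<open>W\<close> without that column, and \<open>B\<close> puts it back.\<close>

lemma singular_factorization:
  fixes W :: "complex mat"
  assumes W: "W \<in> carrier_mat r r" and det: "det W = 0"
  obtains s A B where "s < r" "A \<in> carrier_mat r s" "B \<in> carrier_mat s r" "W = A * B"
proof -
  obtain v where v: "v \<in> carrier_vec r" "v \<noteq> 0\<^sub>v r" "W *\<^sub>v v = 0\<^sub>v r"
    using det det_0_iff_vec_prod_zero_field[OF W] by auto
  then obtain i where i: "i < r" "v $ i \<noteq> 0"
    by (metis carrier_vecD eq_vecI index_zero_vec(1) index_zero_vec(2))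
  \<comment> \<open>Enumerates the indices below \<open>r\<close> other than
    \<open>i\<close>.\<close>
  define t where "t = (\<lambda>b::nat. if b < i then b else b + 1)"
  have bij: "bij_betw t {..<r - 1} ({..<r} - {i})"
  proof (rule bij_betw_imageI)
    show "inj_on t {..<r - 1}" by (auto simp: inj_on_def t_def split: if_splits)
    show "t ` {..<r - 1} = {..<r} - {i}"
    proof
      show "t ` {..<r - 1} \<subseteq> {..<r} - {i}" using i by (auto simp: t_def)
      show "{..<r} - {i} \<subseteq> t ` {..<r - 1}"
      proof
        fix k assume k: "k \<in> {..<r} - {i}"
        show "k \<in> t ` {..<r - 1}"
          using k i by (cases "k < i") (auto simp: t_def image_iff intro: bexI[of _ k] bexI[of _ "k - 1"])
      qed
    qed
  qed
  define A where "A = mat r (r - 1) (\<lambda>(a, b). W $$ (a, t b))"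
  \<comment> \<open>Column \<open>i\<close> holds the coefficients obtained by solving
    \<open>W v = 0\<close> for that column of \<open>W\<close>; the other columns are unit
    vectors.\<close>
  define B where "B = mat (r - 1) r (\<lambda>(b, j). if j = i then - v $ t b / v $ i else if t b = j then 1 else 0)"
  have "W = A * B"
  proof (intro eq_matI)
    fix a j assume "a < dim_row (A * B)" "j < dim_col (A * B)"
    then have aj: "a < r" "j < r" by (auto simp: A_def B_def)
    have "(A * B) $$ (a, j) = (\<Sum>b<r - 1. (\<lambda>k. W $$ (a, k) * (if j = i then - v $ k / v $ i else if k = j then 1 else 0)) (t b))"
      using aj by (simp add: A_def B_def scalar_prod_def lessThan_atLeast0)
    also have "\<dots> = (\<Sum>k\<in>{..<r} - {i}. W $$ (a, k) * (if j = i then - v $ k / v $ i else if k = j then 1 else 0))"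
      by (rule sum.reindex_bij_betw[OF bij])
    also have "\<dots> = W $$ (a, j)"
    proof (cases "j = i")
      case True
      have "(W *\<^sub>v v) $ a = (\<Sum>k<r. W $$ (a, k) * v $ k)"
        using W v(1) aj by (simp add: scalar_prod_def lessThan_atLeast0)
      then have "0 = (\<Sum>k<r. W $$ (a, k) * v $ k)" using v(3) aj by simp
      also have "\<dots> = W $$ (a, i) * v $ i + (\<Sum>k\<in>{..<r} - {i}. W $$ (a, k) * v $ k)"
        using i by (simp add: sum.remove)
      finally have "W $$ (a, i) * v $ i = - (\<Sum>k\<in>{..<r} - {i}. W $$ (a, k) * v $ k)"
        by (simp add: eq_neg_iff_add_eq_0)
      then have "W $$ (a, i) = - (\<Sum>k\<in>{..<r} - {i}. W $$ (a, k) * v $ k) / v $ i"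
        using i by (simp add: field_simps)
      then show ?thesis using True by (simp add: sum_divide_distrib sum_negf)
    next
      case False
      then have "(\<Sum>k\<in>{..<r} - {i}. W $$ (a, k) * (if j = i then - v $ k / v $ i else if k = j then 1 else 0))
        = (\<Sum>k\<in>{..<r} - {i}. if k = j then W $$ (a, k) else 0)"
        by (intro sum.cong) auto
      then show ?thesis using False aj by simp
    qed
    finally show "W $$ (a, j) = (A * B) $$ (a, j)" by simp
  qed (use W in \<open>auto simp: A_def B_def\<close>)
  then show thesis using i by (intro that[of "r - 1" A B]) (auto simp: A_def B_def)
qed

text \<open>The side conditions mention only dimensions, so as a rewrite rule it rebrackets any
  product once the dimensions of the factors are simp rules; no carrier set has to be supplied by
  hand.\<close>

lemma mat_assoc_dim:
  assumes "dim_col A = dim_row B" "dim_col B = dim_row C"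
  shows "(A * B) * C = A * (B * C :: 'a::semiring_0 mat)"
  using assms by (intro assoc_mult_mat) auto

text \<open>Factor \<open>E = U V\<close> through the least possible dimension \<open>r\<close>. Then \<open>W = V U\<close> satisfies
  \<open>W\<^sup>3 = W\<^sup>2\<close>, and it is invertible, because a singular \<open>W\<close> would factor \<open>E\<close> through a smaller
  dimension. Hence \<open>W = 1\<close>.\<close>

lemma idempotent_splits:
  fixes E :: "complex mat"
  assumes E: "E \<in> carrier_mat d d" "E * E = E"
  obtains r U V where "U \<in> carrier_mat d r" "V \<in> carrier_mat r d" "U * V = E" "V * U = 1\<^sub>m r"
proof -
  define P where "P = (\<lambda>r. \<exists>U V. U \<in> carrier_mat d r \<and> V \<in> carrier_mat r d \<and> U * V = E)"
  have "P d" unfolding P_def using E by (intro exI[of _ "1\<^sub>m d"] exI[of _ E]) auto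
  define r where "r = (LEAST r. P r)"
  have "P r" unfolding r_def using \<open>P d\<close> by (rule LeastI)
  then obtain U V where UV: "U \<in> carrier_mat d r" "V \<in> carrier_mat r d" "U * V = E"
    unfolding P_def by auto
  define W where "W = V * U"
  have W: "W \<in> carrier_mat r r" using UV by (auto simp: W_def)
  note [simp] = carrier_matD[OF UV(1)] carrier_matD[OF UV(2)] carrier_matD[OF W]
  have "U * (W * V) = (U * V) * (U * V)"
    unfolding W_def by (simp add: mat_assoc_dim)
  then have EUWV: "E = U * (W * V)" using E UV(3) by simp
  have det: "det W \<noteq> 0"
  proof
    assume "det W = 0"
    then obtain s A B where s: "s < r" "A \<in> carrier_mat r s" "B \<in> carrier_mat s r" "W = A * B"
      using singular_factorization[OF W] by metis
    have "E = (U * A) * (B * V)"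
      using EUWV s UV by (simp add: mat_assoc_dim)
    moreover have "U * A \<in> carrier_mat d s" "B * V \<in> carrier_mat s d" using s UV by auto
    ultimately have "P s" unfolding P_def by metis
    then show False using s(1) unfolding r_def by (meson not_less_Least)
  qed
  obtain X where X: "X \<in> carrier_mat r r" "X * W = 1\<^sub>m r"
    using det_non_zero_imp_unit[OF W det, of "()"] by (auto simp: Units_def ring_mat_def)
  have "W * (W * W) = V * ((U * V) * (U * V)) * U"
    unfolding W_def by (simp add: mat_assoc_dim)
  also have "\<dots> = V * (U * V) * U" using E UV(3) by simp
  also have "\<dots> = W * W" unfolding W_def by (simp add: mat_assoc_dim)
  finally have WW: "W * (W * W) = W * W" .
  note [simp] = carrier_matD[OF X(1)]
  \<comment> \<open>\<open>X\<close> cancels a leading \<open>W\<close>. Applied to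
    \<open>W * (W * W) = W * W\<close> this gives \<open>W * W = W\<close>, and a second
    cancellation gives \<open>W = 1\<close>.\<close>
  have XWA: "X * (W * A) = A" if "dim_row A = r" for A
    using X W that by (simp flip: mat_assoc_dim del: assoc_mult_mat)
  have "W = X * (W * W)" by (simp add: XWA)
  also have "\<dots> = X * (W * (W * W))" using WW by simp
  also have "\<dots> = W * W" by (simp add: XWA)
  finally have W2: "W = W * W" .
  have "1\<^sub>m r = X * (W * W)" using X W2 by simp
  also have "\<dots> = W" by (simp add: XWA)
  finally have "V * U = 1\<^sub>m r" by (simp add: W_def)
  then show thesis using UV that by blast
qed

abbreviation "keys \<equiv> Poly_Mapping.keys"
abbreviation "lookup \<equiv> Poly_Mapping.lookup"
abbreviation "single \<equiv> Poly_Mapping.single"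

section \<open>Associative algebras and linear extension\<close>

text \<open>The scalars are a type and not a carrier set, and any commutative ring is allowed: the
  same results on linear extension serve the complex algebras and the free Green ring, whose
  coefficients are integers.\<close>

locale assoc_algebra = ring A
  for A :: "('c::comm_ring_1, 'a, 'm) module_scheme" (structure) +
  assumes smult_closed [simp, intro]: "x \<in> carrier A \<Longrightarrow> c \<odot> x \<in> carrier A"
    and smult_l_distr: "x \<in> carrier A \<Longrightarrow> (c + d) \<odot> x = c \<odot> x \<oplus> d \<odot> x"
    and smult_r_distr: "x \<in> carrier A \<Longrightarrow> y \<in> carrier A \<Longrightarrow> c \<odot> (x \<oplus> y) = c \<odot> x \<oplus> c \<odot> y"
    and smult_assoc: "x \<in> carrier A \<Longrightarrow> (c * d) \<odot> x = c \<odot> (d \<odot> x)"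
    and smult_one [simp]: "x \<in> carrier A \<Longrightarrow> 1 \<odot> x = x"
    and smult_mult_l: "x \<in> carrier A \<Longrightarrow> y \<in> carrier A \<Longrightarrow> (c \<odot> x) \<otimes> y = c \<odot> (x \<otimes> y)"
    and smult_mult_r: "x \<in> carrier A \<Longrightarrow> y \<in> carrier A \<Longrightarrow> x \<otimes> (c \<odot> y) = c \<odot> (x \<otimes> y)"
begin

lemma smult_zero [simp]: "x \<in> carrier A \<Longrightarrow> 0 \<odot> x = \<zero>"
  using smult_l_distr[of x 0 0] by (metis add.l_cancel_one' smult_closed add_0)

lemma smult_zero_right [simp]: "c \<odot> \<zero> = \<zero>"
  by (metis smult_assoc smult_zero zero_closed mult_zero_right)

lemma smult_minus: "x \<in> carrier A \<Longrightarrow> (- c) \<odot> x = \<ominus> (c \<odot> x)"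
  using smult_l_distr[of x "- c" c] by (simp add: minus_equality)

end

text \<open>The linear extension that \<open>induced\<close> applies to the members of a coset,
  before passing to the quotient. Over general coefficients it also extends maps on isomorphism
  classes additively.\<close>

definition linext :: "('c::comm_ring_1, 'b, 'n) module_scheme \<Rightarrow> ('a \<Rightarrow> 'b) \<Rightarrow> ('a \<Rightarrow>\<^sub>0 'c) \<Rightarrow> 'b"
  where "linext B f p = (\<Oplus>\<^bsub>B\<^esub>a\<in>keys p. lookup p a \<odot>\<^bsub>B\<^esub> f a)"

lemma induced_linext: "induced B f S = the_elem (linext B f ` S)"
  by (simp add: induced_def linext_def[abs_def])

lemma keys_add_subset:
  "keys p \<subseteq> S \<Longrightarrow> keys q \<subseteq> S \<Longrightarrow> keys (p + q) \<subseteq> S"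
  by (rule order_trans[OF Poly_Mapping.keys_add]) simp

lemma keys_diff_subset:
  fixes p q :: "'a \<Rightarrow>\<^sub>0 'c::comm_ring_1"
  shows "keys p \<subseteq> S \<Longrightarrow> keys q \<subseteq> S \<Longrightarrow> keys (p - q) \<subseteq> S"
  by (rule order_trans[OF keys_diff]) simp

text \<open>Reduces a statement about formal linear combinations to single terms. Keeping the
  support inside \<open>S\<close> in every case matters because the maps to be extended are
  controlled on a carrier only.\<close>

lemma poly_mapping_keys_induct [consumes 1, case_names zero single add]:
  fixes p :: "'a \<Rightarrow>\<^sub>0 'c::comm_monoid_add"
  assumes "keys p \<subseteq> S"
    and zero: "P 0"
    and single: "\<And>a c. a \<in> S \<Longrightarrow> P (single a c)"
    and add: "\<And>p q. keys p \<subseteq> S \<Longrightarrow> keys q \<subseteq> S \<Longrightarrow> P p \<Longrightarrow> P q \<Longrightarrow> P (p + q)"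
  shows "P p"
proof -
  have *: "P (\<Sum>a\<in>T. single a (lookup p a)) \<and>
     keys (\<Sum>a\<in>T. single a (lookup p a)) \<subseteq> S"
    if "finite T" "T \<subseteq> S" for T
    using that
  proof (induction T)
    case (insert a T)
    have "keys (single a (lookup p a)) \<subseteq> S"
      using insert by auto
    moreover from this have "keys (single a (lookup p a)
        + (\<Sum>a\<in>T. single a (lookup p a))) \<subseteq> S"
      using insert by (intro keys_add_subset) auto
    ultimately show ?case using insert by (auto intro!: add single)
  qed (auto intro: zero)
  have "p = (\<Sum>a\<in>keys p. single a (lookup p a))"
  proof (rule poly_mapping_eqI)
    fix k
    have "(\<Sum>a\<in>keys p. lookup (single a (lookup p a)) k)
      = (\<Sum>a\<in>keys p. if a = k then lookup p k else 0)"
      by (intro sum.cong) (auto simp: lookup_single when_def)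
    then show "lookup p k = lookup (\<Sum>a\<in>keys p. single a (lookup p a)) k"
      by (auto simp: lookup_sum in_keys_iff)
  qed
  then show ?thesis using *[of "keys p"] assms(1) by simp
qed

lemma lookup_scale: "lookup (Poly_Mapping.map ((*) c) p) k = c * lookup p k"
  for c :: "'c::comm_ring_1"
  by (simp add: map.rep_eq when_def)

lemma keys_scale: "keys (Poly_Mapping.map ((*) c) p) \<subseteq> keys p"
  for c :: "'c::comm_ring_1"
  by (auto simp: in_keys_iff lookup_scale)

lemma scale_zero [simp]: "Poly_Mapping.map ((*) c) 0 = 0" for c :: "'c::comm_ring_1"
  by (simp add: poly_mapping_eqI lookup_scale)

context assoc_algebra
begin

text \<open>Indices outside the support contribute zero, so two combinations can be evaluated over a
  common index set even when terms cancel in their sum.\<close>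

lemma linext_superset:
  assumes "finite T" "keys p \<subseteq> T" "f \<in> T \<rightarrow> carrier A"
  shows "linext A f p = (\<Oplus>a\<in>T. lookup p a \<odot> f a)"
  unfolding linext_def
proof (rule add.finprod_mono_neutral_cong_left)
  show "lookup p i \<odot> f i = \<zero>" if "i \<in> T - keys p" for i
    using that assms by (auto simp: in_keys_iff Pi_iff)
qed (use assms in auto)

lemma linext_closed:
  assumes "keys p \<subseteq> S" "f \<in> S \<rightarrow> carrier A"
  shows "linext A f p \<in> carrier A"
  unfolding linext_def using assms by (intro finsum_closed) auto

lemma linext_zero [simp]: "linext A f 0 = \<zero>"
  by (simp add: linext_def)

lemma linext_single [simp]:
  assumes "f a \<in> carrier A"
  shows "linext A f (single a c) = c \<odot> f a"
  using linext_superset[of "{a}" "single a c" f] assms by simp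

lemma linext_add:
  assumes "keys p \<subseteq> S" "keys q \<subseteq> S" "f \<in> S \<rightarrow> carrier A"
  shows "linext A f (p + q) = linext A f p \<oplus> linext A f q"
proof -
  let ?T = "keys p \<union> keys q"
  have f: "f \<in> ?T \<rightarrow> carrier A" using assms by auto
  have "linext A f (p + q) = (\<Oplus>a\<in>?T. lookup (p + q) a \<odot> f a)"
    using f Poly_Mapping.keys_add[of p q] by (intro linext_superset) auto
  also have "\<dots> = (\<Oplus>a\<in>?T. lookup p a \<odot> f a \<oplus> lookup q a \<odot> f a)"
    using f by (intro finsum_cong') (auto simp: lookup_add smult_l_distr Pi_iff)
  also have "\<dots> = (\<Oplus>a\<in>?T. lookup p a \<odot> f a) \<oplus> (\<Oplus>a\<in>?T. lookup q a \<odot> f a)"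
    using f by (intro finsum_addf) (auto simp: Pi_iff)
  also have "\<dots> = linext A f p \<oplus> linext A f q"
    using f by (simp add: linext_superset[of ?T])
  finally show ?thesis .
qed

lemma linext_scale:
  assumes "keys p \<subseteq> S" "f \<in> S \<rightarrow> carrier A"
  shows "linext A f (Poly_Mapping.map ((*) c) p) = c \<odot> linext A f p"
  using assms(1)
proof (induction rule: poly_mapping_keys_induct)
  case (single a d)
  have "Poly_Mapping.map ((*) c) (single a d) = single a (c * d)"
    by (simp add: poly_mapping_eqI lookup_scale lookup_single when_def)
  then show ?case using single assms by (auto simp: smult_assoc Pi_iff)
next
  case (add p q)
  have "Poly_Mapping.map ((*) c) (p + q) = Poly_Mapping.map ((*) c) p + Poly_Mapping.map ((*) c) q"
    by (simp add: poly_mapping_eqI lookup_scale lookup_add algebra_simps)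
  moreover have "keys (Poly_Mapping.map ((*) c) p) \<subseteq> S"
     "keys (Poly_Mapping.map ((*) c) q) \<subseteq> S" using add by (auto intro!: order_trans[OF keys_scale])
  ultimately show ?case
    using add assms by (simp add: linext_add[of _ S] linext_closed[of _ S] smult_r_distr)
qed simp

lemma linext_uminus:
  assumes "keys p \<subseteq> S" "f \<in> S \<rightarrow> carrier A"
  shows "linext A f (- p) = \<ominus> linext A f p"
proof -
  have "- p = Poly_Mapping.map ((*) (- 1)) p" by (simp add: poly_mapping_eqI lookup_scale)
  then show ?thesis using assms by (simp add: linext_scale linext_closed smult_minus)
qed

lemma linext_diff:
  assumes "keys p \<subseteq> S" "keys q \<subseteq> S" "f \<in> S \<rightarrow> carrier A"
  shows "linext A f (p - q) = linext A f p \<ominus> linext A f q"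
  using linext_add[of p S "- q" f] assms by (simp add: linext_uminus a_minus_def)

end


section \<open>Monoid rings\<close>

lemma monoid_ring_simps [simp]:
  "carrier (monoid_ring M) = {p. keys p \<subseteq> carrier M}"
  "one (monoid_ring M) = single \<one>\<^bsub>M\<^esub> 1"
  "ring.zero (monoid_ring M) = 0"
  "add (monoid_ring M) = (+)"
  "module.smult (monoid_ring M) = (\<lambda>c. Poly_Mapping.map ((*) c))"
  by (simp_all add: monoid_ring_def)

text \<open>The support of \<open>p + q\<close> can be smaller than the union of the supports. As
  \<open>h a 0 = 0\<close>, all three sums may be taken over that union. Both distributive laws of
  the monoid ring are instances.\<close>

lemma sum_keys_add:
  fixes h :: "'a \<Rightarrow> 'c::comm_ring_1 \<Rightarrow> 'b::comm_monoid_add"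
  assumes h0: "\<And>a. h a 0 = 0" and hadd: "\<And>a c d. h a (c + d) = h a c + h a d"
  shows "(\<Sum>a\<in>keys (p + q). h a (lookup (p + q) a)) =
    (\<Sum>a\<in>keys p. h a (lookup p a)) + (\<Sum>a\<in>keys q. h a (lookup q a))"
proof -
  let ?T = "keys p \<union> keys q"
  have *: "(\<Sum>a\<in>keys r. h a (lookup r a)) = (\<Sum>a\<in>?T. h a (lookup r a))"
    if "keys r \<subseteq> ?T" for r
    using that by (intro sum.mono_neutral_left) (auto simp: in_keys_iff h0)
  show ?thesis
    unfolding *[OF Poly_Mapping.keys_add] *[OF Un_upper1] *[OF Un_upper2]
    by (simp add: lookup_add hadd sum.distrib)
qed

lemma monoid_ring_mult_add_right:
  "p \<otimes>\<^bsub>monoid_ring M\<^esub> (q + r) = p \<otimes>\<^bsub>monoid_ring M\<^esub> q + p \<otimes>\<^bsub>monoid_ring M\<^esub> r"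
proof -
  have "(\<Sum>b\<in>keys (q + r). single (a \<otimes>\<^bsub>M\<^esub> b) (lookup p a * lookup (q + r) b))
    = (\<Sum>b\<in>keys q. single (a \<otimes>\<^bsub>M\<^esub> b) (lookup p a * lookup q b))
    + (\<Sum>b\<in>keys r. single (a \<otimes>\<^bsub>M\<^esub> b) (lookup p a * lookup r b))" for a
    by (rule sum_keys_add) (auto simp: algebra_simps single_add)
  then show ?thesis by (simp add: monoid_ring_def sum.distrib)
qed

lemma monoid_ring_mult_add_left:
  "(p + q) \<otimes>\<^bsub>monoid_ring M\<^esub> r = p \<otimes>\<^bsub>monoid_ring M\<^esub> r + q \<otimes>\<^bsub>monoid_ring M\<^esub> r"
  unfolding monoid_ring_def
  by (simp, rule sum_keys_add[where h = "\<lambda>a c. \<Sum>b\<in>keys r. single (a \<otimes>\<^bsub>M\<^esub> b) (c * lookup r b)"])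
    (auto simp: algebra_simps single_add sum.distrib)

lemma monoid_ring_mult_zero [simp]:
  "0 \<otimes>\<^bsub>monoid_ring M\<^esub> p = 0" "p \<otimes>\<^bsub>monoid_ring M\<^esub> 0 = 0"
  by (simp_all add: monoid_ring_def)

lemma monoid_ring_mult_single [simp]:
  "single a c \<otimes>\<^bsub>monoid_ring M\<^esub> single b d = single (a \<otimes>\<^bsub>M\<^esub> b) (c * d)"
  by (simp add: monoid_ring_def)

lemma (in monoid) monoid_ring_mult_closed:
  assumes "keys p \<subseteq> carrier G" "keys q \<subseteq> carrier G"
  shows "keys (p \<otimes>\<^bsub>monoid_ring G\<^esub> q) \<subseteq> carrier G"
  using assms(1)
proof (induction rule: poly_mapping_keys_induct)
  case (single a c)
  show ?case
    using assms(2)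
  proof (induction rule: poly_mapping_keys_induct)
    case (single b d)
    then show ?case using \<open>a \<in> carrier G\<close> by simp
  next
    case (add p q)
    then show ?case by (simp add: monoid_ring_mult_add_right keys_add_subset)
  qed simp
next
  case (add p q)
  then show ?case by (simp add: monoid_ring_mult_add_left keys_add_subset)
qed simp

text \<open>The multiplicative axioms are additive in each argument, so induction on supports
  reduces them to single terms, where they are laws of \<open>G\<close> and of the
  coefficients.\<close>

lemma (in monoid) assoc_algebra_monoid_ring:
  "assoc_algebra (monoid_ring G :: ('c::comm_ring_1, 'a \<Rightarrow>\<^sub>0 'c) module)"
proof -
  let ?R = "monoid_ring G :: ('c::comm_ring_1, 'a \<Rightarrow>\<^sub>0 'c) module"
  have add_closed: "keys (p + q) \<subseteq> carrier G"
    if "keys p \<subseteq> carrier G" "keys q \<subseteq> carrier G" for p q :: "'a \<Rightarrow>\<^sub>0 'c"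
    using that by (rule keys_add_subset)
  have assoc: "p \<otimes>\<^bsub>?R\<^esub> q \<otimes>\<^bsub>?R\<^esub> r = p \<otimes>\<^bsub>?R\<^esub> (q \<otimes>\<^bsub>?R\<^esub> r)"
    if "keys p \<subseteq> carrier G" "keys q \<subseteq> carrier G" "keys r \<subseteq> carrier G"
    for p q r
    using that(1)
  proof (induction rule: poly_mapping_keys_induct)
    case (single a c)
    note a = single
    show ?case
      using that(2)
    proof (induction rule: poly_mapping_keys_induct)
      case (single b d)
      note b = single
      show ?case
        using that(3)
      proof (induction rule: poly_mapping_keys_induct)
        case (single e f)
        then show ?case using a b by (simp add: m_assoc mult.assoc)
      qed (auto simp: monoid_ring_mult_add_right)
    qed (auto simp: monoid_ring_mult_add_left monoid_ring_mult_add_right)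
  qed (auto simp: monoid_ring_mult_add_left)
  have scale_add: "Poly_Mapping.map ((*) c) (p + q) = Poly_Mapping.map ((*) c) p + Poly_Mapping.map ((*) c) q"
    for c and p q :: "'a \<Rightarrow>\<^sub>0 'c"
    by (simp add: poly_mapping_eqI lookup_scale lookup_add algebra_simps)
  have scale_single: "Poly_Mapping.map ((*) c) (single a d) = single a (c * d)"
    for a :: 'a and c d :: 'c
    by (simp add: poly_mapping_eqI lookup_scale lookup_single when_def)
  have one_l: "\<one>\<^bsub>?R\<^esub> \<otimes>\<^bsub>?R\<^esub> p = p" if "keys p \<subseteq> carrier G" for p
    using that by (induction rule: poly_mapping_keys_induct) (auto simp: monoid_ring_mult_add_right)
  have one_r: "p \<otimes>\<^bsub>?R\<^esub> \<one>\<^bsub>?R\<^esub> = p" if "keys p \<subseteq> carrier G" for p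
    using that by (induction rule: poly_mapping_keys_induct) (auto simp: monoid_ring_mult_add_left)
  have scale_l: "Poly_Mapping.map ((*) c) p \<otimes>\<^bsub>?R\<^esub> q = Poly_Mapping.map ((*) c) (p \<otimes>\<^bsub>?R\<^esub> q)
     \<and> p \<otimes>\<^bsub>?R\<^esub> Poly_Mapping.map ((*) c) q = Poly_Mapping.map ((*) c) (p \<otimes>\<^bsub>?R\<^esub> q)"
    if "keys p \<subseteq> carrier G" "keys q \<subseteq> carrier G" for c p q
    using that(1)
  proof (induction rule: poly_mapping_keys_induct)
    case (single a d)
    show ?case
      using that(2)
    proof (induction rule: poly_mapping_keys_induct)
      case (single b e)
      then show ?case by (simp add: scale_single ac_simps)
    qed (auto simp: monoid_ring_mult_add_right scale_add)
  qed (auto simp: monoid_ring_mult_add_left scale_add)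
  have ring: "ring ?R"
  proof (rule ringI)
    show "abelian_group ?R"
    proof (rule abelian_groupI)
      fix x assume "x \<in> carrier ?R"
      then show "\<exists>y\<in>carrier ?R. y \<oplus>\<^bsub>?R\<^esub> x = \<zero>\<^bsub>?R\<^esub>"
        by (intro bexI[of _ "- x"]) (auto simp: in_keys_iff)
    qed (auto simp: add_closed algebra_simps)
    show "monoid ?R"
      using one_l one_r by (intro monoidI) (simp_all add: assoc monoid_ring_mult_closed)
  qed (auto simp: monoid_ring_mult_add_left monoid_ring_mult_add_right)
  show ?thesis
  proof (intro assoc_algebra.intro ring assoc_algebra_axioms.intro)
    show "c \<odot>\<^bsub>?R\<^esub> x \<in> carrier ?R" if "x \<in> carrier ?R" for c x
      using that order_trans[OF keys_scale] by simp
  qed (use scale_l in \<open>auto simp: scale_add poly_mapping_eqI lookup_scale lookup_add algebra_simps\<close>)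
qed

context assoc_algebra
begin

lemma linext_mult:
  assumes M: "monoid M" and f: "f \<in> carrier M \<rightarrow> carrier A"
    and f_mult: "\<And>x y. x \<in> carrier M \<Longrightarrow> y \<in> carrier M \<Longrightarrow> f (x \<otimes>\<^bsub>M\<^esub> y) = f x \<otimes> f y"
    and p: "keys p \<subseteq> carrier M" and q: "keys q \<subseteq> carrier M"
  shows "linext A f (p \<otimes>\<^bsub>monoid_ring M\<^esub> q) = linext A f p \<otimes> linext A f q"
proof -
  interpret M: monoid M by fact
  have fc: "f x \<in> carrier A" if "x \<in> carrier M" for x using f that by auto
  note cl = M.monoid_ring_mult_closed linext_closed[OF _ f] linext_add[OF _ _ f]
  show ?thesis
    using p
  proof (induction rule: poly_mapping_keys_induct)
    case (single a c)
    note a = single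
    show ?case
      using q
    proof (induction rule: poly_mapping_keys_induct)
      case (single b d)
      then show ?case using a
        by (simp add: fc f_mult smult_mult_l smult_mult_r mult.commute flip: smult_assoc)
    next
      case (add q r)
      then show ?case using a
        by (simp add: monoid_ring_mult_add_right cl fc r_distr)
    qed (simp add: fc a)
  next
    case (add p r)
    then show ?case using q
      by (simp add: monoid_ring_mult_add_left cl fc l_distr)
  qed (simp add: cl q)
qed

text \<open>The universal property of a monoid ring.\<close>

lemma linext_ring_hom:
  assumes "monoid M" "f \<in> carrier M \<rightarrow> carrier A"
    and "\<And>x y. x \<in> carrier M \<Longrightarrow> y \<in> carrier M \<Longrightarrow> f (x \<otimes>\<^bsub>M\<^esub> y) = f x \<otimes> f y"
    and "f \<one>\<^bsub>M\<^esub> = \<one>"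
  shows "linext A f \<in> Ring.ring_hom (monoid_ring M) A"
  using assms by (intro ring_hom_memI)
    (auto simp: linext_closed linext_add linext_mult)

end


section \<open>Quotient algebras\<close>

lemma quot_alg_simps [simp]:
  "carrier (quot_alg A I) = carrier (A Quot I)" "monoid.mult (quot_alg A I) = monoid.mult (A Quot I)"
  "one (quot_alg A I) = one (A Quot I)" "ring.zero (quot_alg A I) = ring.zero (A Quot I)"
  "add (quot_alg A I) = add (A Quot I)"
  by (simp_all add: quot_alg_def)

lemma (in ideal) quot_carrierE:
  assumes "S \<in> carrier (R Quot I)"
  obtains x where "x \<in> carrier R" "S = I +> x"
  using assms by (auto simp: FactRing_def A_RCOSETS_def RCOSETS_def a_r_coset_def)

lemma (in ideal) quot_simps:
  shows "x \<in> carrier R \<Longrightarrow> I +> x \<in> carrier (R Quot I)"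
    and "x \<in> carrier R \<Longrightarrow> y \<in> carrier R \<Longrightarrow> (I +> x) \<otimes>\<^bsub>R Quot I\<^esub> (I +> y) = I +> (x \<otimes> y)"
    and "x \<in> carrier R \<Longrightarrow> y \<in> carrier R \<Longrightarrow> (I +> x) \<oplus>\<^bsub>R Quot I\<^esub> (I +> y) = I +> (x \<oplus> y)"
    and "\<one>\<^bsub>R Quot I\<^esub> = I +> \<one>" and "\<zero>\<^bsub>R Quot I\<^esub> = I"
  by (auto simp: FactRing_def rcoset_mult_add a_rcos_sum a_rcosetsI a_subset)

lemma (in ideal) coset_eq_iff:
  assumes "x \<in> carrier R" "y \<in> carrier R"
  shows "I +> x = I +> y \<longleftrightarrow> x \<ominus> y \<in> I"
  using assms quotient_eq_iff_same_a_r_cos[OF ideal_axioms] by auto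

context assoc_algebra
begin

text \<open>Since \<open>c x = (c 1) x\<close>, a ring ideal is a linear subspace; this is what lets
  the scalars act on the quotient.\<close>

lemma ideal_smult_closed:
  assumes "ideal I A" "x \<in> I"
  shows "c \<odot> x \<in> I"
proof -
  interpret I: ideal I A by fact
  have "x \<in> carrier A" using assms I.Icarr by auto
  then have "c \<odot> x = (c \<odot> \<one>) \<otimes> x" by (simp add: smult_mult_l)
  then show ?thesis using assms by (simp add: I.I_l_closed)
qed

text \<open>The scalar action on cosets is defined as a union over all representatives; the cosets
  in that union all coincide because the ideal is stable under scalars.\<close>

lemma quot_smult:
  assumes "ideal I A" "x \<in> carrier A"
  shows "c \<odot>\<^bsub>quot_alg A I\<^esub> (I +> x) = I +> (c \<odot> x)"
proof -
  interpret I: ideal I A by fact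
  have "I +> (c \<odot> s) = I +> (c \<odot> x)" if "s \<in> I +> x" for s
  proof -
    obtain i where i: "i \<in> I" "s = i \<oplus> x" using \<open>s \<in> I +> x\<close> by (auto simp: a_r_coset_def')
    have ic: "i \<in> carrier A" using i I.Icarr by auto
    have "c \<odot> s \<ominus> c \<odot> x = c \<odot> i"
      using ic i assms by (simp add: smult_r_distr a_minus_def a_assoc r_neg)
    then show ?thesis
      using ic i assms ideal_smult_closed[OF assms(1) i(1)] by (subst I.coset_eq_iff) auto
  qed
  then have "(\<Union>s\<in>I +> x. I +> (c \<odot> s)) = (\<Union>s\<in>I +> x. I +> (c \<odot> x))"
    by (intro SUP_cong) auto
  moreover have "I +> x \<noteq> {}" using assms I.a_rcos_self[of x] by blast
  ultimately show ?thesis by (simp add: quot_alg_def)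
qed

lemma assoc_algebra_quot:
  assumes "ideal I A"
  shows "assoc_algebra (quot_alg A I)"
proof -
  interpret I: ideal I A by fact
  interpret Q: ring "A Quot I" by (rule I.quotient_is_ring)
  have ring: "ring (quot_alg A I)"
  proof (rule ringI)
    show "abelian_group (quot_alg A I)"
      using Q.a_assoc Q.a_comm Q.l_neg by (intro abelian_groupI) auto
    show "monoid (quot_alg A I)"
      using Q.m_assoc by (intro monoidI) auto
  qed (use Q.l_distr Q.r_distr in auto)
  note qs = quot_smult[OF assms] I.quot_simps
  show ?thesis
  proof (intro assoc_algebra.intro ring assoc_algebra_axioms.intro)
    fix X Y c d assume X: "X \<in> carrier (quot_alg A I)" and Y: "Y \<in> carrier (quot_alg A I)"
    obtain x where x: "x \<in> carrier A" "X = I +> x" using X by (auto elim: I.quot_carrierE)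
    obtain y where y: "y \<in> carrier A" "Y = I +> y" using Y by (auto elim: I.quot_carrierE)
    show "c \<odot>\<^bsub>quot_alg A I\<^esub> (X \<oplus>\<^bsub>quot_alg A I\<^esub> Y) = c \<odot>\<^bsub>quot_alg A I\<^esub> X \<oplus>\<^bsub>quot_alg A I\<^esub> c \<odot>\<^bsub>quot_alg A I\<^esub> Y"
      "c \<odot>\<^bsub>quot_alg A I\<^esub> X \<otimes>\<^bsub>quot_alg A I\<^esub> Y = c \<odot>\<^bsub>quot_alg A I\<^esub> (X \<otimes>\<^bsub>quot_alg A I\<^esub> Y)"
      "X \<otimes>\<^bsub>quot_alg A I\<^esub> (c \<odot>\<^bsub>quot_alg A I\<^esub> Y) = c \<odot>\<^bsub>quot_alg A I\<^esub> (X \<otimes>\<^bsub>quot_alg A I\<^esub> Y)"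
      using x y by (simp_all add: qs smult_r_distr smult_mult_l smult_mult_r)
  next
    fix X c d assume X: "X \<in> carrier (quot_alg A I)"
    obtain x where x: "x \<in> carrier A" "X = I +> x" using X by (auto elim: I.quot_carrierE)
    show "c \<odot>\<^bsub>quot_alg A I\<^esub> X \<in> carrier (quot_alg A I)"
      "(c + d) \<odot>\<^bsub>quot_alg A I\<^esub> X = c \<odot>\<^bsub>quot_alg A I\<^esub> X \<oplus>\<^bsub>quot_alg A I\<^esub> d \<odot>\<^bsub>quot_alg A I\<^esub> X"
      "(c * d) \<odot>\<^bsub>quot_alg A I\<^esub> X = c \<odot>\<^bsub>quot_alg A I\<^esub> (d \<odot>\<^bsub>quot_alg A I\<^esub> X)"
      "1 \<odot>\<^bsub>quot_alg A I\<^esub> X = X"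
      using x by (simp_all add: qs smult_l_distr smult_assoc)
  qed
qed

end

section \<open>Homomorphisms of algebras\<close>

lemma alg_homD:
  assumes "f \<in> alg_hom A B"
  shows "x \<in> carrier A \<Longrightarrow> f x \<in> carrier B"
    and "x \<in> carrier A \<Longrightarrow> y \<in> carrier A \<Longrightarrow> f (x \<otimes>\<^bsub>A\<^esub> y) = f x \<otimes>\<^bsub>B\<^esub> f y"
    and "x \<in> carrier A \<Longrightarrow> y \<in> carrier A \<Longrightarrow> f (x \<oplus>\<^bsub>A\<^esub> y) = f x \<oplus>\<^bsub>B\<^esub> f y"
    and "x \<in> carrier A \<Longrightarrow> f (c \<odot>\<^bsub>A\<^esub> x) = c \<odot>\<^bsub>B\<^esub> f x"
    and "f \<one>\<^bsub>A\<^esub> = \<one>\<^bsub>B\<^esub>"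
  using assms by (auto simp: alg_hom_def Ring.ring_hom_def)

lemma alg_hom_zero:
  assumes "f \<in> alg_hom A B" "assoc_algebra A" "assoc_algebra B"
  shows "f \<zero>\<^bsub>A\<^esub> = \<zero>\<^bsub>B\<^esub>"
proof -
  interpret A: assoc_algebra A by fact
  interpret B: assoc_algebra B by fact
  show ?thesis
    using alg_homD(4)[OF assms(1), of "\<zero>\<^bsub>A\<^esub>" 0] alg_homD(1)[OF assms(1), of "\<zero>\<^bsub>A\<^esub>"] by simp
qed

lemma alg_hom_compose:
  assumes "f \<in> alg_hom A B" "g \<in> alg_hom B C"
  shows "(\<lambda>x. g (f x)) \<in> alg_hom A C"
  using assms by (auto simp: alg_hom_def Ring.ring_hom_def Pi_iff)

lemma alg_hom_restrict:
  assumes "f \<in> alg_hom A B" "assoc_algebra A"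
  shows "restrict f (carrier A) \<in> alg_hom A B"
proof -
  interpret A: assoc_algebra A by fact
  show ?thesis using assms(1) by (auto simp: alg_hom_def Ring.ring_hom_def Pi_iff)
qed

lemma (in ideal) minimal_Idl:
  assumes "S \<subseteq> I"
  shows "Idl S \<subseteq> I"
  using genideal_minimal[OF ideal_axioms assms] .

section \<open>Maps induced on quotients of monoid rings\<close>

text \<open>The universal property of a monoid ring modulo relators. The monoid is arbitrary because
  there are two uses: words for presented algebras and pairs for tensor products.\<close>

locale induced_map = assoc_algebra B + M: monoid M
  for B :: "(complex, 'b, 'n) module_scheme" (structure) and M :: "('a, 'e) monoid_scheme" +
  fixes f :: "'a \<Rightarrow> 'b" and R :: "('a \<Rightarrow>\<^sub>0 complex) set"
  assumes f_closed: "f \<in> carrier M \<rightarrow> carrier B"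
    and f_mult: "\<And>x y. x \<in> carrier M \<Longrightarrow> y \<in> carrier M \<Longrightarrow> f (x \<otimes>\<^bsub>M\<^esub> y) = f x \<otimes> f y"
    and f_one: "f \<one>\<^bsub>M\<^esub> = \<one>"
    and R_closed: "R \<subseteq> carrier (monoid_ring M)"
    and R_zero: "\<And>r. r \<in> R \<Longrightarrow> linext B f r = \<zero>"
begin

abbreviation "P \<equiv> monoid_ring M :: (complex, 'a \<Rightarrow>\<^sub>0 complex) module"
abbreviation "I \<equiv> genideal P R"

lemma algebra_P: "assoc_algebra P"
  by (rule M.assoc_algebra_monoid_ring)

lemma ideal_I: "ideal I P"
  by (rule ring.genideal_ideal[OF assoc_algebra.axioms(1)[OF algebra_P] R_closed])

lemma linext_hom: "ring_hom_ring P B (linext B f)"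
  by (intro ring_hom_ringI2 assoc_algebra.axioms(1)[OF algebra_P] ring_axioms
      linext_ring_hom[OF M.monoid_axioms f_closed f_mult f_one])

text \<open>The kernel of the ring homomorphism \<open>linext B f\<close> is an ideal that contains
  \<open>R\<close>, hence contains the ideal generated by \<open>R\<close>.\<close>

lemma linext_I: "p \<in> I \<Longrightarrow> linext B f p = \<zero>"
proof -
  assume p: "p \<in> I"
  interpret h: ring_hom_ring P B "linext B f" by (rule linext_hom)
  interpret K: ideal "a_kernel P B (linext B f)" P by (rule h.kernel_is_ideal)
  have "R \<subseteq> a_kernel P B (linext B f)" using R_closed R_zero unfolding a_kernel_def' by blast
  then have "p \<in> a_kernel P B (linext B f)" using K.minimal_Idl p by blast
  then show ?thesis unfolding a_kernel_def' by blast
qed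

text \<open>The linear extension is constant on the coset, so its image there is a singleton and
  \<open>the_elem\<close> is meaningful.\<close>

lemma induced_coset:
  assumes p: "p \<in> carrier P"
  shows "induced B f (I +>\<^bsub>P\<^esub> p) = linext B f p"
proof -
  interpret h: ring_hom_ring P B "linext B f" by (rule linext_hom)
  interpret I: ideal I P by (rule ideal_I)
  have "linext B f q = linext B f p" if q: "q \<in> I +>\<^bsub>P\<^esub> p" for q
  proof -
    obtain i where i: "i \<in> I" "q = i \<oplus>\<^bsub>P\<^esub> p" using q by (auto simp: a_r_coset_def')
    have "linext B f q = linext B f i \<oplus> linext B f p"
      unfolding i(2) using i p I.Icarr by (intro h.hom_add) auto
    then show ?thesis using i p by (simp only: linext_I) (use h.hom_closed p in auto)
  qed
  moreover have "p \<in> I +>\<^bsub>P\<^esub> p" using p I.a_rcos_self by auto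
  ultimately have "linext B f ` (I +>\<^bsub>P\<^esub> p) = {linext B f p}" by blast
  then show ?thesis by (simp add: induced_linext)
qed

lemma induced_alg_hom: "induced B f \<in> alg_hom (quot_alg P I) B"
proof -
  interpret P: assoc_algebra P by (rule algebra_P)
  interpret h: ring_hom_ring P B "linext B f" by (rule linext_hom)
  interpret I: ideal I P by (rule ideal_I)
  note sc = P.quot_smult[OF ideal_I]
  show ?thesis
    unfolding alg_hom_def
  proof (intro CollectI conjI ring_hom_memI allI ballI)
    fix X assume X: "X \<in> carrier (quot_alg P I)"
    then obtain x where x: "x \<in> carrier P" "X = I +>\<^bsub>P\<^esub> x" by (auto elim: I.quot_carrierE)
    show "induced B f X \<in> carrier B" using x h.hom_closed by (simp only: induced_coset)
    show "induced B f (c \<odot>\<^bsub>quot_alg P I\<^esub> X) = c \<odot> induced B f X" for c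
    proof -
      have "linext B f (c \<odot>\<^bsub>P\<^esub> x) = c \<odot> linext B f x"
        using x linext_scale[OF _ f_closed] by simp
      then show ?thesis using x sc P.smult_closed by (simp only: induced_coset)
    qed
    fix Y assume Y: "Y \<in> carrier (quot_alg P I)"
    then obtain y where y: "y \<in> carrier P" "Y = I +>\<^bsub>P\<^esub> y" by (auto elim: I.quot_carrierE)
    show "induced B f (X \<otimes>\<^bsub>quot_alg P I\<^esub> Y) = induced B f X \<otimes> induced B f Y"
      using x y by (simp only: quot_alg_simps I.quot_simps induced_coset h.hom_mult P.m_closed)
    show "induced B f (X \<oplus>\<^bsub>quot_alg P I\<^esub> Y) = induced B f X \<oplus> induced B f Y"
      using x y by (simp only: quot_alg_simps I.quot_simps induced_coset h.hom_add P.a_closed)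
  next
    show "induced B f \<one>\<^bsub>quot_alg P I\<^esub> = \<one>"
      using I.quot_simps(4) induced_coset[of "\<one>\<^bsub>P\<^esub>"] h.hom_one P.one_closed
      by (simp only: quot_alg_simps)
  qed
qed

end


section \<open>Presented algebras\<close>

definition word_monoid :: "'g set \<Rightarrow> 'g list monoid"
  where "word_monoid X = \<lparr>carrier = lists X, monoid.mult = (@), one = []\<rparr>"

definition word_eval :: "('c, 'b, 'n) module_scheme \<Rightarrow> ('g \<Rightarrow> 'b) \<Rightarrow> 'g list \<Rightarrow> 'b"
  where "word_eval B f w = foldr (\<lambda>x y. f x \<otimes>\<^bsub>B\<^esub> y) w \<one>\<^bsub>B\<^esub>"

lemma word_eval_simps [simp]:
  "word_eval B f [] = \<one>\<^bsub>B\<^esub>"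
  "word_eval B f (x # w) = f x \<otimes>\<^bsub>B\<^esub> word_eval B f w"
  by (simp_all add: word_eval_def)

lemma word_monoid_simps [simp]:
  "carrier (word_monoid X) = lists X" "x \<otimes>\<^bsub>word_monoid X\<^esub> y = x @ y" "\<one>\<^bsub>word_monoid X\<^esub> = []"
  by (simp_all add: word_monoid_def)

lemma monoid_word_monoid: "monoid (word_monoid X)"
  by (rule monoidI) auto

lemma free_alg_eq: "free_alg X = monoid_ring (word_monoid X)"
  by (simp add: free_alg_def word_monoid_def)

lemma alg_map_eq: "alg_map B f = induced B (word_eval B f)"
  by (simp add: alg_map_def word_eval_def[abs_def])

text \<open>For \<open>f\<close> with values in the carrier, this is the condition under which
  \<open>f\<close> extends to the algebra presented by \<open>R\<close>.\<close>

definition satisfies :: "('c::comm_ring_1, 'b, 'n) module_scheme \<Rightarrow> ('g \<Rightarrow> 'b) \<Rightarrow> ('g list \<Rightarrow>\<^sub>0 'c) set \<Rightarrow> bool"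
  where "satisfies B f R \<longleftrightarrow> (\<forall>r\<in>R. linext B (word_eval B f) r = \<zero>\<^bsub>B\<^esub>)"

context assoc_algebra
begin

lemma word_eval_closed:
  assumes "f \<in> X \<rightarrow> carrier A"
  shows "w \<in> lists X \<Longrightarrow> word_eval A f w \<in> carrier A"
  using assms by (induction w) auto

lemma word_eval_append:
  assumes "f \<in> X \<rightarrow> carrier A" "v \<in> lists X" "w \<in> lists X"
  shows "word_eval A f (v @ w) = word_eval A f v \<otimes> word_eval A f w"
  using assms(2)
proof (induction v)
  case Nil
  then show ?case using word_eval_closed[OF assms(1,3)] by simp
next
  case (Cons x v)
  then show ?case
    using word_eval_closed[OF assms(1,3)] word_eval_closed[OF assms(1) Cons.hyps(2)] assms(1)
    by (auto simp: m_assoc Pi_iff)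
qed

end

locale presentation =
  fixes X :: "'g set" and R :: "('g list \<Rightarrow>\<^sub>0 complex) set"
  assumes R_closed: "R \<subseteq> carrier (free_alg X)"
begin

abbreviation "F \<equiv> free_alg X"
abbreviation "J \<equiv> genideal F R"
abbreviation "A \<equiv> presented_alg X R"
abbreviation "e \<equiv> presented_gen X R"

lemma algebra_F: "assoc_algebra F"
  unfolding free_alg_eq by (rule monoid.assoc_algebra_monoid_ring[OF monoid_word_monoid])

lemma ideal_J: "ideal J F"
  by (rule ring.genideal_ideal[OF assoc_algebra.axioms(1)[OF algebra_F] R_closed])

lemma R_subset_J: "R \<subseteq> J"
  by (rule ring.genideal_self[OF assoc_algebra.axioms(1)[OF algebra_F] R_closed])

lemma algebra_A: "assoc_algebra A"
  unfolding presented_alg_def by (rule assoc_algebra.assoc_algebra_quot[OF algebra_F ideal_J])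

lemma gen_closed: "x \<in> X \<Longrightarrow> e x \<in> carrier A"
proof -
  assume "x \<in> X"
  interpret J: ideal J F by (rule ideal_J)
  show ?thesis unfolding presented_gen_def presented_alg_def quot_alg_simps
    using \<open>x \<in> X\<close> by (intro J.quot_simps(1)) (auto simp: free_alg_eq)
qed

lemma word_eval_gen: "w \<in> lists X \<Longrightarrow> word_eval A e w = J +>\<^bsub>F\<^esub> word w"
proof (induction w)
  case Nil
  interpret J: ideal J F by (rule ideal_J)
  show ?case using J.quot_simps(4) by (simp add: presented_alg_def free_alg_eq FactRing_def)
next
  case (Cons x w)
  interpret J: ideal J F by (rule ideal_J)
  have "(J +>\<^bsub>F\<^esub> word [x]) \<otimes>\<^bsub>F Quot J\<^esub> (J +>\<^bsub>F\<^esub> word w) = J +>\<^bsub>F\<^esub> (word [x] \<otimes>\<^bsub>F\<^esub> word w)"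
    using Cons by (intro J.quot_simps) (auto simp: free_alg_eq)
  then show ?case using Cons by (simp add: presented_alg_def presented_gen_def free_alg_eq)
qed

text \<open>Evaluation at the generators is the quotient map itself. Consequently every element of
  the presented algebra is a noncommutative polynomial in the generators.\<close>

lemma linext_gen:
  assumes "p \<in> carrier F"
  shows "linext A (word_eval A e) p = J +>\<^bsub>F\<^esub> p"
proof -
  interpret J: ideal J F by (rule ideal_J)
  interpret A: assoc_algebra A by (rule algebra_A)
  interpret F: assoc_algebra F by (rule algebra_F)
  have eX: "e \<in> X \<rightarrow> carrier A" using gen_closed by auto
  have ev: "word_eval A e \<in> lists X \<rightarrow> carrier A" using A.word_eval_closed[OF eX] by auto
  have "keys p \<subseteq> lists X" using assms by (simp add: free_alg_eq)
  then show ?thesis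
  proof (induction rule: poly_mapping_keys_induct)
    case zero
    have "\<zero>\<^bsub>F\<^esub> = 0" by (simp add: free_alg_eq)
    then have "J +>\<^bsub>F\<^esub> 0 = J" using J.a_rcos_zero[OF ideal_J] additive_subgroup.zero_closed[OF J.additive_subgroup_axioms] by metis
    moreover have "\<zero>\<^bsub>A\<^esub> = J" by (simp add: presented_alg_def FactRing_def)
    ultimately show ?case by simp
  next
    case (single w c)
    have w: "word_eval A e w \<in> carrier A" using single ev by blast
    have "linext A (word_eval A e) (single w c) = c \<odot>\<^bsub>A\<^esub> (J +>\<^bsub>F\<^esub> word w)"
      using single w by (simp add: word_eval_gen)
    also have "\<dots> = J +>\<^bsub>F\<^esub> (c \<odot>\<^bsub>F\<^esub> word w)"
      unfolding presented_alg_def using single by (intro F.quot_smult ideal_J) (auto simp: free_alg_eq)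
    also have "c \<odot>\<^bsub>F\<^esub> word w = single w c"
      by (simp add: free_alg_eq poly_mapping_eqI lookup_scale lookup_single when_def)
    finally show ?case .
  next
    case (add p q)
    have "(J +>\<^bsub>F\<^esub> p) \<oplus>\<^bsub>F Quot J\<^esub> (J +>\<^bsub>F\<^esub> q) = J +>\<^bsub>F\<^esub> (p \<oplus>\<^bsub>F\<^esub> q)"
      using add by (intro J.quot_simps) (auto simp: free_alg_eq)
    moreover have "linext A (word_eval A e) (p + q) = linext A (word_eval A e) p \<oplus>\<^bsub>A\<^esub> linext A (word_eval A e) q"
      using add ev by (intro A.linext_add)
    ultimately show ?case using add by (simp add: presented_alg_def free_alg_eq)
  qed
qed

lemma carrierE:
  assumes "h \<in> carrier A"
  obtains p where "p \<in> carrier F" "h = linext A (word_eval A e) p"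
proof -
  interpret J: ideal J F by (rule ideal_J)
  obtain p where "p \<in> carrier F" "h = J +>\<^bsub>F\<^esub> p"
    using assms J.quot_carrierE[of h] unfolding presented_alg_def by auto
  then show thesis using that linext_gen by simp
qed

lemma gen_satisfies: "satisfies A e R"
proof -
  interpret J: ideal J F by (rule ideal_J)
  have "J +>\<^bsub>F\<^esub> r = J" if "r \<in> R" for r
    using that R_subset_J J.a_rcos_const by auto
  then have "linext A (word_eval A e) r = J" if "r \<in> R" for r
    using that linext_gen R_closed by auto
  then show ?thesis by (simp add: satisfies_def presented_alg_def FactRing_def)
qed

text \<open>The converse of the universal property: applied to a module, it turns the relators into
  matrix identities between the actions of the generators.\<close>

lemma gen_image_satisfies:
  assumes B: "assoc_algebra B" and f: "f \<in> alg_hom A B"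
  shows "satisfies B (\<lambda>x. f (e x)) R"
  unfolding satisfies_def
proof
  interpret A: assoc_algebra A by (rule algebra_A)
  interpret B: assoc_algebra B by fact
  note h = alg_homD[OF f]
  have ec: "e \<in> X \<rightarrow> carrier A" using gen_closed by auto
  have fc: "(\<lambda>x. f (e x)) \<in> X \<rightarrow> carrier B" using h(1) gen_closed by blast
  have ev: "word_eval A e \<in> lists X \<rightarrow> carrier A" "word_eval B (\<lambda>x. f (e x)) \<in> lists X \<rightarrow> carrier B"
    using A.word_eval_closed[OF ec] B.word_eval_closed[OF fc] by auto
  have w: "f (word_eval A e v) = word_eval B (\<lambda>x. f (e x)) v" if "v \<in> lists X" for v
    using that
  proof (induction v)
    case (Cons x v)
    then show ?case using h(2)[OF gen_closed A.word_eval_closed[OF ec]] by simp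
  qed (use h(5) in simp)
  have *: "f (linext A (word_eval A e) p) = linext B (word_eval B (\<lambda>x. f (e x))) p"
    if "keys p \<subseteq> lists X" for p
    using that
  proof (induction rule: poly_mapping_keys_induct)
    case zero
    show ?case using alg_hom_zero[OF f algebra_A B] by (simp only: A.linext_zero B.linext_zero)
  next
    case (single v c)
    have "word_eval A e v \<in> carrier A" "word_eval B (\<lambda>x. f (e x)) v \<in> carrier B"
      using single ev by blast+
    then show ?case using h(4) w[OF single] by (simp only: A.linext_single B.linext_single)
  next
    case (add p q)
    then show ?case
      using h(3) A.linext_closed[OF _ ev(1)]
      by (simp only: A.linext_add[OF _ _ ev(1)] B.linext_add[OF _ _ ev(2)])
  qed
  fix r assume r: "r \<in> R"
  then have "keys r \<subseteq> lists X" using R_closed by (auto simp: free_alg_eq)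
  then show "linext B (word_eval B (\<lambda>x. f (e x))) r = \<zero>\<^bsub>B\<^esub>"
    using * gen_satisfies r alg_hom_zero[OF f algebra_A B] by (metis satisfies_def)
qed

text \<open>Properties stable under the algebra operations have to be checked on generators only.
  This is behind the comparison of modules, the recognition of intertwiners and the centrality of
  the idempotent.\<close>

lemma presented_induct [consumes 1, case_names gen one add mult smult]:
  assumes h: "h \<in> carrier A"
    and gen: "\<And>x. x \<in> X \<Longrightarrow> Q (e x)"
    and one: "Q \<one>\<^bsub>A\<^esub>"
    and add: "\<And>a b. a \<in> carrier A \<Longrightarrow> b \<in> carrier A \<Longrightarrow> Q a \<Longrightarrow> Q b \<Longrightarrow> Q (a \<oplus>\<^bsub>A\<^esub> b)"
    and mult: "\<And>a b. a \<in> carrier A \<Longrightarrow> b \<in> carrier A \<Longrightarrow> Q a \<Longrightarrow> Q b \<Longrightarrow> Q (a \<otimes>\<^bsub>A\<^esub> b)"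
    and smult: "\<And>c a. a \<in> carrier A \<Longrightarrow> Q a \<Longrightarrow> Q (c \<odot>\<^bsub>A\<^esub> a)"
  shows "Q h"
proof -
  interpret A: assoc_algebra A by (rule algebra_A)
  have eX: "e \<in> X \<rightarrow> carrier A" using gen_closed by auto
  have ev: "word_eval A e \<in> lists X \<rightarrow> carrier A" using A.word_eval_closed[OF eX] by auto
  have w: "Q (word_eval A e w)" if "w \<in> lists X" for w
    using that
  proof (induction w)
    case (Cons x w)
    then show ?case using gen eX A.word_eval_closed[OF eX] by (auto intro!: mult)
  qed (simp add: one)
  obtain p where p: "p \<in> carrier F" "h = linext A (word_eval A e) p" using carrierE[OF h] .
  have "keys p \<subseteq> lists X" using p by (simp add: free_alg_eq)
  then have "Q (linext A (word_eval A e) p)"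
  proof (induction rule: poly_mapping_keys_induct)
    case zero
    \<comment> \<open>The zero element is obtained as \<open>0\<close> times the unit.\<close>
    show ?case using smult[OF A.one_closed one, of 0] by simp
  next
    case (single v c)
    have "word_eval A e v \<in> carrier A" using single ev by blast
    then show ?case using smult[OF _ w[OF single]] by simp
  next
    case (add p q)
    then show ?case using assms(4) A.linext_add[OF add.hyps(1,2) ev] A.linext_closed[OF _ ev] by simp
  qed
  then show ?thesis using p by simp
qed

end

locale presented_map = presentation + B: assoc_algebra B for B :: "(complex, 'b, 'n) module_scheme" +
  fixes f :: "'a \<Rightarrow> 'b"
  assumes f_closed: "f \<in> X \<rightarrow> carrier B" and f_satisfies: "satisfies B f R"
begin

lemma induced_map: "induced_map B (word_monoid X) (word_eval B f) R"
  using B.word_eval_append[OF f_closed] B.word_eval_closed[OF f_closed] R_closed f_satisfies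
  by (intro induced_map.intro induced_map_axioms.intro B.assoc_algebra_axioms monoid_word_monoid)
    (auto simp: satisfies_def free_alg_eq)

lemma alg_map_hom: "alg_map B f \<in> alg_hom A B"
  using induced_map.induced_alg_hom[OF induced_map]
  by (simp add: alg_map_eq presented_alg_def free_alg_eq)

lemma alg_map_gen:
  assumes "x \<in> X"
  shows "alg_map B f (e x) = f x"
proof -
  have fx: "f x \<in> carrier B" using assms f_closed by auto
  have "alg_map B f (e x) = linext B (word_eval B f) (word [x])"
    unfolding alg_map_eq presented_gen_def free_alg_eq
    using assms by (intro induced_map.induced_coset[OF induced_map]) simp
  then show ?thesis using fx by simp
qed

end


section \<open>Tensor products of algebras\<close>

locale tensor_product = A: assoc_algebra A + B: assoc_algebra B
  for A :: "(complex, 'a, 'm) module_scheme" and B :: "(complex, 'b, 'n) module_scheme"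
begin

abbreviation "P \<equiv> pair_alg A B"
abbreviation "T \<equiv> tensor_alg A B"
abbreviation "tn \<equiv> tens A B"
abbreviation "J \<equiv> tensor_ideal A B"

lemma monoid_pair: "monoid (A \<times>\<times> B)"
  by (intro DirProd_monoid A.monoid_axioms B.monoid_axioms)

lemma algebra_P: "assoc_algebra P"
  unfolding pair_alg_def by (rule monoid.assoc_algebra_monoid_ring[OF monoid_pair])

lemma rels_closed: "bilinear_rels A B \<subseteq> carrier P"
  unfolding bilinear_rels_def pair_alg_def
  by (intro subsetI; elim UnE CollectE exE conjE; simp add: keys_diff_subset)

lemma ideal_J: "ideal J P"
  unfolding tensor_ideal_def
  by (rule ring.genideal_ideal[OF assoc_algebra.axioms(1)[OF algebra_P] rels_closed])

lemma rels_in_J: "bilinear_rels A B \<subseteq> J"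
  unfolding tensor_ideal_def
  by (rule ring.genideal_self[OF assoc_algebra.axioms(1)[OF algebra_P] rels_closed])

lemma algebra_T: "assoc_algebra T"
  unfolding tensor_alg_def by (rule assoc_algebra.assoc_algebra_quot[OF algebra_P ideal_J])

lemma fpair_closed: "a \<in> carrier A \<Longrightarrow> b \<in> carrier B \<Longrightarrow> fpair c a b \<in> carrier P"
  by (simp add: pair_alg_def)

lemma tens_closed [simp, intro]: "a \<in> carrier A \<Longrightarrow> b \<in> carrier B \<Longrightarrow> tn a b \<in> carrier T"
  using ideal.quot_simps(1)[OF ideal_J] fpair_closed by (simp add: tens_def tensor_alg_def)

text \<open>The relators are written with the subtraction of finitely supported functions, the
  criterion for equal cosets with that of the ring; the two agree on the carrier.\<close>

lemma coset_eqI: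
  assumes "p \<in> carrier P" "q \<in> carrier P" "p - q \<in> J"
  shows "J +>\<^bsub>P\<^esub> p = J +>\<^bsub>P\<^esub> q"
proof -
  interpret J: ideal J P by (rule ideal_J)
  have "\<ominus>\<^bsub>P\<^esub> q = - q" using assms(2)
    by (intro J.minus_equality) (auto simp: pair_alg_def in_keys_iff subset_iff)
  then have "p \<ominus>\<^bsub>P\<^esub> q = p - q" by (simp add: a_minus_def pair_alg_def)
  then show ?thesis using J.coset_eq_iff assms by simp
qed

lemma coset_add: "p \<in> carrier P \<Longrightarrow> q \<in> carrier P \<Longrightarrow> J +>\<^bsub>P\<^esub> (p + q) = (J +>\<^bsub>P\<^esub> p) \<oplus>\<^bsub>T\<^esub> (J +>\<^bsub>P\<^esub> q)"
  using ideal.quot_simps(3)[OF ideal_J, of p q] by (simp add: tensor_alg_def pair_alg_def)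

lemma P_add_closed: "p \<in> carrier P \<Longrightarrow> q \<in> carrier P \<Longrightarrow> p + q \<in> carrier P"
  by (simp add: pair_alg_def keys_add_subset)

lemma tens_add_left:
  assumes "a \<in> carrier A" "a' \<in> carrier A" "b \<in> carrier B"
  shows "tn (a \<oplus>\<^bsub>A\<^esub> a') b = tn a b \<oplus>\<^bsub>T\<^esub> tn a' b"
proof -
  have "fpair 1 (a \<oplus>\<^bsub>A\<^esub> a') b - fpair 1 a b - fpair 1 a' b \<in> J"
    using assms rels_in_J by (force simp: bilinear_rels_def)
  then have "J +>\<^bsub>P\<^esub> fpair 1 (a \<oplus>\<^bsub>A\<^esub> a') b = J +>\<^bsub>P\<^esub> (fpair 1 a b + fpair 1 a' b)"
    using assms by (intro coset_eqI P_add_closed fpair_closed) (auto simp: diff_diff_eq)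
  then show ?thesis using assms by (simp add: tens_def coset_add fpair_closed)
qed

lemma tens_add_right:
  assumes "a \<in> carrier A" "b \<in> carrier B" "b' \<in> carrier B"
  shows "tn a (b \<oplus>\<^bsub>B\<^esub> b') = tn a b \<oplus>\<^bsub>T\<^esub> tn a b'"
proof -
  have "fpair 1 a (b \<oplus>\<^bsub>B\<^esub> b') - fpair 1 a b - fpair 1 a b' \<in> J"
    using assms rels_in_J by (force simp: bilinear_rels_def)
  then have "J +>\<^bsub>P\<^esub> fpair 1 a (b \<oplus>\<^bsub>B\<^esub> b') = J +>\<^bsub>P\<^esub> (fpair 1 a b + fpair 1 a b')"
    using assms by (intro coset_eqI P_add_closed fpair_closed) (auto simp: diff_diff_eq)
  then show ?thesis using assms by (simp add: tens_def coset_add fpair_closed)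
qed

lemma coset_fpair:
  assumes "a \<in> carrier A" "b \<in> carrier B"
  shows "J +>\<^bsub>P\<^esub> fpair c a b = c \<odot>\<^bsub>T\<^esub> tn a b"
proof -
  have "c \<odot>\<^bsub>P\<^esub> fpair 1 a b = fpair c a b"
    by (simp add: pair_alg_def poly_mapping_eqI lookup_scale lookup_single when_def)
  then show ?thesis
    using assoc_algebra.quot_smult[OF algebra_P ideal_J fpair_closed[OF assms, of 1], of c]
    by (simp add: tens_def tensor_alg_def)
qed

lemma tens_smult_left:
  assumes "a \<in> carrier A" "b \<in> carrier B"
  shows "tn (c \<odot>\<^bsub>A\<^esub> a) b = c \<odot>\<^bsub>T\<^esub> tn a b"
proof -
  have "fpair 1 (c \<odot>\<^bsub>A\<^esub> a) b - fpair c a b \<in> J"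
    using assms rels_in_J by (force simp: bilinear_rels_def)
  then have "J +>\<^bsub>P\<^esub> fpair 1 (c \<odot>\<^bsub>A\<^esub> a) b = J +>\<^bsub>P\<^esub> fpair c a b"
    using assms by (intro coset_eqI fpair_closed) auto
  then show ?thesis
    unfolding tens_def[of A B "c \<odot>\<^bsub>A\<^esub> a" b] coset_fpair[OF assms] .
qed

lemma tens_smult_right:
  assumes "a \<in> carrier A" "b \<in> carrier B"
  shows "tn a (c \<odot>\<^bsub>B\<^esub> b) = c \<odot>\<^bsub>T\<^esub> tn a b"
proof -
  have "fpair 1 a (c \<odot>\<^bsub>B\<^esub> b) - fpair c a b \<in> J"
    using assms rels_in_J by (force simp: bilinear_rels_def)
  then have "J +>\<^bsub>P\<^esub> fpair 1 a (c \<odot>\<^bsub>B\<^esub> b) = J +>\<^bsub>P\<^esub> fpair c a b"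
    using assms by (intro coset_eqI fpair_closed) auto
  then show ?thesis
    unfolding tens_def[of A B a "c \<odot>\<^bsub>B\<^esub> b"] coset_fpair[OF assms] .
qed

lemma tens_zero:
  "b \<in> carrier B \<Longrightarrow> tn \<zero>\<^bsub>A\<^esub> b = \<zero>\<^bsub>T\<^esub>"
  "a \<in> carrier A \<Longrightarrow> tn a \<zero>\<^bsub>B\<^esub> = \<zero>\<^bsub>T\<^esub>"
  using tens_smult_left[of "\<zero>\<^bsub>A\<^esub>" b 0] tens_smult_right[of a "\<zero>\<^bsub>B\<^esub>" 0]
    assoc_algebra.smult_zero[OF algebra_T tens_closed]
  by auto

lemma tens_minus:
  assumes "a \<in> carrier A" "b \<in> carrier B"
  shows "tn (\<ominus>\<^bsub>A\<^esub> a) b = \<ominus>\<^bsub>T\<^esub> tn a b" "tn a (\<ominus>\<^bsub>B\<^esub> b) = \<ominus>\<^bsub>T\<^esub> tn a b"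
  using tens_smult_left[OF assms, of "- 1"] tens_smult_right[OF assms, of "- 1"] assms
    assoc_algebra.smult_minus[OF algebra_T tens_closed[OF assms], of 1]
    assoc_algebra.smult_one[OF algebra_T tens_closed[OF assms]]
  by (simp_all add: A.smult_minus B.smult_minus)

lemma tens_mult:
  assumes "a \<in> carrier A" "a' \<in> carrier A" "b \<in> carrier B" "b' \<in> carrier B"
  shows "tn a b \<otimes>\<^bsub>T\<^esub> tn a' b' = tn (a \<otimes>\<^bsub>A\<^esub> a') (b \<otimes>\<^bsub>B\<^esub> b')"
  using ideal.quot_simps(2)[OF ideal_J fpair_closed fpair_closed, of a b a' b' 1 1] assms
  by (simp add: tens_def tensor_alg_def) (simp add: pair_alg_def)

lemma one_T: "\<one>\<^bsub>T\<^esub> = tn \<one>\<^bsub>A\<^esub> \<one>\<^bsub>B\<^esub>"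
  by (simp add: tens_def tensor_alg_def FactRing_def) (simp add: pair_alg_def)

text \<open>Besides being bilinear, \<open>f\<close> is asked to be multiplicative: the relators
  generate a two-sided ideal, and the extension vanishes there because the kernel of a ring
  homomorphism is an ideal. Kronecker products of representations are of this kind.\<close>

lemma induced_tensor:
  fixes C :: "(complex, 'd, 'k) module_scheme"
  assumes C: "assoc_algebra C"
    and f_closed: "\<And>a b. a \<in> carrier A \<Longrightarrow> b \<in> carrier B \<Longrightarrow> f (a, b) \<in> carrier C"
    and f_mult: "\<And>a b a' b'. a \<in> carrier A \<Longrightarrow> b \<in> carrier B \<Longrightarrow> a' \<in> carrier A \<Longrightarrow> b' \<in> carrier B \<Longrightarrow>
       f (a \<otimes>\<^bsub>A\<^esub> a', b \<otimes>\<^bsub>B\<^esub> b') = f (a, b) \<otimes>\<^bsub>C\<^esub> f (a', b')"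
    and f_one: "f (\<one>\<^bsub>A\<^esub>, \<one>\<^bsub>B\<^esub>) = \<one>\<^bsub>C\<^esub>"
    and f_add_left: "\<And>a a' b. a \<in> carrier A \<Longrightarrow> a' \<in> carrier A \<Longrightarrow> b \<in> carrier B \<Longrightarrow>
       f (a \<oplus>\<^bsub>A\<^esub> a', b) = f (a, b) \<oplus>\<^bsub>C\<^esub> f (a', b)"
    and f_add_right: "\<And>a b b'. a \<in> carrier A \<Longrightarrow> b \<in> carrier B \<Longrightarrow> b' \<in> carrier B \<Longrightarrow>
       f (a, b \<oplus>\<^bsub>B\<^esub> b') = f (a, b) \<oplus>\<^bsub>C\<^esub> f (a, b')"
    and f_smult_left: "\<And>c a b. a \<in> carrier A \<Longrightarrow> b \<in> carrier B \<Longrightarrow> f (c \<odot>\<^bsub>A\<^esub> a, b) = c \<odot>\<^bsub>C\<^esub> f (a, b)"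
    and f_smult_right: "\<And>c a b. a \<in> carrier A \<Longrightarrow> b \<in> carrier B \<Longrightarrow> f (a, c \<odot>\<^bsub>B\<^esub> b) = c \<odot>\<^bsub>C\<^esub> f (a, b)"
  shows "induced C f \<in> alg_hom T C"
    and "\<And>a b. a \<in> carrier A \<Longrightarrow> b \<in> carrier B \<Longrightarrow> induced C f (tn a b) = f (a, b)"
proof -
  interpret C: assoc_algebra C by (rule C)
  have fc: "f \<in> carrier A \<times> carrier B \<rightarrow> carrier C" using f_closed by auto
  have d: "linext C f (p - q) = linext C f p \<ominus>\<^bsub>C\<^esub> linext C f q"
    if "p \<in> carrier P" "q \<in> carrier P" for p q
    using that fc by (intro C.linext_diff[of _ "carrier A \<times> carrier B"]) (auto simp: pair_alg_def)
  have dc: "p - q \<in> carrier P" if "p \<in> carrier P" "q \<in> carrier P" for p q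
    using that by (simp add: pair_alg_def keys_diff_subset)
  have s: "linext C f (fpair c a b) = c \<odot>\<^bsub>C\<^esub> f (a, b)" if "a \<in> carrier A" "b \<in> carrier B" for c a b
    using that f_closed by simp
  have cancel: "x \<oplus>\<^bsub>C\<^esub> y \<ominus>\<^bsub>C\<^esub> x \<ominus>\<^bsub>C\<^esub> y = \<zero>\<^bsub>C\<^esub>" if "x \<in> carrier C" "y \<in> carrier C" for x y
  proof -
    have "x \<oplus>\<^bsub>C\<^esub> y \<ominus>\<^bsub>C\<^esub> x \<ominus>\<^bsub>C\<^esub> y = (x \<oplus>\<^bsub>C\<^esub> y) \<oplus>\<^bsub>C\<^esub> (\<ominus>\<^bsub>C\<^esub> (x \<oplus>\<^bsub>C\<^esub> y))"
      using that by (simp add: a_minus_def C.minus_add C.a_assoc)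
    then show ?thesis using that by (simp add: C.r_neg)
  qed
  have rels: "linext C f r = \<zero>\<^bsub>C\<^esub>" if "r \<in> bilinear_rels A B" for r
    using that unfolding bilinear_rels_def
    by (auto simp: d dc s fpair_closed f_add_left f_add_right f_smult_left f_smult_right f_closed cancel C.r_right_minus_eq)
  interpret I: induced_map C "A \<times>\<times> B" f "bilinear_rels A B"
  proof (intro induced_map.intro induced_map_axioms.intro C monoid_pair)
    show "bilinear_rels A B \<subseteq> carrier (monoid_ring (A \<times>\<times> B))"
      using rels_closed by (simp add: pair_alg_def)
  qed (use rels f_closed f_mult f_one in auto)
  show "induced C f \<in> alg_hom T C"
    using I.induced_alg_hom by (simp add: tensor_alg_def tensor_ideal_def pair_alg_def)
  show "induced C f (tn a b) = f (a, b)" if "a \<in> carrier A" "b \<in> carrier B" for a b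
    using I.induced_coset[of "fpair 1 a b"] that s[of a b 1] f_closed[OF that]
    by (simp add: tens_def tensor_ideal_def pair_alg_def)
qed

end

section \<open>Modules and intertwiners\<close>

lemma mat_alg_simps [simp]:
  "carrier (mat_alg d) = carrier_mat d d" "monoid.mult (mat_alg d) = (*)" "one (mat_alg d) = 1\<^sub>m d"
  "ring.zero (mat_alg d) = 0\<^sub>m d d" "add (mat_alg d) = (+)" "module.smult (mat_alg d) = (\<cdot>\<^sub>m)"
  by (simp_all add: mat_alg_def)

lemma assoc_algebra_mat: "assoc_algebra (mat_alg d)"
proof -
  have "ring (mat_alg d)"
  proof (rule ringI)
    show "abelian_group (mat_alg d)"
    proof (rule abelian_groupI)
      fix x assume "x \<in> carrier (mat_alg d)"
      then show "\<exists>y\<in>carrier (mat_alg d). y \<oplus>\<^bsub>mat_alg d\<^esub> x = \<zero>\<^bsub>mat_alg d\<^esub>"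
        by (intro bexI[of _ "- x"]) auto
    qed (auto simp: comm_add_mat)
    show "monoid (mat_alg d)"
      by (rule monoidI) auto
  qed (auto simp: add_mult_distrib_mat mult_add_distrib_mat)
  then show ?thesis
  proof (intro assoc_algebra.intro assoc_algebra_axioms.intro)
  qed (auto simp: add_smult_distrib_right_mat add_smult_distrib_left_mat)
qed

lemma complex_alg_simps [simp]:
  "carrier complex_alg = UNIV" "monoid.mult complex_alg = (*)" "one complex_alg = 1"
  "ring.zero complex_alg = 0" "add complex_alg = (+)" "module.smult complex_alg = (*)"
  by (simp_all add: complex_alg_def)

lemma assoc_algebra_complex: "assoc_algebra complex_alg"
proof -
  have "ring complex_alg"
  proof (rule ringI)
    show "abelian_group complex_alg"
      by (rule abelian_groupI) (auto simp: algebra_simps intro: exI[of _ "- x" for x])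
    show "monoid complex_alg" by (rule monoidI) auto
  qed (auto simp: algebra_simps)
  then show ?thesis
    by (intro assoc_algebra.intro assoc_algebra_axioms.intro) (auto simp: algebra_simps)
qed

text \<open>Intertwiners may be rectangular, so inclusions and projections of summands are covered
  along with isomorphisms.\<close>

definition intw :: "'h hopf \<Rightarrow> 'h fdmod \<Rightarrow> 'h fdmod \<Rightarrow> complex mat \<Rightarrow> bool"
  where "intw H M N P \<longleftrightarrow> P \<in> carrier_mat (fst N) (fst M) \<and> (\<forall>h\<in>carrier H. P * snd M h = snd N h * P)"

text \<open>The equational description of a direct sum. It is preserved by every additive functor,
  so distributivity of tensor products can be shown without permuting a basis.\<close>

definition biproduct :: "'h hopf \<Rightarrow> 'h fdmod \<Rightarrow> 'h fdmod \<Rightarrow> 'h fdmod \<Rightarrow>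
    complex mat \<Rightarrow> complex mat \<Rightarrow> complex mat \<Rightarrow> complex mat \<Rightarrow> bool"
  where "biproduct H M N Y i j p q \<longleftrightarrow>
    intw H M Y i \<and> intw H N Y j \<and> intw H Y M p \<and> intw H Y N q \<and>
    p * i = 1\<^sub>m (fst M) \<and> q * j = 1\<^sub>m (fst N) \<and> p * j = 0\<^sub>m (fst M) (fst N) \<and> q * i = 0\<^sub>m (fst N) (fst M) \<and>
    i * p + j * q = 1\<^sub>m (fst Y)"

lemma mult_add_dim:
  assumes "dim_row A = dim_row B" "dim_col A = dim_col B" "dim_col A = dim_row C"
  shows "(A + B) * C = A * C + B * (C :: 'a::semiring_0 mat)"
  using assms by (intro add_mult_distrib_mat) auto

lemma add_mult_dim:
  assumes "dim_row A = dim_row B" "dim_col A = dim_col B" "dim_row A = dim_col C"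
  shows "C * (A + B) = C * A + C * (B :: 'a::semiring_0 mat)"
  using assms by (intro mult_add_distrib_mat) auto

lemma mult_zero_dim:
  shows "dim_row A = b \<Longrightarrow> 0\<^sub>m a b * A = (0\<^sub>m a (dim_col A) :: 'a::semiring_0 mat)"
    and "dim_col A = b \<Longrightarrow> A * 0\<^sub>m b c = (0\<^sub>m (dim_row A) c :: 'a::semiring_0 mat)"
  by (auto intro: left_mult_zero_mat right_mult_zero_mat)

lemma intw_carrier: "intw H M N P \<Longrightarrow> P \<in> carrier_mat (fst N) (fst M)"
  by (simp add: intw_def)

lemma intw_dim [simp]:
  assumes "intw H M N P"
  shows "dim_row P = fst N" "dim_col P = fst M"
  using intw_carrier[OF assms] by auto

text \<open>The orthogonality relations in the middle kill the mixed terms. This covers both the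
  comparison of two direct sums and the sum of two splittings.\<close>

lemma biproduct_mult:
  fixes a b s t a' b' s' t' :: "complex mat"
  assumes c: "a \<in> carrier_mat y m" "b \<in> carrier_mat y n" "s \<in> carrier_mat m z" "t \<in> carrier_mat n z"
      "a' \<in> carrier_mat z m" "b' \<in> carrier_mat z n" "s' \<in> carrier_mat m x" "t' \<in> carrier_mat n x"
    and "s * a' = 1\<^sub>m m" "s * b' = 0\<^sub>m m n" "t * a' = 0\<^sub>m n m" "t * b' = 1\<^sub>m n"
  shows "(a * s + b * t) * (a' * s' + b' * t') = a * s' + b * t'"
proof -
  note [simp] = c[THEN carrier_matD(1)] c[THEN carrier_matD(2)]
  have "(a * s + b * t) * (a' * s' + b' * t') =
    (a * ((s * a') * s') + b * ((t * a') * s')) + (a * ((s * b') * t') + b * ((t * b') * t'))"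
    by (simp add: mult_add_dim add_mult_dim mat_assoc_dim)
  then show ?thesis using assms by (simp add: mult_zero_dim)
qed

section \<open>The category of modules and its direct sums\<close>

locale module_category = assoc_algebra H for H :: "'h hopf" (structure)
begin

abbreviation "md \<equiv> fd_module H"
abbreviation "iw \<equiv> intw H"
abbreviation "miso \<equiv> mod_iso H"
abbreviation "cls \<equiv> iso_class H"

lemma act_carrier: "md M \<Longrightarrow> h \<in> carrier H \<Longrightarrow> snd M h \<in> carrier_mat (fst M) (fst M)"
  by (auto simp: fd_module_def alg_hom_def Ring.ring_hom_def)

lemma act_dim [simp]:
  assumes "md M" "h \<in> carrier H"
  shows "dim_row (snd M h) = fst M" "dim_col (snd M h) = fst M"
  using act_carrier[OF assms] by auto

lemma act_simps:
  assumes "md M"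
  shows "x \<in> carrier H \<Longrightarrow> y \<in> carrier H \<Longrightarrow> snd M (x \<otimes> y) = snd M x * snd M y"
    and "x \<in> carrier H \<Longrightarrow> y \<in> carrier H \<Longrightarrow> snd M (x \<oplus> y) = snd M x + snd M y"
    and "x \<in> carrier H \<Longrightarrow> snd M (c \<odot> x) = c \<cdot>\<^sub>m snd M x"
    and "snd M \<one> = 1\<^sub>m (fst M)"
  using assms by (auto simp: fd_module_def alg_hom_def Ring.ring_hom_def)

lemma fd_moduleI:
  assumes "\<And>x. x \<in> carrier H \<Longrightarrow> \<rho> x \<in> carrier_mat d d"
    and "\<And>x y. x \<in> carrier H \<Longrightarrow> y \<in> carrier H \<Longrightarrow> \<rho> (x \<otimes> y) = \<rho> x * \<rho> y"
    and "\<And>x y. x \<in> carrier H \<Longrightarrow> y \<in> carrier H \<Longrightarrow> \<rho> (x \<oplus> y) = \<rho> x + \<rho> y"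
    and "\<And>c x. x \<in> carrier H \<Longrightarrow> \<rho> (c \<odot> x) = c \<cdot>\<^sub>m \<rho> x"
    and "\<rho> \<one> = 1\<^sub>m d"
  shows "md (d, restrict \<rho> (carrier H))"
  using assms by (auto simp: fd_module_def alg_hom_def Ring.ring_hom_def)

lemma intw_id: "md M \<Longrightarrow> iw M M (1\<^sub>m (fst M))"
  by (auto simp: intw_def act_carrier left_mult_one_mat'[symmetric])

lemma intw_comp:
  assumes "md L" "md M" "md N" and P: "iw L M P" and Q: "iw M N Q"
  shows "iw L N (Q * P)"
proof -
  have "Q * P * snd L h = snd N h * (Q * P)" if h: "h \<in> carrier H" for h
  proof -
    note [simp] = act_dim[OF assms(1) h] act_dim[OF assms(2) h] act_dim[OF assms(3) h]
      intw_dim[OF P] intw_dim[OF Q]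
    have "Q * P * snd L h = Q * (P * snd L h)" by (simp add: mat_assoc_dim)
    also have "\<dots> = (Q * snd M h) * P" using P h by (simp add: intw_def mat_assoc_dim)
    also have "\<dots> = snd N h * (Q * P)" using Q h by (simp add: intw_def mat_assoc_dim)
    finally show ?thesis .
  qed
  then show ?thesis using intw_carrier[OF P] intw_carrier[OF Q] by (auto simp: intw_def)
qed

lemma intw_add:
  assumes "md M" "md N" and P: "iw M N P" and Q: "iw M N Q"
  shows "iw M N (P + Q)"
  using P Q assms(1,2) intw_carrier[OF P] intw_carrier[OF Q]
  by (auto simp: intw_def mult_add_dim add_mult_dim)

text \<open>Pairs of mutually inverse intertwiners compose more easily than square invertible
  matrices; equality of the dimensions comes back from the trace argument.\<close>

lemma mod_iso_iff:
  assumes "md M" "md N"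
  shows "miso M N \<longleftrightarrow> (\<exists>P Q. iw M N P \<and> iw N M Q \<and> P * Q = 1\<^sub>m (fst N) \<and> Q * P = 1\<^sub>m (fst M))"
proof
  assume "miso M N"
  then obtain P where d: "fst M = fst N" and P: "P \<in> carrier_mat (fst M) (fst M)" "invertible_mat P"
    "\<And>h. h \<in> carrier H \<Longrightarrow> P * snd M h = snd N h * P"
    by (auto simp: mod_iso_def)
  then obtain Q where PQ: "P * Q = 1\<^sub>m (dim_row P)" and QP: "Q * P = 1\<^sub>m (dim_row Q)"
    by (auto simp: invertible_mat_def inverts_mat_def)
  \<comment> \<open>\<open>inverts_mat\<close> does not fix the shape of \<open>Q\<close>; it is
    read off from the identity matrices.\<close>
  have "dim_col (P * Q) = dim_row P" "dim_col (Q * P) = dim_row Q" by (simp_all only: PQ QP index_one_mat)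
  then have Q: "Q \<in> carrier_mat (fst M) (fst M)" using P by auto
  have "Q * snd N h = snd M h * Q" if h: "h \<in> carrier H" for h
  proof -
    note [simp] = act_dim[OF assms(1) h] act_dim[OF assms(2) h] carrier_matD[OF P(1)] carrier_matD[OF Q]
    have "Q * snd N h = Q * (snd N h * (P * Q))" using d PQ act_carrier[OF assms(2) h] by simp
    also have "\<dots> = Q * (snd N h * P) * Q" using d by (simp add: mat_assoc_dim)
    also have "\<dots> = Q * (P * snd M h) * Q" using P(3)[OF h] by simp
    also have "\<dots> = (Q * P) * (snd M h * Q)" using d by (simp add: mat_assoc_dim)
    also have "\<dots> = snd M h * Q" using QP Q act_carrier[OF assms(1) h] by simp
    finally show ?thesis .
  qed
  then show "\<exists>P Q. iw M N P \<and> iw N M Q \<and> P * Q = 1\<^sub>m (fst N) \<and> Q * P = 1\<^sub>m (fst M)"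
    using P Q PQ QP d by (intro exI[of _ P] exI[of _ Q]) (auto simp: intw_def)
next
  assume "\<exists>P Q. iw M N P \<and> iw N M Q \<and> P * Q = 1\<^sub>m (fst N) \<and> Q * P = 1\<^sub>m (fst M)"
  then obtain P Q where PQ: "iw M N P" "iw N M Q" "P * Q = 1\<^sub>m (fst N)" "Q * P = 1\<^sub>m (fst M)" by auto
  have "fst N = fst M"
    using inverse_mats_dim_eq[OF intw_carrier[OF PQ(1)] intw_carrier[OF PQ(2)] PQ(3,4)] .
  then show "miso M N"
    using PQ intw_carrier[OF PQ(1)] intw_carrier[OF PQ(2)]
    unfolding mod_iso_def invertible_mat_def inverts_mat_def
    by (intro conjI bexI[of _ P] exI[of _ Q]) (auto simp: intw_def)
qed

lemma mod_isoI:
  assumes "md M" "md N" "iw M N P" "iw N M Q" "P * Q = 1\<^sub>m (fst N)" "Q * P = 1\<^sub>m (fst M)"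
  shows "miso M N"
  using assms mod_iso_iff by blast

lemma mod_iso_refl: "md M \<Longrightarrow> miso M M"
  by (rule mod_isoI[OF _ _ intw_id intw_id]) simp_all

lemma mod_iso_sym: "md M \<Longrightarrow> md N \<Longrightarrow> miso M N \<Longrightarrow> miso N M"
  by (auto simp: mod_iso_iff)

lemma mod_iso_trans:
  assumes "md L" "md M" "md N" "miso L M" "miso M N"
  shows "miso L N"
proof -
  obtain P Q where P: "iw L M P" "iw M L Q" "P * Q = 1\<^sub>m (fst M)" "Q * P = 1\<^sub>m (fst L)"
    using assms mod_iso_iff by blast
  obtain R S where R: "iw M N R" "iw N M S" "R * S = 1\<^sub>m (fst N)" "S * R = 1\<^sub>m (fst M)"
    using assms mod_iso_iff by blast
  note [simp] = intw_dim[OF P(1)] intw_dim[OF P(2)] intw_dim[OF R(1)] intw_dim[OF R(2)]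
  have "R * P * (Q * S) = R * ((P * Q) * S)" by (simp add: mat_assoc_dim)
  also have "\<dots> = 1\<^sub>m (fst N)" using P R intw_carrier[OF R(2)] by simp
  finally have 1: "R * P * (Q * S) = 1\<^sub>m (fst N)" .
  have "Q * S * (R * P) = Q * ((S * R) * P)" by (simp add: mat_assoc_dim)
  also have "\<dots> = 1\<^sub>m (fst L)" using P R intw_carrier[OF P(1)] by simp
  finally have 2: "Q * S * (R * P) = 1\<^sub>m (fst L)" .
  show ?thesis
    using 1 2 assms P R by (intro mod_isoI[of _ _ "R * P" "Q * S"]) (auto intro: intw_comp)
qed

lemma cls_eq_iff:
  assumes "md M" "md N"
  shows "cls M = cls N \<longleftrightarrow> miso M N"
proof
  assume "cls M = cls N"
  then have "N \<in> cls M" using assms mod_iso_refl by (simp add: iso_class_def)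
  then show "miso M N" by (simp add: iso_class_def)
next
  assume "miso M N"
  then show "cls M = cls N"
    using assms unfolding iso_class_def by (metis mod_iso_sym mod_iso_trans)
qed

lemma mod_sum_md:
  assumes "md M" "md N"
  shows "md (mod_sum H M N)"
proof -
  note c = act_carrier[OF assms(1)] act_carrier[OF assms(2)]
  note s = act_simps[OF assms(1)] act_simps[OF assms(2)]
  show ?thesis
    unfolding mod_sum_def
  proof (rule fd_moduleI)
    fix x y assume xy: "x \<in> carrier H" "y \<in> carrier H"
    show "four_block_mat (snd M (x \<otimes> y)) (0\<^sub>m (fst M) (fst N)) (0\<^sub>m (fst N) (fst M)) (snd N (x \<otimes> y)) =
      four_block_mat (snd M x) (0\<^sub>m (fst M) (fst N)) (0\<^sub>m (fst N) (fst M)) (snd N x) *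
      four_block_mat (snd M y) (0\<^sub>m (fst M) (fst N)) (0\<^sub>m (fst N) (fst M)) (snd N y)"
      using xy c mult_carrier_mat[OF c(1)[OF xy(1)] c(1)[OF xy(2)]] mult_carrier_mat[OF c(2)[OF xy(1)] c(2)[OF xy(2)]]
      by (subst mult_four_block_mat[of _ "fst M" "fst M" _ "fst N" _ "fst N" _ _ "fst M" _ "fst N"])
        (auto simp: s mult_zero_dim assms)
    show "four_block_mat (snd M (x \<oplus> y)) (0\<^sub>m (fst M) (fst N)) (0\<^sub>m (fst N) (fst M)) (snd N (x \<oplus> y)) =
      four_block_mat (snd M x) (0\<^sub>m (fst M) (fst N)) (0\<^sub>m (fst N) (fst M)) (snd N x) +
      four_block_mat (snd M y) (0\<^sub>m (fst M) (fst N)) (0\<^sub>m (fst N) (fst M)) (snd N y)"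
      using xy c by (subst add_four_block_mat[of _ "fst M" "fst M" _ "fst N" _ "fst N"]) (auto simp: s)
  next
    fix x c assume x: "x \<in> carrier H"
    show "four_block_mat (snd M (c \<odot> x)) (0\<^sub>m (fst M) (fst N)) (0\<^sub>m (fst N) (fst M)) (snd N (c \<odot> x)) =
      c \<cdot>\<^sub>m four_block_mat (snd M x) (0\<^sub>m (fst M) (fst N)) (0\<^sub>m (fst N) (fst M)) (snd N x)"
      using x act_carrier[OF assms(1) x] act_carrier[OF assms(2) x]
      by (subst smult_four_block_mat[of _ "fst M" "fst M" _ "fst N" _ "fst N"]) (auto simp: s)
  qed (use c in \<open>auto simp: s\<close>)
qed

lemma fst_mod_sum [simp]: "fst (mod_sum H M N) = fst M + fst N"
  by (simp add: mod_sum_def)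

lemma mod_sum_biproduct:
  assumes "md M" "md N"
  obtains i j p q where "biproduct H M N (mod_sum H M N) i j p q"
proof -
  define m n where "m = fst M" and "n = fst N"
  \<comment> \<open>The inclusions are block columns and the projections block rows. Blocks of width
    or height 0 complete them, so that the rule for products of 2 by 2 block matrices
    applies.\<close>
  define i where "i = four_block_mat (1\<^sub>m m) (0\<^sub>m m 0) (0\<^sub>m n m) (0\<^sub>m n 0 :: complex mat)"
  define j where "j = four_block_mat (0\<^sub>m m n) (0\<^sub>m m 0) (1\<^sub>m n) (0\<^sub>m n 0 :: complex mat)"
  define p where "p = four_block_mat (1\<^sub>m m) (0\<^sub>m m n) (0\<^sub>m 0 m) (0\<^sub>m 0 n :: complex mat)"
  define q where "q = four_block_mat (0\<^sub>m n m) (1\<^sub>m n) (0\<^sub>m 0 m) (0\<^sub>m 0 n :: complex mat)"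
  have blk: "A = four_block_mat A (0\<^sub>m a 0) (0\<^sub>m 0 b) (0\<^sub>m 0 0)" if "A \<in> carrier_mat a b"
    for A :: "complex mat" and a b
    using that by (intro eq_matI) auto
  have S: "snd (mod_sum H M N) h = four_block_mat (snd M h) (0\<^sub>m m n) (0\<^sub>m n m) (snd N h)"
    if "h \<in> carrier H" for h using that by (simp add: mod_sum_def m_def n_def)
  have c: "snd M h \<in> carrier_mat m m" "snd N h \<in> carrier_mat n n" if "h \<in> carrier H" for h
    using that assms act_carrier by (auto simp: m_def n_def)
  have ic: "i \<in> carrier_mat (m + n) m" "j \<in> carrier_mat (m + n) n"
    "p \<in> carrier_mat m (m + n)" "q \<in> carrier_mat n (m + n)"
    unfolding i_def j_def p_def q_def by auto
  have I: "i * snd M h = snd (mod_sum H M N) h * i" "j * snd N h = snd (mod_sum H M N) h * j"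
    "p * snd (mod_sum H M N) h = snd M h * p" "q * snd (mod_sum H M N) h = snd N h * q"
    if h: "h \<in> carrier H" for h
  proof -
    note A = c(1)[OF h] and B = c(2)[OF h]
    show "i * snd M h = snd (mod_sum H M N) h * i"
      unfolding S[OF h] i_def using A B
      by (subst (1) blk[OF A], subst mult_four_block_mat[of _ m m _ 0 _ n _ _ m _ 0],
          auto, subst mult_four_block_mat[of _ m m _ n _ n _ _ m _ 0], auto)
    show "j * snd N h = snd (mod_sum H M N) h * j"
      unfolding S[OF h] j_def using A B
      by (subst (1) blk[OF B], subst mult_four_block_mat[of _ m n _ 0 _ n _ _ n _ 0],
          auto, subst mult_four_block_mat[of _ m m _ n _ n _ _ n _ 0], auto)
    show "p * snd (mod_sum H M N) h = snd M h * p"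
      unfolding S[OF h] p_def using A B
      by (subst (2) blk[OF A], subst mult_four_block_mat[of _ m m _ n _ 0 _ _ m _ n],
          auto, subst mult_four_block_mat[of _ m m _ 0 _ 0 _ _ m _ n], auto)
    show "q * snd (mod_sum H M N) h = snd N h * q"
      unfolding S[OF h] q_def using A B
      by (subst (2) blk[OF B], subst mult_four_block_mat[of _ n m _ n _ 0 _ _ m _ n],
          auto, subst mult_four_block_mat[of _ n n _ 0 _ 0 _ _ m _ n], auto)
  qed
  have "p * i = 1\<^sub>m m" "p * j = 0\<^sub>m m n"
    unfolding p_def i_def j_def
    by (subst mult_four_block_mat[of _ m m _ n _ 0 _ _ m _ 0]; force intro!: eq_matI)
       (subst mult_four_block_mat[of _ m m _ n _ 0 _ _ n _ 0]; force intro!: eq_matI)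
  moreover have "q * i = 0\<^sub>m n m" "q * j = 1\<^sub>m n"
    unfolding q_def i_def j_def
    by (subst mult_four_block_mat[of _ n m _ n _ 0 _ _ m _ 0]; force intro!: eq_matI)
       (subst mult_four_block_mat[of _ n m _ n _ 0 _ _ n _ 0]; force intro!: eq_matI)
  moreover have "i * p + j * q = 1\<^sub>m (m + n)"
  proof -
    have "i * p = four_block_mat (1\<^sub>m m) (0\<^sub>m m n) (0\<^sub>m n m) (0\<^sub>m n n)"
      unfolding p_def i_def by (subst mult_four_block_mat[of _ m m _ 0 _ n _ _ m _ n]) auto
    moreover have "j * q = four_block_mat (0\<^sub>m m m) (0\<^sub>m m n) (0\<^sub>m n m) (1\<^sub>m n)"
      unfolding q_def j_def by (subst mult_four_block_mat[of _ m n _ 0 _ n _ _ m _ n]) auto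
    ultimately show ?thesis
      by (simp add: add_four_block_mat[of _ m m _ n _ n])
  qed
  ultimately have "biproduct H M N (mod_sum H M N) i j p q"
    using I ic by (auto simp: biproduct_def intw_def m_def n_def)
  then show thesis by (rule that)
qed

text \<open>The canonical maps leave one direct sum through its projections and enter the other
  through its inclusions.\<close>

lemma biproduct_unique:
  assumes md: "md M" "md N" "md Y" "md Y'"
    and Y: "biproduct H M N Y i j p q" and Y': "biproduct H M N Y' i' j' p' q'"
  shows "miso Y Y'"
proof -
  have iw: "iw M Y i" "iw N Y j" "iw Y M p" "iw Y N q" "iw M Y' i'" "iw N Y' j'" "iw Y' M p'" "iw Y' N q'"
    using Y Y' by (auto simp: biproduct_def)
  note [simp] = intw_dim[OF iw(1)] intw_dim[OF iw(2)] intw_dim[OF iw(3)] intw_dim[OF iw(4)]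
    intw_dim[OF iw(5)] intw_dim[OF iw(6)] intw_dim[OF iw(7)] intw_dim[OF iw(8)]
  note cs = iw[THEN intw_carrier]
  show ?thesis
  proof (rule mod_isoI[OF md(3,4), of "i' * p + j' * q" "i * p' + j * q'"])
    show "iw Y Y' (i' * p + j' * q)" "iw Y' Y (i * p' + j * q')"
      by (intro intw_add md intw_comp[OF md(3) md(1) md(4) iw(3) iw(5)] intw_comp[OF md(3) md(2) md(4) iw(4) iw(6)]
          intw_comp[OF md(4) md(1) md(3) iw(7) iw(1)] intw_comp[OF md(4) md(2) md(3) iw(8) iw(2)])+
    show "(i' * p + j' * q) * (i * p' + j * q') = 1\<^sub>m (fst Y')"
      using Y Y' cs by (subst biproduct_mult[of _ "fst Y'" "fst M" _ "fst N" _ "fst Y" _ _ _ _ "fst Y'"]) (auto simp: biproduct_def)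
    show "(i * p' + j * q') * (i' * p + j' * q) = 1\<^sub>m (fst Y)"
      using Y Y' cs by (subst biproduct_mult[of _ "fst Y" "fst M" _ "fst N" _ "fst Y'" _ _ _ _ "fst Y"]) (auto simp: biproduct_def)
  qed
qed

end

section \<open>Green rings\<close>

text \<open>An additive map respects membership in a generated subgroup once it does so on
  generators. It is applied to multiplication by a fixed element and to the maps between free rings
  on classes.\<close>

lemma additive_generate_subset:
  assumes G: "abelian_group A" and K: "abelian_group B"
    and closed: "\<And>x. x \<in> carrier A \<Longrightarrow> h x \<in> carrier B"
    and add: "\<And>x y. x \<in> carrier A \<Longrightarrow> y \<in> carrier A \<Longrightarrow> h (x \<oplus>\<^bsub>A\<^esub> y) = h x \<oplus>\<^bsub>B\<^esub> h y"
    and S: "S \<subseteq> carrier A" and img: "\<And>s. s \<in> S \<Longrightarrow> h s \<in> I"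
    and I: "subgroup I (add_monoid B)"
    and x: "x \<in> generate (add_monoid A) S"
  shows "h x \<in> I"
proof -
  interpret h: group_hom "add_monoid A" "add_monoid B" h
    using assms by (intro group_hom.intro group_hom_axioms.intro abelian_group.a_group) (auto simp: hom_def)
  have "h x \<in> generate (add_monoid B) (h ` S)"
    using h.generate_img[of S] S x by auto
  also have "\<dots> \<subseteq> I"
    using img by (intro h.H.generate_subgroup_incl I) auto
  finally show ?thesis .
qed

text \<open>A strict monoidal structure: associativity and the unit laws are equalities of modules,
  so the product of isomorphism classes inherits them without coherence maps. Compatibility with
  intertwiners makes that product well defined.\<close>

locale tensor_category = module_category +
  assumes tensor_md: "md M \<Longrightarrow> md N \<Longrightarrow> md (mod_tensor H M N)"
    and tensor_assoc: "md L \<Longrightarrow> md M \<Longrightarrow> md N \<Longrightarrow>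
      mod_tensor H (mod_tensor H L M) N = mod_tensor H L (mod_tensor H M N)"
    and unit_md: "md (mod_unit H)"
    and tensor_unit_left: "md M \<Longrightarrow> mod_tensor H (mod_unit H) M = M"
    and tensor_unit_right: "md M \<Longrightarrow> mod_tensor H M (mod_unit H) = M"
    and tensor_intw: "md M \<Longrightarrow> md M' \<Longrightarrow> md N \<Longrightarrow> md N' \<Longrightarrow> iw M M' P \<Longrightarrow> iw N N' Q \<Longrightarrow>
      iw (mod_tensor H M N) (mod_tensor H M' N') (kron P Q)"
begin

abbreviation "tn \<equiv> mod_tensor H"

lemma fst_tensor [simp]: "fst (tn M N) = fst M * fst N"
  by (simp add: mod_tensor_def)

lemma tensor_iso:
  assumes "md M" "md M'" "md N" "md N'" "miso M M'" "miso N N'"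
  shows "miso (tn M N) (tn M' N')"
proof -
  obtain P Q where P: "iw M M' P" "iw M' M Q" "P * Q = 1\<^sub>m (fst M')" "Q * P = 1\<^sub>m (fst M)"
    using assms mod_iso_iff by blast
  obtain R S where R: "iw N N' R" "iw N' N S" "R * S = 1\<^sub>m (fst N')" "S * R = 1\<^sub>m (fst N)"
    using assms mod_iso_iff by blast
  note c = intw_carrier[OF P(1)] intw_carrier[OF P(2)] intw_carrier[OF R(1)] intw_carrier[OF R(2)]
  show ?thesis
    using P R assms kron_mult[OF c(1) c(3) c(2) c(4)] kron_mult[OF c(2) c(4) c(1) c(3)]
    by (intro mod_isoI[of _ _ "kron P R" "kron Q S"] tensor_md tensor_intw) auto
qed

text \<open>Tensoring with \<open>L\<close> is additive and functorial, hence preserves the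
  equations of a direct sum. In the lexicographic basis, the tensor product of \<open>L\<close> with
  a block sum is in general not block diagonal, which is why the equations are used instead of
  blocks.\<close>

lemma biproduct_tensor_left:
  assumes md: "md L" "md M" "md N" "md Y" and Y: "biproduct H M N Y i j p q"
  shows "biproduct H (tn L M) (tn L N) (tn L Y)
    (kron (1\<^sub>m (fst L)) i) (kron (1\<^sub>m (fst L)) j) (kron (1\<^sub>m (fst L)) p) (kron (1\<^sub>m (fst L)) q)"
proof -
  have iw: "iw M Y i" "iw N Y j" "iw Y M p" "iw Y N q" using Y by (auto simp: biproduct_def)
  note c = iw[THEN intw_carrier]
  have k: "kron (1\<^sub>m (fst L)) A * kron (1\<^sub>m (fst L)) B = kron (1\<^sub>m (fst L)) (A * B)"
    if "A \<in> carrier_mat a b" "B \<in> carrier_mat b d" for A B a b d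
    using kron_mult[OF one_carrier_mat that(1) one_carrier_mat that(2), of "fst L"] by simp
  have "kron (1\<^sub>m (fst L)) (i * p) + kron (1\<^sub>m (fst L)) (j * q) = kron (1\<^sub>m (fst L)) (i * p + j * q)"
    using c by (intro kron_add_right[symmetric, of _ "fst L" "fst L" _ "fst Y" "fst Y"]) auto
  then show ?thesis
    using Y iw md
    by (auto simp: biproduct_def k[OF c(3) c(1)] k[OF c(4) c(2)] k[OF c(3) c(2)] k[OF c(4) c(1)] k[OF c(1) c(3)] k[OF c(2) c(4)]
        kron_zero_right[OF one_carrier_mat] intro!: tensor_intw intw_id)
qed

lemma biproduct_tensor_right:
  assumes md: "md L" "md M" "md N" "md Y" and Y: "biproduct H M N Y i j p q"
  shows "biproduct H (tn M L) (tn N L) (tn Y L)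
    (kron i (1\<^sub>m (fst L))) (kron j (1\<^sub>m (fst L))) (kron p (1\<^sub>m (fst L))) (kron q (1\<^sub>m (fst L)))"
proof -
  have iw: "iw M Y i" "iw N Y j" "iw Y M p" "iw Y N q" using Y by (auto simp: biproduct_def)
  note c = iw[THEN intw_carrier]
  have k: "kron A (1\<^sub>m (fst L)) * kron B (1\<^sub>m (fst L)) = kron (A * B) (1\<^sub>m (fst L))"
    if "A \<in> carrier_mat a b" "B \<in> carrier_mat b d" for A B a b d
    using kron_mult[OF that(1) one_carrier_mat that(2) one_carrier_mat, of "fst L"] by simp
  have "kron (i * p) (1\<^sub>m (fst L)) + kron (j * q) (1\<^sub>m (fst L)) = kron (i * p + j * q) (1\<^sub>m (fst L))"
    using c by (intro kron_add_left[symmetric, of _ "fst Y" "fst Y" _ _ "fst L" "fst L"]) auto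
  then show ?thesis
    using Y iw md
    by (auto simp: biproduct_def k[OF c(3) c(1)] k[OF c(4) c(2)] k[OF c(3) c(2)] k[OF c(4) c(1)] k[OF c(1) c(3)] k[OF c(2) c(4)]
        kron_zero_left[OF one_carrier_mat] intro!: tensor_intw intw_id)
qed

lemma tensor_sum_left:
  assumes "md L" "md M" "md N"
  shows "miso (tn L (mod_sum H M N)) (mod_sum H (tn L M) (tn L N))"
proof -
  obtain i j p q where 1: "biproduct H M N (mod_sum H M N) i j p q"
    using mod_sum_biproduct assms by blast
  obtain i' j' p' q' where 2: "biproduct H (tn L M) (tn L N) (mod_sum H (tn L M) (tn L N)) i' j' p' q'"
    using mod_sum_biproduct assms tensor_md by blast
  show ?thesis
    using assms by (intro biproduct_unique[OF _ _ _ _ biproduct_tensor_left[OF _ _ _ _ 1] 2] tensor_md mod_sum_md)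
qed

lemma tensor_sum_right:
  assumes "md L" "md M" "md N"
  shows "miso (tn (mod_sum H M N) L) (mod_sum H (tn M L) (tn N L))"
proof -
  obtain i j p q where 1: "biproduct H M N (mod_sum H M N) i j p q"
    using mod_sum_biproduct assms by blast
  obtain i' j' p' q' where 2: "biproduct H (tn M L) (tn N L) (mod_sum H (tn M L) (tn N L)) i' j' p' q'"
    using mod_sum_biproduct assms tensor_md by blast
  show ?thesis
    using assms by (intro biproduct_unique[OF _ _ _ _ biproduct_tensor_right[OF _ _ _ _ 1] 2] tensor_md mod_sum_md)
qed

section \<open>The monoid of isomorphism classes\<close>

abbreviation "IM \<equiv> iso_monoid H"

lemma iso_monoid_carrier: "carrier IM = cls ` {M. md M}"
  by (auto simp: iso_monoid_def)

lemma iso_monoid_one: "\<one>\<^bsub>IM\<^esub> = cls (mod_unit H)"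
  by (simp add: iso_monoid_def)

lemma cls_closed [simp]: "md M \<Longrightarrow> cls M \<in> carrier IM"
  by (simp add: iso_monoid_carrier)

text \<open>The product is a union over all representatives, which collapses because all of them
  give the same class.\<close>

lemma iso_monoid_mult:
  assumes "md M" "md N"
  shows "cls M \<otimes>\<^bsub>IM\<^esub> cls N = cls (tn M N)"
proof -
  have "cls (tn M N) = cls (tn M' N')" if "M' \<in> cls M" "N' \<in> cls N" for M' N'
    using that assms tensor_iso[of M M' N N']
    by (subst cls_eq_iff) (simp_all add: iso_class_def tensor_md)
  then have "(\<Union>M'\<in>cls M. \<Union>N'\<in>cls N. cls (tn M' N')) = (\<Union>M'\<in>cls M. \<Union>N'\<in>cls N. cls (tn M N))"
    by (intro SUP_cong refl) auto
  moreover have "M \<in> cls M" "N \<in> cls N" using assms mod_iso_refl by (auto simp: iso_class_def)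
  then have "cls M \<noteq> {}" "cls N \<noteq> {}" by auto
  ultimately show ?thesis by (simp add: iso_monoid_def)
qed

lemma monoid_iso_monoid: "monoid IM"
proof (rule monoidI)
  fix x y z assume "x \<in> carrier IM" "y \<in> carrier IM" "z \<in> carrier IM"
  then obtain L M N where "md L" "md M" "md N" "x = cls L" "y = cls M" "z = cls N"
    by (auto simp: iso_monoid_carrier)
  then show "x \<otimes>\<^bsub>IM\<^esub> y \<otimes>\<^bsub>IM\<^esub> z = x \<otimes>\<^bsub>IM\<^esub> (y \<otimes>\<^bsub>IM\<^esub> z)"
    by (simp add: iso_monoid_mult tensor_md tensor_assoc)
next
  fix x y assume "x \<in> carrier IM" "y \<in> carrier IM"
  then obtain M N where "md M" "md N" "x = cls M" "y = cls N"
    by (auto simp: iso_monoid_carrier)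
  then show "x \<otimes>\<^bsub>IM\<^esub> y \<in> carrier IM"
    by (simp add: iso_monoid_mult tensor_md)
next
  fix x assume "x \<in> carrier IM"
  then obtain M where "md M" "x = cls M" by (auto simp: iso_monoid_carrier)
  then show "\<one>\<^bsub>IM\<^esub> \<otimes>\<^bsub>IM\<^esub> x = x" "x \<otimes>\<^bsub>IM\<^esub> \<one>\<^bsub>IM\<^esub> = x"
    by (simp_all add: iso_monoid_one iso_monoid_mult unit_md tensor_unit_left tensor_unit_right)
qed (simp add: iso_monoid_one unit_md)

section \<open>The free ring on isomorphism classes and its ideal of relations\<close>

abbreviation "FG \<equiv> free_green H"

lemma algebra_FG: "assoc_algebra FG"
  unfolding free_green_def by (rule monoid.assoc_algebra_monoid_ring[OF monoid_iso_monoid])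

lemma ring_FG: "ring FG"
  by (rule assoc_algebra.axioms(1)[OF algebra_FG])

lemma abelian_group_FG: "abelian_group FG"
  by (rule ring.is_abelian_group[OF ring_FG])

abbreviation basis :: "'a fdmod \<Rightarrow> 'a fdmod set \<Rightarrow>\<^sub>0 int"
  where "basis M \<equiv> single (cls M) 1"

lemma FG_simps [simp]:
  "carrier FG = {p. keys p \<subseteq> carrier IM}" "\<zero>\<^bsub>FG\<^esub> = 0" "add FG = (+)"
  by (simp_all add: free_green_def)

lemma FG_minus: "p \<in> carrier FG \<Longrightarrow> \<ominus>\<^bsub>FG\<^esub> p = - p"
proof -
  interpret FG: ring FG by (rule ring_FG)
  show "p \<in> carrier FG \<Longrightarrow> \<ominus>\<^bsub>FG\<^esub> p = - p"
    by (rule FG.minus_equality) simp_all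
qed

lemma green_rels_closed: "green_rels H \<subseteq> carrier FG"
  by (rule subsetI, unfold green_rels_def, elim CollectE exE conjE)
    (simp add: mod_sum_md keys_diff_subset)

lemma subgroup_green_sub: "subgroup (green_sub H) (add_monoid FG)"
  unfolding green_sub_def
  using green_rels_closed by (intro group.generate_is_subgroup abelian_group.a_group abelian_group_FG) simp

lemma green_sub_closed: "a \<in> green_sub H \<Longrightarrow> a \<in> carrier FG"
  using subgroup.mem_carrier[OF subgroup_green_sub] by simp

lemma green_sub_rel:
  assumes "md M" "md N" "md Y" "miso Y (mod_sum H M N)"
  shows "basis Y - basis M - basis N \<in> green_sub H"
proof -
  have "basis Y - basis M - basis N = basis (mod_sum H M N) - basis M - basis N"
    using cls_eq_iff[OF assms(3) mod_sum_md[OF assms(1,2)]] assms(4) by simp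
  also have "\<dots> \<in> green_rels H" using assms unfolding green_rels_def by blast
  finally show ?thesis unfolding green_sub_def by (rule generate.incl)
qed

lemma FG_mult_basis: "md M \<Longrightarrow> md N \<Longrightarrow> basis M \<otimes>\<^bsub>FG\<^esub> basis N = basis (tn M N)"
  by (simp add: free_green_def iso_monoid_mult)

lemma FG_mult_diff:
  assumes "p \<in> carrier FG" "q \<in> carrier FG" "r \<in> carrier FG"
  shows "p \<otimes>\<^bsub>FG\<^esub> (q - r) = p \<otimes>\<^bsub>FG\<^esub> q - p \<otimes>\<^bsub>FG\<^esub> r" "(q - r) \<otimes>\<^bsub>FG\<^esub> p = q \<otimes>\<^bsub>FG\<^esub> p - r \<otimes>\<^bsub>FG\<^esub> p"
  using monoid_ring_mult_add_right[of IM p "q - r" r] monoid_ring_mult_add_left[of IM "q - r" r p]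
  by (simp_all add: free_green_def algebra_simps)

text \<open>Distributivity of the tensor product over direct sums turns a relation times a class
  into another relation.\<close>

lemma basis_mult_green_sub:
  assumes M: "md M" and a: "a \<in> green_sub H"
  shows "basis M \<otimes>\<^bsub>FG\<^esub> a \<in> green_sub H" "a \<otimes>\<^bsub>FG\<^esub> basis M \<in> green_sub H"
proof -
  interpret FG: ring FG by (rule ring_FG)
  have bc: "basis N \<in> carrier FG" if "md N" for N using that by simp
  have dc: "basis N - basis L \<in> carrier FG" if "md N" "md L" for N L
    using that by (simp add: keys_diff_subset)
  have r: "basis M \<otimes>\<^bsub>FG\<^esub> s \<in> green_sub H \<and> s \<otimes>\<^bsub>FG\<^esub> basis M \<in> green_sub H" if s: "s \<in> green_rels H" for s
  proof -
    obtain N L where NL: "md N" "md L" and s: "s = basis (mod_sum H N L) - basis N - basis L"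
      using s unfolding green_rels_def by auto
    have "basis M \<otimes>\<^bsub>FG\<^esub> s = basis (tn M (mod_sum H N L)) - basis (tn M N) - basis (tn M L)"
      "s \<otimes>\<^bsub>FG\<^esub> basis M = basis (tn (mod_sum H N L) M) - basis (tn N M) - basis (tn L M)"
      unfolding s using NL M by (simp_all only: FG_mult_diff bc dc mod_sum_md FG_mult_basis)
    then show ?thesis
      using NL M by (auto intro!: green_sub_rel tensor_md mod_sum_md tensor_sum_left tensor_sum_right)
  qed
  have a': "a \<in> generate (add_monoid FG) (green_rels H)" using a by (simp add: green_sub_def)
  show "basis M \<otimes>\<^bsub>FG\<^esub> a \<in> green_sub H"
    by (rule additive_generate_subset[OF abelian_group_FG abelian_group_FG _ _ green_rels_closed _ subgroup_green_sub a'])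
      (use r bc[OF M] FG.r_distr FG.m_closed in blast)+
  show "a \<otimes>\<^bsub>FG\<^esub> basis M \<in> green_sub H"
    by (rule additive_generate_subset[OF abelian_group_FG abelian_group_FG _ _ green_rels_closed _ subgroup_green_sub a'])
      (use r bc[OF M] FG.l_distr FG.m_closed in blast)+
qed

text \<open>Integer multiples of a class arise by repeated addition and subtraction, so additive
  maps on the free ring are controlled by the single classes.\<close>

lemma carrier_FG_generated:
  "carrier FG = generate (add_monoid FG) {basis M | M. md M}" (is "_ = ?G")
proof -
  interpret FG: assoc_algebra FG by (rule algebra_FG)
  have sub: "{basis M | M. md M} \<subseteq> carrier FG" by auto
  then have G: "subgroup ?G (add_monoid FG)"
    by (intro group.generate_is_subgroup FG.a_group) simp
  have gadd: "a + b \<in> ?G" if "a \<in> ?G" "b \<in> ?G" for a b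
    using subgroup.m_closed[OF G that] by simp
  have cl: "a \<in> carrier FG" if "a \<in> ?G" for a
    using subgroup.mem_carrier[OF G that] by simp
  have um: "- a \<in> ?G" if "a \<in> ?G" for a
    using subgroup.m_inv_closed[OF G that] FG_minus[OF cl[OF that]] by (simp add: a_inv_def)
  have zero: "0 \<in> ?G" using subgroup.one_closed[OF G] by simp
  have "p \<in> ?G" if "keys p \<subseteq> carrier IM" for p
    using that
  proof (induction rule: poly_mapping_keys_induct)
    case (single C c)
    then obtain M where M: "md M" "C = cls M" by (auto simp: iso_monoid_carrier)
    then have b: "single C 1 \<in> ?G" by (intro generate.incl) blast
    show ?case
    proof (induction c rule: int_induct[where k = 0])
      case (step1 i)
      then show ?case using gadd b by (simp add: single_add)
    next
      case (step2 i)
      then show ?case using gadd[OF _ um[OF b]] by (simp add: single_diff)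
    qed (use zero in \<open>simp only: single_zero\<close>)
  qed (use zero gadd in blast)+
  then have "carrier FG \<subseteq> ?G" by (simp only: FG_simps) blast
  moreover have "?G \<subseteq> carrier FG" using cl by blast
  ultimately show ?thesis by (rule equalityI)
qed

text \<open>The relations are closed up only additively, so stability under products has to be
  shown. Both factors are reduced to generators in turn: the relation in
  \<open>basis_mult_green_sub\<close>, the multiplier here.\<close>

lemma ideal_green_sub: "ideal (green_sub H) FG"
proof (rule idealI[OF ring_FG subgroup_green_sub])
  interpret FG: ring FG by (rule ring_FG)
  fix a x assume a: "a \<in> green_sub H" and "x \<in> carrier FG"
  then have x: "x \<in> generate (add_monoid FG) {basis M | M. md M}" by (subst (asm) carrier_FG_generated)
  note ac = green_sub_closed[OF a]
  note gen = additive_generate_subset[OF abelian_group_FG abelian_group_FG _ _ _ _ subgroup_green_sub x]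
  show "x \<otimes>\<^bsub>FG\<^esub> a \<in> green_sub H"
    by (rule gen[of "\<lambda>x. x \<otimes>\<^bsub>FG\<^esub> a"])
      (use basis_mult_green_sub(1)[OF _ a] FG.m_closed[OF _ ac] FG.l_distr[OF _ _ ac] in auto)
  show "a \<otimes>\<^bsub>FG\<^esub> x \<in> green_sub H"
    by (rule gen[of "\<lambda>x. a \<otimes>\<^bsub>FG\<^esub> x"])
      (use basis_mult_green_sub(2)[OF _ a] FG.m_closed[OF ac] FG.r_distr[OF _ _ ac] in auto)
qed

text \<open>The index type is left free so that classes over one Hopf algebra can be sent to classes
  over another.\<close>

definition class_map :: "('c \<Rightarrow> 'a fdmod set) \<Rightarrow> ('c \<Rightarrow>\<^sub>0 int) \<Rightarrow> ('a fdmod set \<Rightarrow>\<^sub>0 int)"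
  where "class_map f = linext FG (\<lambda>C. single (f C) 1)"

lemma class_map_basis_closed:
  assumes "f \<in> S \<rightarrow> carrier IM"
  shows "(\<lambda>C. single (f C) 1) \<in> S \<rightarrow> carrier FG"
  using assms by auto

lemma class_map_closed:
  assumes "f \<in> S \<rightarrow> carrier IM" "keys p \<subseteq> S"
  shows "class_map f p \<in> carrier FG"
  unfolding class_map_def
  by (rule assoc_algebra.linext_closed[OF algebra_FG assms(2) class_map_basis_closed[OF assms(1)]])

lemma class_map_zero: "class_map f 0 = 0"
  unfolding class_map_def using assoc_algebra.linext_zero[OF algebra_FG] by simp

lemma class_map_add:
  assumes "f \<in> S \<rightarrow> carrier IM" "keys p \<subseteq> S" "keys q \<subseteq> S"
  shows "class_map f (p + q) = class_map f p + class_map f q"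
  using assoc_algebra.linext_add[OF algebra_FG assms(2,3) class_map_basis_closed[OF assms(1)]]
  by (simp only: class_map_def FG_simps)

lemma class_map_diff:
  assumes "f \<in> S \<rightarrow> carrier IM" "keys p \<subseteq> S" "keys q \<subseteq> S"
  shows "class_map f (p - q) = class_map f p - class_map f q"
  using class_map_add[OF assms(1) keys_diff_subset[OF assms(2,3)] assms(3)] by (simp add: algebra_simps)

lemma class_map_single:
  assumes "f \<in> S \<rightarrow> carrier IM" "C \<in> S"
  shows "class_map f (single C c) = single (f C) c"
proof -
  have "class_map f (single C c) = c \<odot>\<^bsub>FG\<^esub> single (f C) 1"
    unfolding class_map_def using class_map_basis_closed[OF assms(1)] assms(2)
    by (intro assoc_algebra.linext_single[OF algebra_FG]) blast
  then show ?thesis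
    by (simp add: free_green_def poly_mapping_eqI lookup_scale lookup_single when_def)
qed

lemma class_map_relation:
  assumes "f \<in> S \<rightarrow> carrier IM" "A \<in> S" "B \<in> S" "C \<in> S"
  shows "class_map f (single A 1 - single B 1 - single C 1) =
    single (f A) 1 - single (f B) 1 - single (f C) 1"
  using assms by (simp add: class_map_diff[OF assms(1)] class_map_single[OF assms(1)] keys_diff_subset)

lemma ring_green_ring: "ring (green_ring H)"
  unfolding green_ring_def by (rule ideal.quotient_is_ring[OF ideal_green_sub])

end

section \<open>Hopf algebras generated by group-like and skew-primitive elements\<close>

lemma presented_hopf_simps [simp]:
  "carrier (presented_hopf A \<Delta> \<epsilon>) = carrier A" "monoid.mult (presented_hopf A \<Delta> \<epsilon>) = monoid.mult A"
  "one (presented_hopf A \<Delta> \<epsilon>) = one A" "ring.zero (presented_hopf A \<Delta> \<epsilon>) = ring.zero A"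
  "add (presented_hopf A \<Delta> \<epsilon>) = add A" "module.smult (presented_hopf A \<Delta> \<epsilon>) = module.smult A"
  "comult (presented_hopf A \<Delta> \<epsilon>) = alg_map (tensor_alg A A) \<Delta>"
  "counit (presented_hopf A \<Delta> \<epsilon>) = alg_map complex_alg \<epsilon>"
  by (simp_all add: presented_hopf_def)

lemma alg_hom_presented_hopf [simp]: "alg_hom (presented_hopf A \<Delta> \<epsilon>) B = alg_hom A B"
  by (simp add: alg_hom_def Ring.ring_hom_def)

lemma assoc_algebra_presented_hopf:
  assumes "assoc_algebra A"
  shows "assoc_algebra (presented_hopf A \<Delta> \<epsilon>)"
proof -
  interpret A: assoc_algebra A by fact
  have "ring (presented_hopf A \<Delta> \<epsilon>)"
  proof (rule ringI)
    show "abelian_group (presented_hopf A \<Delta> \<epsilon>)"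
      using A.a_assoc A.a_comm A.l_neg by (intro abelian_groupI) auto
    show "monoid (presented_hopf A \<Delta> \<epsilon>)"
      using A.m_assoc by (intro monoidI) auto
  qed (use A.l_distr A.r_distr in auto)
  then show ?thesis
    by (intro assoc_algebra.intro assoc_algebra_axioms.intro)
      (auto simp: A.smult_l_distr A.smult_r_distr A.smult_assoc A.smult_mult_l A.smult_mult_r)
qed

text \<open>The generators with \<open>prim x\<close> have coproduct \<open>\<sigma> x \<otimes> x + x \<otimes> 1\<close>, the others are group-like;
  \<open>\<sigma> x\<close> is meaningless for the latter.\<close>

locale skew_hopf = presentation X R for X :: "'g set" and R +
  fixes \<Delta> :: "'g \<Rightarrow> ((('g list \<Rightarrow>\<^sub>0 complex) set \<times> ('g list \<Rightarrow>\<^sub>0 complex) set) \<Rightarrow>\<^sub>0 complex) set"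
    and \<epsilon> :: "'g \<Rightarrow> complex" and \<sigma> :: "'g \<Rightarrow> 'g" and prim :: "'g \<Rightarrow> bool"
  assumes Delta_grouplike: "\<And>x. x \<in> X \<Longrightarrow> \<not> prim x \<Longrightarrow> \<Delta> x = tens A A (e x) (e x)"
    and Delta_prim: "\<And>x. x \<in> X \<Longrightarrow> prim x \<Longrightarrow>
      \<Delta> x = tens A A (e (\<sigma> x)) (e x) \<oplus>\<^bsub>tensor_alg A A\<^esub> tens A A (e x) \<one>\<^bsub>A\<^esub>"
    and sigma_closed: "\<And>x. x \<in> X \<Longrightarrow> prim x \<Longrightarrow> \<sigma> x \<in> X"
    and sigma_grouplike: "\<And>x. x \<in> X \<Longrightarrow> prim x \<Longrightarrow> \<not> prim (\<sigma> x)"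
    and Delta_satisfies: "satisfies (tensor_alg A A) \<Delta> R"
    and eps_eq: "\<And>x. x \<in> X \<Longrightarrow> \<epsilon> x = (if prim x then 0 else 1)"
    and eps_satisfies: "satisfies complex_alg \<epsilon> R"
begin

abbreviation "H \<equiv> presented_hopf A \<Delta> \<epsilon>"

sublocale tp: tensor_product A A
  by (intro tensor_product.intro algebra_A)

sublocale module_category H
  by (intro module_category.intro assoc_algebra_presented_hopf algebra_A)

lemma Delta_closed: "\<Delta> \<in> X \<rightarrow> carrier (tensor_alg A A)"
proof
  interpret T: assoc_algebra "tensor_alg A A" by (rule tp.algebra_T)
  interpret A': assoc_algebra A by (rule algebra_A)
  fix x assume "x \<in> X"
  then show "\<Delta> x \<in> carrier (tensor_alg A A)"
    using gen_closed sigma_closed by (cases "prim x") (auto simp: Delta_grouplike Delta_prim)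
qed

sublocale cm: presented_map X R "tensor_alg A A" \<Delta>
  by (intro presented_map.intro presented_map_axioms.intro presentation_axioms tp.algebra_T
      Delta_closed Delta_satisfies)

sublocale cu: presented_map X R complex_alg \<epsilon>
  by (intro presented_map.intro presented_map_axioms.intro presentation_axioms assoc_algebra_complex
      eps_satisfies) simp

lemma gen_in_H [simp]: "x \<in> X \<Longrightarrow> e x \<in> carrier H"
  using gen_closed by simp

lemma fd_module_iff: "md M \<longleftrightarrow> snd M \<in> alg_hom A (mat_alg (fst M)) \<and> snd M \<in> extensional (carrier A)"
  by (simp add: fd_module_def)

text \<open>The action is determined by the generators, and extensionality fixes it off the carrier;
  hence an equality of modules and not just an isomorphism.\<close>

lemma module_ext:
  assumes "md M" "md N" "fst M = fst N" and gen: "\<And>x. x \<in> X \<Longrightarrow> snd M (e x) = snd N (e x)"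
  shows "M = N"
proof (rule prod_eqI)
  show "snd M = snd N"
  proof (rule extensionalityI)
    show "snd M \<in> extensional (carrier A)" "snd N \<in> extensional (carrier A)"
      using assms by (auto simp: fd_module_iff)
    fix h assume "h \<in> carrier A"
    then show "snd M h = snd N h"
    proof (induction rule: presented_induct)
      case (gen x)
      then show ?case by (rule assms(4))
    qed (use act_simps[OF assms(1)] act_simps[OF assms(2)] assms(3) in auto)
  qed
qed fact

text \<open>The elements whose actions are intertwined by \<open>P\<close> form a
  subalgebra.\<close>

lemma intwI:
  assumes M: "md M" and N: "md N" and P: "P \<in> carrier_mat (fst N) (fst M)"
    and gen: "\<And>x. x \<in> X \<Longrightarrow> P * snd M (e x) = snd N (e x) * P"
  shows "iw M N P"
proof -
  note [simp] = carrier_matD[OF P] act_dim[OF M] act_dim[OF N] act_simps[OF M] act_simps[OF N]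
  note mc = act_carrier[OF M, simplified] act_carrier[OF N, simplified]
  have "P * snd M h = snd N h * P" if "h \<in> carrier A" for h
    using that
  proof (induction rule: presented_induct)
    case (gen x)
    then show ?case by (rule assms(4))
  next
    case one
    then show ?case using P act_simps(4)[OF M] act_simps(4)[OF N] by simp
  next
    case (add a b)
    have "P * (snd M a + snd M b) = P * snd M a + P * snd M b"
      using add mc by (intro add_mult_dim) auto
    also have "\<dots> = (snd N a + snd N b) * P"
      using add mc P by (subst mult_add_dim) auto
    finally show ?case using add act_simps(2)[OF M, of a b] act_simps(2)[OF N, of a b] by simp
  next
    case (mult a b)
    have "P * (snd M a * snd M b) = (P * snd M a) * snd M b"
      using mult mc P by (subst mat_assoc_dim) auto
    also have "\<dots> = snd N a * (P * snd M b)"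
      using mult mc P by (simp add: mat_assoc_dim)
    also have "\<dots> = (snd N a * snd N b) * P"
      using mult mc P by (simp add: mat_assoc_dim)
    finally show ?case using mult act_simps(1)[OF M, of a b] act_simps(1)[OF N, of a b] by simp
  next
    case (smult c a)
    have "P * (c \<cdot>\<^sub>m snd M a) = c \<cdot>\<^sub>m (P * snd M a)"
      using mc(1)[OF smult(1)] P by (intro mult_smult_distrib)
    also have "\<dots> = (c \<cdot>\<^sub>m snd N a) * P"
      using smult(2) mult_smult_assoc_mat[OF mc(2)[OF smult(1)] P] by simp
    finally show ?case using smult act_simps(3)[OF M, of a c] act_simps(3)[OF N, of a c] by simp
  qed
  then show ?thesis using P by (simp add: intw_def)
qed

text \<open>By the presentation, a family of matrices that satisfies the relators is all it takes to
  give a module.\<close>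

lemma module_of_gens:
  assumes f: "f \<in> X \<rightarrow> carrier_mat d d" and sat: "satisfies (mat_alg d) f R"
  defines "M \<equiv> (d, restrict (alg_map (mat_alg d) f) (carrier A))"
  shows "md M" "\<And>x. x \<in> X \<Longrightarrow> snd M (e x) = f x"
proof -
  interpret m: presented_map X R "mat_alg d" f
    using f by (intro presented_map.intro presented_map_axioms.intro presentation_axioms assoc_algebra_mat sat) simp
  show "md M"
    unfolding fd_module_iff M_def using alg_hom_restrict[OF m.alg_map_hom algebra_A] by simp
  show "snd M (e x) = f x" if "x \<in> X" for x
    using that gen_closed m.alg_map_gen by (simp add: M_def)
qed

section \<open>Tensor products of modules along the coproduct\<close>

abbreviation "tensor_action M N \<equiv>
  induced (mat_alg (fst M * fst N)) (\<lambda>(a, b). kron (snd M a) (snd N b))"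

text \<open>The universal property of the tensor square, applied to the Kronecker product of the two
  actions, which is bilinear and multiplicative.\<close>

lemma tensor_induced:
  assumes M: "md M" and N: "md N"
  shows "tensor_action M N \<in> alg_hom (tensor_alg A A) (mat_alg (fst M * fst N))"
    and "a \<in> carrier A \<Longrightarrow> b \<in> carrier A \<Longrightarrow> tensor_action M N (tens A A a b) = kron (snd M a) (snd N b)"
proof -
  note c = act_carrier[OF M, simplified] act_carrier[OF N, simplified]
  note s = act_simps[OF M, simplified] act_simps[OF N, simplified] c kron_mult[OF c(1) c(2) c(1) c(2)]
    kron_add_left[OF c(1) c(1) c(2)] kron_add_right[OF c(1) c(2) c(2)] kron_smult_left[OF c(1) c(2)]
    kron_smult_right[OF c(1) c(2)] kron_carrier[OF c(1) c(2)]
  show "tensor_action M N \<in> alg_hom (tensor_alg A A) (mat_alg (fst M * fst N))"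
    by (rule tp.induced_tensor(1)[OF assoc_algebra_mat]) (simp_all add: s)
  show "tensor_action M N (tens A A a b) = kron (snd M a) (snd N b)" if "a \<in> carrier A" "b \<in> carrier A"
    using that by (subst tp.induced_tensor(2)[OF assoc_algebra_mat]) (simp_all add: s)
qed

text \<open>The action is a composite of two algebra maps, the coproduct and the action of the
  tensor square. The first exists because the values of \<open>\<Delta>\<close> satisfy the
  relators.\<close>

lemma mod_tensor_md:
  assumes "md M" "md N"
  shows "md (mod_tensor H M N)"
  unfolding fd_module_iff mod_tensor_def
  using alg_hom_restrict[OF alg_hom_compose[OF cm.alg_map_hom tensor_induced(1)[OF assms]] algebra_A]
  by simp

lemma mod_tensor_gen:
  assumes M: "md M" and N: "md N" and x: "x \<in> X"
  shows "snd (mod_tensor H M N) (e x) =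
    (if prim x then kron (snd M (e (\<sigma> x))) (snd N (e x)) + kron (snd M (e x)) (1\<^sub>m (fst N))
     else kron (snd M (e x)) (snd N (e x)))"
proof -
  interpret T: assoc_algebra "tensor_alg A A" by (rule tp.algebra_T)
  have one: "\<one>\<^bsub>A\<^esub> \<in> carrier A" using one_closed by simp
  note g = gen_closed[OF x]
  have "snd (mod_tensor H M N) (e x) = tensor_action M N (\<Delta> x)"
    using g x cm.alg_map_gen by (simp add: mod_tensor_def)
  also have "\<dots> = (if prim x then kron (snd M (e (\<sigma> x))) (snd N (e x)) + kron (snd M (e x)) (1\<^sub>m (fst N))
     else kron (snd M (e x)) (snd N (e x)))"
  proof (cases "prim x")
    case False
    then show ?thesis using x g by (simp add: Delta_grouplike tensor_induced(2)[OF M N])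
  next
    case True
    have \<sigma>: "e (\<sigma> x) \<in> carrier A" using x True sigma_closed gen_closed by auto
    show ?thesis
      using True x g \<sigma> one act_simps(4)[OF N]
        alg_homD(3)[OF tensor_induced(1)[OF M N] tp.tens_closed[OF \<sigma> g] tp.tens_closed[OF g one]]
      by (simp add: Delta_prim tensor_induced(2)[OF M N])
  qed
  finally show ?thesis .
qed

lemma mod_unit_md: "md (mod_unit H)"
proof -
  note c = alg_homD[OF cu.alg_map_hom]
  show ?thesis
    unfolding mod_unit_def
    by (rule fd_moduleI) (auto simp: c scalar_prod_def algebra_simps)
qed

lemma mod_unit_gen: "x \<in> X \<Longrightarrow> snd (mod_unit H) (e x) = (if prim x then 0\<^sub>m 1 1 else 1\<^sub>m 1)"
  using gen_closed cu.alg_map_gen eps_eq by (auto simp: mod_unit_def)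

lemma fst_mod_unit [simp]: "fst (mod_unit H) = 1"
  by (simp add: mod_unit_def)

lemma fst_mod_tensor [simp]: "fst (mod_tensor H M N) = fst M * fst N"
  by (simp add: mod_tensor_def)

sublocale tensor_category H
proof
  fix L M N assume L: "md L" and M: "md M" and N: "md N"
  note c = act_carrier[OF L gen_in_H] act_carrier[OF M gen_in_H] act_carrier[OF N gen_in_H]
  show "mod_tensor H (mod_tensor H L M) N = mod_tensor H L (mod_tensor H M N)"
  proof (rule module_ext)
    fix x assume x: "x \<in> X"
    show "snd (mod_tensor H (mod_tensor H L M) N) (e x) = snd (mod_tensor H L (mod_tensor H M N)) (e x)"
    proof (cases "prim x")
      case False
      then show ?thesis using x L M N by (simp add: mod_tensor_gen mod_tensor_md kron_assoc)
    next
      case True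
      note \<sigma> = sigma_closed[OF x True] sigma_grouplike[OF x True]
      have one: "(1\<^sub>m (fst M * fst N) :: complex mat) = kron (1\<^sub>m (fst M)) (1\<^sub>m (fst N))" by simp
      have k: "kron (snd L (e (\<sigma> x))) (snd M (e x)) \<in> carrier_mat (fst L * fst M) (fst L * fst M)"
        "kron (snd L (e x)) (1\<^sub>m (fst M)) \<in> carrier_mat (fst L * fst M) (fst L * fst M)"
        "kron (snd M (e (\<sigma> x))) (snd N (e x)) \<in> carrier_mat (fst M * fst N) (fst M * fst N)"
        "kron (snd M (e x)) (1\<^sub>m (fst N)) \<in> carrier_mat (fst M * fst N) (fst M * fst N)"
        using c x \<sigma> by auto
      \<comment> \<open>Coassociativity on a skew-primitive generator: both bracketings give three
        terms, with \<open>x\<close> acting on \<open>N\<close>, on \<open>M\<close> or on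
        \<open>L\<close>, preceded by \<open>\<sigma> x\<close> and followed by 1. The term for
        \<open>N\<close> relies on \<open>\<sigma> x\<close> being group-like.\<close>
      have "snd (mod_tensor H (mod_tensor H L M) N) (e x) =
        kron (snd L (e (\<sigma> x))) (kron (snd M (e (\<sigma> x))) (snd N (e x))) +
        (kron (snd L (e (\<sigma> x))) (kron (snd M (e x)) (1\<^sub>m (fst N))) +
         kron (snd L (e x)) (1\<^sub>m (fst M * fst N)))"
        using x True \<sigma> L M N
        by (simp add: mod_tensor_gen mod_tensor_md kron_add_left[OF k(1,2) one_carrier_mat] kron_assoc)
      also have "\<dots> = (kron (snd L (e (\<sigma> x))) (kron (snd M (e (\<sigma> x))) (snd N (e x))) +
        kron (snd L (e (\<sigma> x))) (kron (snd M (e x)) (1\<^sub>m (fst N)))) +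
         kron (snd L (e x)) (1\<^sub>m (fst M * fst N))"
        by (rule assoc_add_mat[symmetric, of _ "fst L * (fst M * fst N)" "fst L * (fst M * fst N)"])
          (use kron_carrier[OF c(1)[OF \<sigma>(1)] k(3)] kron_carrier[OF c(1)[OF \<sigma>(1)] k(4)] kron_carrier[OF c(1)[OF x] one_carrier_mat] in auto)
      also have "\<dots> = snd (mod_tensor H L (mod_tensor H M N)) (e x)"
        using x True \<sigma> L M N
        by (simp add: mod_tensor_gen mod_tensor_md kron_add_right[OF c(1)[OF \<sigma>(1)] k(3,4)])
      finally show ?thesis .
    qed
  qed (use L M N in \<open>simp_all add: mod_tensor_md mult.assoc\<close>)
next
  fix M assume M: "md M"
  note c = act_carrier[OF M gen_in_H]
  show "mod_tensor H (mod_unit H) M = M"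
  proof (rule module_ext)
    fix x assume x: "x \<in> X"
    \<comment> \<open>On the unit module group-likes act as 1 and skew-primitive generators as 0, so
      of the two terms of the coproduct only one survives.\<close>
    show "snd (mod_tensor H (mod_unit H) M) (e x) = snd M (e x)"
      using x M mod_unit_md sigma_closed sigma_grouplike kron_one_left[OF c[OF x]] c[OF x]
        kron_zero_left[OF one_carrier_mat, of 1 1 "fst M"]
      by (auto simp: mod_tensor_gen mod_unit_gen)
  qed (use M in \<open>simp_all add: mod_tensor_md mod_unit_md\<close>)
  show "mod_tensor H M (mod_unit H) = M"
  proof (rule module_ext)
    fix x assume x: "x \<in> X"
    show "snd (mod_tensor H M (mod_unit H)) (e x) = snd M (e x)"
      using x M mod_unit_md sigma_closed sigma_grouplike kron_one_right[OF c[OF x]] c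
        kron_zero_right[OF c, of "\<sigma> x" 1 1]
      by (auto simp: mod_tensor_gen mod_unit_gen)
  qed (use M in \<open>simp_all add: mod_tensor_md mod_unit_md\<close>)
next
  fix M M' N N' P Q
  assume M: "md M" and M': "md M'" and N: "md N" and N': "md N'" and P: "iw M M' P" and Q: "iw N N' Q"
  note c = act_carrier[OF M gen_in_H] act_carrier[OF M' gen_in_H] act_carrier[OF N gen_in_H]
    act_carrier[OF N' gen_in_H]
  note cP = intw_carrier[OF P] and cQ = intw_carrier[OF Q]
  have PM: "P * snd M (e x) = snd M' (e x) * P" if "x \<in> X" for x using P that by (simp add: intw_def gen_closed)
  have QN: "Q * snd N (e x) = snd N' (e x) * Q" if "x \<in> X" for x using Q that by (simp add: intw_def gen_closed)
  show "iw (mod_tensor H M N) (mod_tensor H M' N') (kron P Q)"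
  proof (rule intwI)
    show "kron P Q \<in> carrier_mat (fst (mod_tensor H M' N')) (fst (mod_tensor H M N))"
      using cP cQ by auto
    fix x assume x: "x \<in> X"
    show "kron P Q * snd (mod_tensor H M N) (e x) = snd (mod_tensor H M' N') (e x) * kron P Q"
    proof (cases "prim x")
      case False
      then show ?thesis
        using x M M' N N'
        by (simp add: mod_tensor_gen kron_mult[OF cP cQ c(1) c(3)] kron_mult[OF c(2) c(4) cP cQ] PM QN)
    next
      case True
      note \<sigma> = sigma_closed[OF x True]
      note [simp] = c[OF x, THEN carrier_matD(1)] c[OF x, THEN carrier_matD(2)]
        c[OF \<sigma>, THEN carrier_matD(1)] c[OF \<sigma>, THEN carrier_matD(2)]
        carrier_matD[OF cP] carrier_matD[OF cQ]
      have "kron P Q * (kron (snd M (e (\<sigma> x))) (snd N (e x)) + kron (snd M (e x)) (1\<^sub>m (fst N))) =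
        kron P Q * kron (snd M (e (\<sigma> x))) (snd N (e x)) + kron P Q * kron (snd M (e x)) (1\<^sub>m (fst N))"
        by (intro add_mult_dim) auto
      also have "\<dots> = kron (snd M' (e (\<sigma> x))) (snd N' (e x)) * kron P Q + kron (snd M' (e x)) (1\<^sub>m (fst N')) * kron P Q"
        using x \<sigma> cQ by (simp add: kron_mult[OF cP cQ c(1) c(3)] kron_mult[OF c(2) c(4) cP cQ] PM QN
          kron_mult[OF cP cQ c(1) one_carrier_mat] kron_mult[OF c(2) one_carrier_mat cP cQ])
      also have "\<dots> = (kron (snd M' (e (\<sigma> x))) (snd N' (e x)) + kron (snd M' (e x)) (1\<^sub>m (fst N'))) * kron P Q"
        by (intro mult_add_dim[symmetric]) auto
      finally show ?thesis using True x M M' N N' by (simp add: mod_tensor_gen)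
    qed
  qed (use M M' N N' in \<open>simp_all add: mod_tensor_md\<close>)
qed (use mod_tensor_md mod_unit_md in auto)

end

section \<open>The Nichols Hopf algebras and their doubles\<close>

text \<open>Turns quantification over a family of relators into quantification over its indices,
  with one version for each number of indices.\<close>

lemma ball_compr:
  "(\<forall>r\<in>{g i | i. P i}. Q r) \<longleftrightarrow> (\<forall>i. P i \<longrightarrow> Q (g i))"
  "(\<forall>r\<in>{g2 i j | i j. P2 i j}. Q r) \<longleftrightarrow> (\<forall>i j. P2 i j \<longrightarrow> Q (g2 i j))"
  "(\<forall>r\<in>{g3 i j k | i j k. P3 i j k}. Q r) \<longleftrightarrow> (\<forall>i j k. P3 i j k \<longrightarrow> Q (g3 i j k))"
  by blast+

context assoc_algebra
begin

lemma word_eval_Pi: "f \<in> X \<rightarrow> carrier A \<Longrightarrow> word_eval A f \<in> lists X \<rightarrow> carrier A"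
  using word_eval_closed by blast

lemma linext_quadratic:
  fixes f :: "'g \<Rightarrow> 'a"
  assumes f: "f \<in> X \<rightarrow> carrier A"
  shows "a \<in> X \<Longrightarrow> b \<in> X \<Longrightarrow> linext A (word_eval A f) (single [a, b] 1) = f a \<otimes> f b"
    and "a \<in> X \<Longrightarrow> b \<in> X \<Longrightarrow> linext A (word_eval A f) (single [a, b] 1 - single [] 1) = f a \<otimes> f b \<ominus> \<one>"
    and "a \<in> X \<Longrightarrow> b \<in> X \<Longrightarrow> c \<in> X \<Longrightarrow> d \<in> X \<Longrightarrow>
      linext A (word_eval A f) (single [a, b] 1 + single [c, d] 1) = f a \<otimes> f b \<oplus> f c \<otimes> f d"
    and "a \<in> X \<Longrightarrow> b \<in> X \<Longrightarrow> c \<in> X \<Longrightarrow> d \<in> X \<Longrightarrow>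
      linext A (word_eval A f) (single [a, b] 1 - single [c, d] 1) = f a \<otimes> f b \<ominus> f c \<otimes> f d"
    and "a \<in> X \<Longrightarrow> b \<in> X \<Longrightarrow> linext A (word_eval A f) (single [] 1 - single [a, b] 1) = \<one> \<ominus> f a \<otimes> f b"
  by (simp_all add: linext_add[OF _ _ word_eval_Pi[OF f]]
      linext_diff[OF _ _ word_eval_Pi[OF f]] funcset_mem[OF f])

lemma linext_commutation:
  fixes f :: "'g \<Rightarrow> 'a"
  assumes f: "f \<in> X \<rightarrow> carrier A" and abcd: "a \<in> X" "b \<in> X" "c \<in> X" "d \<in> X"
  shows "linext A (word_eval A f) (single [a, b] 1 + single [b, a] 1
      - (if P then single [] 1 - single [c, d] 1 else 0)) =
    (f a \<otimes> f b \<oplus> f b \<otimes> f a) \<ominus> (if P then \<one> \<ominus> f c \<otimes> f d else \<zero>)"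
proof -
  have ev: "word_eval A f \<in> lists X \<rightarrow> carrier A" using word_eval_closed[OF f] by auto
  have fX: "f x \<in> carrier A" if "x \<in> X" for x using f that by auto
  have 1: "keys (single [a, b] 1 + single [b, a] (1 :: 'c)) \<subseteq> lists X"
    "keys (single [] 1 - single [c, d] (1 :: 'c)) \<subseteq> lists X"
    using abcd by (intro keys_add_subset keys_diff_subset; simp)+
  show ?thesis
    using abcd fX 1 linext_diff[OF 1 ev]
    by (auto simp: linext_quadratic[OF f] a_minus_def)
qed

end

lemma satisfies_nichols:
  fixes B :: "(complex, 'b, 'n) module_scheme" (structure)
  assumes B: "assoc_algebra B" and f: "f \<in> nichols_gens m \<rightarrow> carrier B"
  shows "satisfies B f (nichols_rels m) \<longleftrightarrow>
    f NK \<otimes> f NK = \<one> \<and>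
    (\<forall>i\<in>{1..m}. f (NXi i) \<otimes> f (NXi i) = \<zero>) \<and>
    (\<forall>i\<in>{1..m}. f NK \<otimes> f (NXi i) \<oplus> f (NXi i) \<otimes> f NK = \<zero>) \<and>
    (\<forall>i\<in>{1..m}. \<forall>j\<in>{1..m}. i \<noteq> j \<longrightarrow> f (NXi i) \<otimes> f (NXi j) \<oplus> f (NXi j) \<otimes> f (NXi i) = \<zero>)"
proof -
  interpret B: assoc_algebra B by fact
  have X [simp]: "NK \<in> nichols_gens m" "i \<in> {1..m} \<Longrightarrow> NXi i \<in> nichols_gens m" for i
    by (auto simp: nichols_gens_def)
  have [simp]: "f NK \<in> carrier B" "i \<in> {1..m} \<Longrightarrow> f (NXi i) \<in> carrier B" for i
    using f X by blast+
  show ?thesis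
    unfolding satisfies_def nichols_rels_def ball_Un ball_compr
    by (simp add: B.linext_quadratic[OF f] B.r_right_minus_eq del: atLeastAtMost_iff) blast
qed

lemmas satisfies_nicholsD =
  satisfies_nichols[THEN iffD1, THEN conjunct1]
  satisfies_nichols[THEN iffD1, THEN conjunct2, THEN conjunct1, rule_format]
  satisfies_nichols[THEN iffD1, THEN conjunct2, THEN conjunct2, THEN conjunct1, rule_format]
  satisfies_nichols[THEN iffD1, THEN conjunct2, THEN conjunct2, THEN conjunct2, rule_format]

lemma all_bounded2:
  "(\<And>i j. i \<in> S \<Longrightarrow> j \<in> T \<Longrightarrow> A i j = B i j) \<Longrightarrow>
    (\<forall>i j. i \<in> S \<and> j \<in> T \<longrightarrow> A i j) = (\<forall>i\<in>S. \<forall>j\<in>T. B i j)"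
  by blast

lemma all_bounded3:
  "(\<And>i j k. i \<in> S \<Longrightarrow> j \<in> T \<Longrightarrow> k \<in> U \<Longrightarrow> P i j k = Q i j k) \<Longrightarrow>
    (\<forall>i j k. i \<in> S \<and> j \<in> T \<and> k \<in> U \<longrightarrow> P i j k) = (\<forall>i\<in>S. \<forall>j\<in>T. \<forall>k\<in>U. Q i j k)"
  by blast

lemma all_bounded3_distinct:
  "(\<And>i j k. i \<in> S \<Longrightarrow> j \<in> T \<Longrightarrow> k \<in> U \<Longrightarrow> j \<noteq> k \<Longrightarrow> P i j k = Q i j k) \<Longrightarrow>
    (\<forall>i j k. i \<in> S \<and> j \<in> T \<and> k \<in> U \<and> j \<noteq> k \<longrightarrow> P i j k) =
    (\<forall>i\<in>S. \<forall>j\<in>T. \<forall>k\<in>U. j \<noteq> k \<longrightarrow> Q i j k)"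
  by blast

lemma satisfies_dk:
  fixes B :: "(complex, 'b, 'n) module_scheme" (structure)
  assumes B: "assoc_algebra B" and f: "f \<in> dk_gens n \<rightarrow> carrier B"
  shows "satisfies B f (dk_rels n) \<longleftrightarrow>
    f DK \<otimes> f DK = \<one> \<and> f DK' \<otimes> f DK' = \<one> \<and> f DK \<otimes> f DK' = f DK' \<otimes> f DK \<and>
    (\<forall>k\<in>{DK, DK'}. \<forall>x\<in>{DXi, DXi'}. \<forall>i\<in>{1..n}. f k \<otimes> f (x i) \<oplus> f (x i) \<otimes> f k = \<zero>) \<and>
    (\<forall>x\<in>{DXi, DXi'}. \<forall>i\<in>{1..n}. f (x i) \<otimes> f (x i) = \<zero>) \<and>
    (\<forall>x\<in>{DXi, DXi'}. \<forall>i\<in>{1..n}. \<forall>j\<in>{1..n}. i \<noteq> j \<longrightarrow> f (x i) \<otimes> f (x j) \<oplus> f (x j) \<otimes> f (x i) = \<zero>) \<and>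
    (\<forall>i\<in>{1..n}. \<forall>j\<in>{1..n}. f (DXi' i) \<otimes> f (DXi j) \<oplus> f (DXi j) \<otimes> f (DXi' i) =
      (if i = j then \<one> \<ominus> f DK \<otimes> f DK' else \<zero>))"
proof -
  interpret B: assoc_algebra B by fact
  have X [simp]: "DK \<in> dk_gens n" "DK' \<in> dk_gens n" "i \<in> {1..n} \<Longrightarrow> DXi i \<in> dk_gens n"
    "i \<in> {1..n} \<Longrightarrow> DXi' i \<in> dk_gens n" for i
    by (auto simp: dk_gens_def)
  have c [simp]: "f DK \<in> carrier B" "f DK' \<in> carrier B" "i \<in> {1..n} \<Longrightarrow> f (DXi i) \<in> carrier B"
    "i \<in> {1..n} \<Longrightarrow> f (DXi' i) \<in> carrier B" for i
    using f X by blast+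
  have [simp]: "(if P then \<one> \<ominus> f DK \<otimes> f DK' else \<zero>) \<in> carrier B" for P by simp
  have 0: "(\<forall>r\<in>{word [DK, DK] - word [], word [DK', DK'] - word [], word [DK, DK'] - word [DK', DK]}. linext B (word_eval B f) r = \<zero>) \<longleftrightarrow>
    f DK \<otimes> f DK = \<one> \<and> f DK' \<otimes> f DK' = \<one> \<and> f DK \<otimes> f DK' = f DK' \<otimes> f DK"
    by (simp add: B.linext_quadratic[OF f] B.r_right_minus_eq)
  show ?thesis
    unfolding satisfies_def dk_rels_def ball_Un ball_compr 0 conj_assoc
  proof (intro arg_cong2[where f = "(\<and>)"] refl all_bounded2 all_bounded3 all_bounded3_distinct)
    fix i j assume "i \<in> {1..n}" "j \<in> {1..n}"
    then show "(linext B (word_eval B f) (word [DXi' i, DXi j] + word [DXi j, DXi' i]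
        - (if i = j then word [] - word [DK, DK'] else 0)) = \<zero>) =
      (f (DXi' i) \<otimes> f (DXi j) \<oplus> f (DXi j) \<otimes> f (DXi' i) = (if i = j then \<one> \<ominus> f DK \<otimes> f DK' else \<zero>))"
      by (subst B.linext_commutation[OF f]) (auto simp: B.r_right_minus_eq simp del: atLeastAtMost_iff)
  qed (use X in \<open>auto simp: B.linext_quadratic[OF f]\<close>)
qed

lemmas satisfies_dkD =
  satisfies_dk[THEN iffD1, THEN conjunct1]
  satisfies_dk[THEN iffD1, THEN conjunct2, THEN conjunct1]
  satisfies_dk[THEN iffD1, THEN conjunct2, THEN conjunct2, THEN conjunct1]
  satisfies_dk[THEN iffD1, THEN conjunct2, THEN conjunct2, THEN conjunct2, THEN conjunct1, rule_format]
  satisfies_dk[THEN iffD1, THEN conjunct2, THEN conjunct2, THEN conjunct2, THEN conjunct2, THEN conjunct1, rule_format]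
  satisfies_dk[THEN iffD1, THEN conjunct2, THEN conjunct2, THEN conjunct2, THEN conjunct2, THEN conjunct2, THEN conjunct1, rule_format]
  satisfies_dk[THEN iffD1, THEN conjunct2, THEN conjunct2, THEN conjunct2, THEN conjunct2, THEN conjunct2, THEN conjunct2, rule_format]

text \<open>The values on generators that occur inside \<open>nichols\<close>, named so that the
  general results on skew-primitively generated Hopf algebras can be instantiated.\<close>

definition nichols_Delta :: "nat \<Rightarrow> nichols_gen \<Rightarrow>
    (((nichols_gen list \<Rightarrow>\<^sub>0 complex) set \<times> (nichols_gen list \<Rightarrow>\<^sub>0 complex) set) \<Rightarrow>\<^sub>0 complex) set"
  where "nichols_Delta m =
    (let A = nichols_alg m; T = tensor_alg A A; e = nichols_el m in
       (\<lambda>x. case x of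
          NK \<Rightarrow> tens A A (e NK) (e NK)
        | NXi i \<Rightarrow> tens A A (e NK) (e (NXi i)) \<oplus>\<^bsub>T\<^esub> tens A A (e (NXi i)) \<one>\<^bsub>A\<^esub>))"

definition nichols_eps :: "nichols_gen \<Rightarrow> complex"
  where "nichols_eps x = (case x of NK \<Rightarrow> 1 | NXi i \<Rightarrow> 0)"

lemma nichols_eq: "nichols m = presented_hopf (presented_alg (nichols_gens m) (nichols_rels m)) (nichols_Delta m) nichols_eps"
  by (simp add: nichols_def nichols_Delta_def nichols_eps_def[abs_def] nichols_alg_def Let_def)

definition dk_Delta :: "nat \<Rightarrow> dk_gen \<Rightarrow>
    (((dk_gen list \<Rightarrow>\<^sub>0 complex) set \<times> (dk_gen list \<Rightarrow>\<^sub>0 complex) set) \<Rightarrow>\<^sub>0 complex) set"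
  where "dk_Delta n =
    (let A = dk_alg n; T = tensor_alg A A; e = dk_el n in
       (\<lambda>x. case x of
          DK \<Rightarrow> tens A A (e DK) (e DK)
        | DK' \<Rightarrow> tens A A (e DK') (e DK')
        | DXi i \<Rightarrow> tens A A (e DK) (e (DXi i)) \<oplus>\<^bsub>T\<^esub> tens A A (e (DXi i)) \<one>\<^bsub>A\<^esub>
        | DXi' i \<Rightarrow> tens A A (e DK') (e (DXi' i)) \<oplus>\<^bsub>T\<^esub> tens A A (e (DXi' i)) \<one>\<^bsub>A\<^esub>))"

definition dk_eps :: "dk_gen \<Rightarrow> complex"
  where "dk_eps x = (case x of DK \<Rightarrow> 1 | DK' \<Rightarrow> 1 | DXi i \<Rightarrow> 0 | DXi' i \<Rightarrow> 0)"

lemma dk_eq: "nichols_double n = presented_hopf (presented_alg (dk_gens n) (dk_rels n)) (dk_Delta n) dk_eps"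
  by (simp add: nichols_double_def dk_Delta_def dk_eps_def[abs_def] dk_alg_def Let_def)

definition dk_sigma :: "dk_gen \<Rightarrow> dk_gen"
  where "dk_sigma x = (case x of DXi' i \<Rightarrow> DK' | _ \<Rightarrow> DK)"

definition dk_prim :: "dk_gen \<Rightarrow> bool"
  where "dk_prim x \<longleftrightarrow> x \<notin> {DK, DK'}"

lemma nichols_gens_closed: "NK \<in> nichols_gens m" "i \<in> {1..m} \<Longrightarrow> NXi i \<in> nichols_gens m"
  by (auto simp: nichols_gens_def)

lemma dk_gens_closed: "DK \<in> dk_gens n" "DK' \<in> dk_gens n" "i \<in> {1..n} \<Longrightarrow> DXi i \<in> dk_gens n"
    "i \<in> {1..n} \<Longrightarrow> DXi' i \<in> dk_gens n"
  by (auto simp: dk_gens_def)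

lemma nichols_gensE:
  assumes "x \<in> nichols_gens m"
  obtains "x = NK" | i where "i \<in> {1..m}" "x = NXi i"
  using assms by (auto simp: nichols_gens_def)

lemma dk_gensE:
  assumes "x \<in> dk_gens n"
  obtains "x = DK" | "x = DK'" | i where "i \<in> {1..n}" "x = DXi i" | i where "i \<in> {1..n}" "x = DXi' i"
  using assms by (auto simp: dk_gens_def)

lemma presentation_nichols: "presentation (nichols_gens m) (nichols_rels m)"
proof
  show "nichols_rels m \<subseteq> carrier (free_alg (nichols_gens m))"
    unfolding nichols_rels_def free_alg_eq
    by (rule subsetI; elim UnE CollectE exE conjE; simp add: keys_add_subset keys_diff_subset nichols_gens_def)
qed

lemma presentation_dk: "presentation (dk_gens n) (dk_rels n)"
proof
  show "dk_rels n \<subseteq> carrier (free_alg (dk_gens n))"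
    unfolding dk_rels_def free_alg_eq
    by (rule subsetI; elim UnE CollectE exE conjE insertE emptyE;
        simp add: keys_add_subset keys_diff_subset dk_gens_def)
qed

section \<open>The coproduct respects the defining relations\<close>

locale tensor_square = tensor_product A A for A :: "(complex, 'a, 'm) module_scheme" (structure)
begin

abbreviation tmult (infixl "\<star>" 70) where "x \<star> y \<equiv> x \<otimes>\<^bsub>T\<^esub> y"
abbreviation tadd (infixl "\<boxplus>" 65) where "x \<boxplus> y \<equiv> x \<oplus>\<^bsub>T\<^esub> y"

sublocale T: assoc_algebra T by (rule algebra_T)

text \<open>The coproduct of a skew-primitive element \<open>x\<close> with associated group-like
  \<open>k\<close>.\<close>

definition skew :: "'a \<Rightarrow> 'a \<Rightarrow> (('a \<times> 'a) \<Rightarrow>\<^sub>0 complex) set"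
  where "skew k x = tn k x \<boxplus> tn x \<one>"

lemma skew_closed [simp]: "k \<in> carrier A \<Longrightarrow> x \<in> carrier A \<Longrightarrow> skew k x \<in> carrier T"
  by (simp add: skew_def)

lemma skew_mult:
  assumes [simp]: "k \<in> carrier A" "x \<in> carrier A" "l \<in> carrier A" "y \<in> carrier A"
  shows "skew k x \<star> skew l y =
    (tn (k \<otimes> l) (x \<otimes> y) \<boxplus> tn (x \<otimes> l) y) \<boxplus> (tn (k \<otimes> y) x \<boxplus> tn (x \<otimes> y) \<one>)"
  by (simp add: skew_def T.l_distr T.r_distr tens_mult)

text \<open>The mixed terms cancel in pairs because each group-like anticommutes with the other
  element; what is left involves only the anticommutator of \<open>x\<close> and
  \<open>y\<close>.\<close>

lemma skew_anticommutator:
  assumes [simp]: "k \<in> carrier A" "x \<in> carrier A" "l \<in> carrier A" "y \<in> carrier A"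
    and kl: "k \<otimes> l = l \<otimes> k"
    and ky: "k \<otimes> y \<oplus> y \<otimes> k = \<zero>"
    and lx: "l \<otimes> x \<oplus> x \<otimes> l = \<zero>"
  shows "skew k x \<star> skew l y \<boxplus> skew l y \<star> skew k x =
    tn (k \<otimes> l) (x \<otimes> y \<oplus> y \<otimes> x) \<boxplus> tn (x \<otimes> y \<oplus> y \<otimes> x) \<one>"
proof -
  have rearrange: "((a \<boxplus> b) \<boxplus> (c \<boxplus> d)) \<boxplus> ((a' \<boxplus> b') \<boxplus> (c' \<boxplus> d')) =
     ((a \<boxplus> a') \<boxplus> (d \<boxplus> d')) \<boxplus> ((b' \<boxplus> c) \<boxplus> (b \<boxplus> c'))"
    if "a \<in> carrier T" "b \<in> carrier T" "c \<in> carrier T" "d \<in> carrier T"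
      "a' \<in> carrier T" "b' \<in> carrier T" "c' \<in> carrier T" "d' \<in> carrier T" for a b c d a' b' c' d'
    using that by (simp add: T.a_ac)
  have "tn (y \<otimes> k) x \<boxplus> tn (k \<otimes> y) x = \<zero>\<^bsub>T\<^esub>"
    using ky by (simp add: A.a_comm tens_zero flip: tens_add_left)
  moreover have "tn (x \<otimes> l) y \<boxplus> tn (l \<otimes> x) y = \<zero>\<^bsub>T\<^esub>"
    using lx by (simp add: A.a_comm tens_zero flip: tens_add_left)
  ultimately show ?thesis
    by (subst skew_mult, simp_all, subst skew_mult, simp_all, subst rearrange)
      (simp_all add: kl tens_add_left tens_add_right)
qed

text \<open>Treated apart from the anticommutator, which at \<open>y = x\<close> yields only twice
  the square.\<close>

lemma skew_square:
  assumes [simp]: "k \<in> carrier A" "x \<in> carrier A"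
    and kx: "k \<otimes> x \<oplus> x \<otimes> k = \<zero>" and xx: "x \<otimes> x = \<zero>"
  shows "skew k x \<star> skew k x = \<zero>\<^bsub>T\<^esub>"
proof -
  have "tn (x \<otimes> k) x \<boxplus> tn (k \<otimes> x) x = \<zero>\<^bsub>T\<^esub>"
    using kx by (simp add: A.a_comm tens_zero flip: tens_add_left)
  then show ?thesis by (simp add: skew_mult xx tens_zero)
qed

text \<open>Each of the two terms of the coproduct anticommutes with \<open>g\<close> tensor
  \<open>g\<close> by itself: \<open>g\<close> commutes with one tensor factor and changes sign past
  the other.\<close>

lemma skew_grouplike_anticommutator:
  assumes [simp]: "g \<in> carrier A" "k \<in> carrier A" "x \<in> carrier A"
    and gk: "g \<otimes> k = k \<otimes> g"
    and gx: "g \<otimes> x \<oplus> x \<otimes> g = \<zero>"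
  shows "tn g g \<star> skew k x \<boxplus> skew k x \<star> tn g g = \<zero>\<^bsub>T\<^esub>"
proof -
  have rearrange: "(a \<boxplus> b) \<boxplus> (c \<boxplus> d) = (a \<boxplus> c) \<boxplus> (b \<boxplus> d)"
    if "a \<in> carrier T" "b \<in> carrier T" "c \<in> carrier T" "d \<in> carrier T" for a b c d
    using that by (simp add: T.a_ac)
  have "tn g g \<star> skew k x \<boxplus> skew k x \<star> tn g g =
    (tn (k \<otimes> g) (g \<otimes> x) \<boxplus> tn (g \<otimes> x) g) \<boxplus> (tn (k \<otimes> g) (x \<otimes> g) \<boxplus> tn (x \<otimes> g) g)"
    by (simp add: skew_def T.l_distr T.r_distr tens_mult gk)
  also have "\<dots> = \<zero>\<^bsub>T\<^esub>"
    by (subst rearrange) (simp_all add: gx tens_zero flip: tens_add_left tens_add_right)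
  finally show ?thesis .
qed

lemma coproduct_satisfies_nichols:
  assumes f: "f \<in> nichols_gens m \<rightarrow> carrier A" and sat: "satisfies A f (nichols_rels m)"
    and D: "d NK = tn (f NK) (f NK)" "\<And>i. d (NXi i) = skew (f NK) (f (NXi i))"
  shows "satisfies T d (nichols_rels m)"
proof -
  note [simp] = nichols_gens_closed funcset_mem[OF f]
  have dc: "d \<in> nichols_gens m \<rightarrow> carrier T"
    by (rule Pi_I, erule nichols_gensE) (simp_all add: D del: atLeastAtMost_iff)
  note rel = satisfies_nicholsD[OF A.assoc_algebra_axioms f sat]
  note KK = rel(1) and XX = rel(2) and KX = rel(3) and XY = rel(4)
  show ?thesis
    unfolding satisfies_nichols[OF algebra_T dc]
  proof (intro conjI ballI impI)
    show "d NK \<star> d NK = \<one>\<^bsub>T\<^esub>"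
      by (simp add: D tens_mult KK one_T)
  next
    fix i assume i: "i \<in> {1..m}"
    show "d (NXi i) \<star> d (NXi i) = \<zero>\<^bsub>T\<^esub>"
      unfolding D using i KX XX by (intro skew_square) (simp_all del: atLeastAtMost_iff)
    show "d NK \<star> d (NXi i) \<boxplus> d (NXi i) \<star> d NK = \<zero>\<^bsub>T\<^esub>"
      unfolding D using i KX by (intro skew_grouplike_anticommutator) (simp_all del: atLeastAtMost_iff)
    fix j assume j: "j \<in> {1..m}" and ij: "i \<noteq> j"
    show "d (NXi i) \<star> d (NXi j) \<boxplus> d (NXi j) \<star> d (NXi i) = \<zero>\<^bsub>T\<^esub>"
    proof -
      show ?thesis unfolding D using i j ij KX
        by (subst skew_anticommutator) (simp_all add: XY tens_zero del: atLeastAtMost_iff)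
    qed
  qed
qed

lemma coproduct_satisfies_dk:
  assumes f: "f \<in> dk_gens n \<rightarrow> carrier A" and sat: "satisfies A f (dk_rels n)"
    and D: "d DK = tn (f DK) (f DK)" "d DK' = tn (f DK') (f DK')"
      "\<And>i. d (DXi i) = skew (f DK) (f (DXi i))" "\<And>i. d (DXi' i) = skew (f DK') (f (DXi' i))"
  shows "satisfies T d (dk_rels n)"
proof -
  note [simp] = dk_gens_closed funcset_mem[OF f]
  have dc: "d \<in> dk_gens n \<rightarrow> carrier T"
    by (rule Pi_I, erule dk_gensE) (simp_all add: D del: atLeastAtMost_iff)
  note rel = satisfies_dkD[OF A.assoc_algebra_axioms f sat]
  note KK = rel(1-3) and KX = rel(4) and XX = rel(5) and XY = rel(6) and X'X = rel(7)
  note KX' = KX[of DK DXi, simplified] KX[of DK' DXi, simplified] KX[of DK DXi', simplified] KX[of DK' DXi', simplified]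
  note XX' = XX[of DXi, simplified] XX[of DXi', simplified]
  note XY' = XY[of DXi, simplified] XY[of DXi', simplified]
  define K where "K = f DK" define K' where "K' = f DK'"
  have Kc [simp]: "K \<in> carrier A" "K' \<in> carrier A" by (simp_all add: K_def K'_def)
  show ?thesis
    unfolding satisfies_dk[OF algebra_T dc]
  proof (intro conjI ballI impI)
    show "d DK \<star> d DK = \<one>\<^bsub>T\<^esub>" "d DK' \<star> d DK' = \<one>\<^bsub>T\<^esub>"
      "d DK \<star> d DK' = d DK' \<star> d DK"
      by (simp_all add: D tens_mult KK one_T)
  next
    fix k x i assume k: "k \<in> {DK, DK'}" and x: "x \<in> {DXi, DXi'}" and i: "i \<in> {1..n}"
    show "d k \<star> d (x i) \<boxplus> d (x i) \<star> d k = \<zero>\<^bsub>T\<^esub>"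
      using k x i KX' KK(3)
      by (elim insertE emptyE) (simp_all add: D skew_grouplike_anticommutator)
  next
    fix x i assume x: "x \<in> {DXi, DXi'}" and i: "i \<in> {1..n}"
    show "d (x i) \<star> d (x i) = \<zero>\<^bsub>T\<^esub>"
      using x i KX' XX' by (elim insertE emptyE) (simp_all add: D skew_square)
    fix j assume j: "j \<in> {1..n}" and ij: "i \<noteq> j"
    show "d (x i) \<star> d (x j) \<boxplus> d (x j) \<star> d (x i) = \<zero>\<^bsub>T\<^esub>"
      using x i j ij KX' XY'
      by (elim insertE emptyE) (simp_all add: D skew_anticommutator tens_zero)
  next
    fix i j assume i: "i \<in> {1..n}" and j: "j \<in> {1..n}"
    let ?d = "if i = j then \<one> \<ominus> K \<otimes> K' else \<zero>"
    have "d (DXi' i) \<star> d (DXi j) \<boxplus> d (DXi j) \<star> d (DXi' i) =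
      tn (K' \<otimes> K) ?d \<boxplus> tn ?d \<one>"
      unfolding D using i j KX' KK(3) X'X
      by (subst skew_anticommutator) (simp_all add: K_def K'_def)
    also have "\<dots> = (if i = j then \<one>\<^bsub>T\<^esub> \<ominus>\<^bsub>T\<^esub> d DK \<star> d DK' else \<zero>\<^bsub>T\<^esub>)"
    proof (cases "i = j")
      case False
      then show ?thesis by (simp add: tens_zero)
    next
      case True
      let ?g = "K \<otimes> K'"
      have K'K: "K' \<otimes> K = ?g" using KK(3) by (simp add: K_def K'_def)
      have gg: "?g \<otimes> ?g = \<one>"
      proof -
        have "?g \<otimes> ?g = K \<otimes> (K' \<otimes> K) \<otimes> K'" by (simp add: A.m_assoc)
        also have "\<dots> = (K \<otimes> K) \<otimes> (K' \<otimes> K')" unfolding K'K by (simp add: A.m_assoc)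
        finally show ?thesis using KK by (simp add: K_def K'_def)
      qed
      have m: "tn a (b \<ominus> c) = tn a b \<ominus>\<^bsub>T\<^esub> tn a c" "tn (b \<ominus> c) a = tn b a \<ominus>\<^bsub>T\<^esub> tn c a"
        if "a \<in> carrier A" "b \<in> carrier A" "c \<in> carrier A" for a b c
        using that by (simp_all add: a_minus_def tens_add_left tens_add_right tens_minus)
      have cancel: "(x \<ominus>\<^bsub>T\<^esub> y) \<boxplus> (z \<ominus>\<^bsub>T\<^esub> x) = z \<ominus>\<^bsub>T\<^esub> y"
        if "x \<in> carrier T" "y \<in> carrier T" "z \<in> carrier T" for x y z
      proof -
        have "(x \<ominus>\<^bsub>T\<^esub> y) \<boxplus> (z \<ominus>\<^bsub>T\<^esub> x) = (x \<boxplus> \<ominus>\<^bsub>T\<^esub> x) \<boxplus> (z \<ominus>\<^bsub>T\<^esub> y)"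
          using that by (simp add: a_minus_def T.a_ac)
        then show ?thesis using that by (simp add: T.r_neg)
      qed
      \<comment> \<open>Telescoping, with \<open>g = K K'\<close>: the terms \<open>g\<close> tensor
        1 cancel, and \<open>g\<close> tensor \<open>g\<close> is the product of the values of the
        coproduct at \<open>DK\<close> and \<open>DK'\<close>.\<close>
      have "tn ?g (\<one> \<ominus> ?g) \<boxplus> tn (\<one> \<ominus> ?g) \<one>
        = \<one>\<^bsub>T\<^esub> \<ominus>\<^bsub>T\<^esub> tn ?g ?g"
        by (simp add: m cancel one_T)
      then show ?thesis using True by (simp add: K'K D tens_mult flip: K_def K'_def)
    qed
    finally show "d (DXi' i) \<star> d (DXi j) \<boxplus> d (DXi j) \<star> d (DXi' i) =
      (if i = j then \<one>\<^bsub>T\<^esub> \<ominus>\<^bsub>T\<^esub> d DK \<star> d DK' else \<zero>\<^bsub>T\<^esub>)" .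
  qed
qed

end

lemma skew_hopf_nichols:
  "skew_hopf (nichols_gens m) (nichols_rels m) (nichols_Delta m) nichols_eps (\<lambda>_. NK) (\<lambda>x. x \<noteq> NK)"
proof -
  interpret P: presentation "nichols_gens m" "nichols_rels m" by (rule presentation_nichols)
  interpret T: tensor_square P.A by (intro tensor_square.intro tensor_product.intro P.algebra_A)
  show ?thesis
  proof
    show "satisfies T.T (nichols_Delta m) (nichols_rels m)"
      by (rule T.coproduct_satisfies_nichols[OF _ P.gen_satisfies])
        (use P.gen_closed in \<open>auto simp: nichols_Delta_def T.skew_def nichols_alg_def nichols_el_def Let_def\<close>)
    show "satisfies complex_alg nichols_eps (nichols_rels m)"
      by (subst satisfies_nichols[OF assoc_algebra_complex]) (auto simp: nichols_eps_def)
  qed (auto simp: nichols_Delta_def nichols_eps_def nichols_alg_def nichols_el_def Let_def nichols_gens_closed split: nichols_gen.splits)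
qed

lemma complex_alg_uminus: "\<ominus>\<^bsub>complex_alg\<^esub> x = - x"
proof -
  interpret C: assoc_algebra complex_alg by (rule assoc_algebra_complex)
  show ?thesis by (rule C.minus_equality) simp_all
qed

lemma skew_hopf_dk:
  "skew_hopf (dk_gens n) (dk_rels n) (dk_Delta n) dk_eps dk_sigma dk_prim"
proof -
  interpret P: presentation "dk_gens n" "dk_rels n" by (rule presentation_dk)
  interpret T: tensor_square P.A by (intro tensor_square.intro tensor_product.intro P.algebra_A)
  show ?thesis
  proof
    show "satisfies T.T (dk_Delta n) (dk_rels n)"
      by (rule T.coproduct_satisfies_dk[OF _ P.gen_satisfies])
        (use P.gen_closed in \<open>auto simp: dk_Delta_def T.skew_def dk_alg_def dk_el_def Let_def\<close>)
    show "satisfies complex_alg dk_eps (dk_rels n)"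
      by (subst satisfies_dk[OF assoc_algebra_complex]) (auto simp: dk_eps_def a_minus_def complex_alg_uminus)
  qed (auto simp: dk_Delta_def dk_eps_def dk_alg_def dk_el_def dk_prim_def dk_sigma_def Let_def dk_gens_closed split: dk_gen.splits)
qed

section \<open>Modules over the double on which the two group-likes agree\<close>

text \<open>Tested on unit vectors, that is, column by column. \<open>K_eq_K'\<close> speaks of
  vectors, while the arguments below compare matrices.\<close>

lemma mat_eq_if_mult_vec_eq:
  fixes A B :: "'a::semiring_1 mat"
  assumes "A \<in> carrier_mat m n" "B \<in> carrier_mat m n"
    and "\<And>v. v \<in> carrier_vec n \<Longrightarrow> A *\<^sub>v v = B *\<^sub>v v"
  shows "A = B"
proof (rule eq_matI)
  fix i j assume ij: "i < dim_row B" "j < dim_col B"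
  have "(A *\<^sub>v unit_vec n j) $ i = (B *\<^sub>v unit_vec n j) $ i"
    by (simp only: assms(3)[OF unit_vec_carrier])
  then show "A $$ (i, j) = B $$ (i, j)" using assms(1,2) ij by (simp add: scalar_prod_right_unit)
qed (use assms in auto)

text \<open>On a retract every element acts through the larger module, as \<open>p\<close> times its
  action there times \<open>i\<close>.\<close>

lemma (in module_category) act_eq_if_retract:
  assumes "md N" "md Y" "iw N Y i" "p \<in> carrier_mat (fst N) (fst Y)" "p * i = 1\<^sub>m (fst N)"
    and ab: "a \<in> carrier H" "b \<in> carrier H" and eq: "snd Y a = snd Y b"
  shows "snd N a = snd N b"
proof -
  note [simp] = intw_dim[OF assms(3)] carrier_matD[OF assms(4)] act_dim[OF assms(1)] act_dim[OF assms(2)]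
  have "snd N x = p * (snd Y x * i)" if x: "x \<in> carrier H" for x
  proof -
    have "snd N x = (p * i) * snd N x" using assms(5) act_carrier[OF assms(1) x] by simp
    also have "\<dots> = p * (i * snd N x)" using x by (simp add: mat_assoc_dim)
    also have "\<dots> = p * (snd Y x * i)" using assms(3) x by (simp add: intw_def)
    finally show ?thesis .
  qed
  then show ?thesis using ab eq by simp
qed

locale nichols_double_pair =
  fixes n :: nat
begin

sublocale N: skew_hopf "nichols_gens (2 * n)" "nichols_rels (2 * n)" "nichols_Delta (2 * n)" nichols_eps
    "\<lambda>_. NK" "\<lambda>x. x \<noteq> NK"
  by (rule skew_hopf_nichols)

sublocale D: skew_hopf "dk_gens n" "dk_rels n" "dk_Delta n" dk_eps dk_sigma dk_prim
  by (rule skew_hopf_dk)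

definition gen_proj :: "dk_gen \<Rightarrow> nichols_gen"
  where "gen_proj x = (case x of DK \<Rightarrow> NK | DK' \<Rightarrow> NK | DXi i \<Rightarrow> NXi i | DXi' i \<Rightarrow> NXi (n + i))"

lemma gen_proj_simps [simp]:
  "gen_proj DK = NK" "gen_proj DK' = NK" "gen_proj (DXi i) = NXi i" "gen_proj (DXi' i) = NXi (n + i)"
  by (simp_all add: gen_proj_def)

lemma gen_proj_closed [simp]: "x \<in> dk_gens n \<Longrightarrow> gen_proj x \<in> nichols_gens (2 * n)"
  by (erule dk_gensE) (auto simp: nichols_gens_def)

lemmas DK_gens [simp] = dk_gens_closed[where n = n]

text \<open>The unbarred generators cover the indices up to \<open>n\<close>, the barred ones those
  from \<open>n + 1\<close> to \<open>2 * n\<close>. Surjectivity is what makes the pullback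
  injective on modules and full on intertwiners.\<close>

lemma gen_proj_surj:
  assumes "y \<in> nichols_gens (2 * n)"
  obtains x where "x \<in> dk_gens n" "gen_proj x = y"
  using assms
proof (cases rule: nichols_gensE)
  case 1
  then show ?thesis using that[of DK] by (simp add: dk_gens_def)
next
  case (2 i)
  show ?thesis
  proof (cases "i \<le> n")
    case True
    then show ?thesis using that[of "DXi i"] 2 by (simp add: dk_gens_def)
  next
    case False
    then have "DXi' (i - n) \<in> dk_gens n" using 2 by (intro DK_gens(4)) auto
    then show ?thesis using that[of "DXi' (i - n)"] 2 False by simp
  qed
qed

lemma dk_proj_eq: "dk_proj n = alg_map N.A (\<lambda>x. N.e (gen_proj x))"
proof -
  have "(\<lambda>x. case x of DK \<Rightarrow> nichols_el (2 * n) NK | DK' \<Rightarrow> nichols_el (2 * n) NK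
      | DXi i \<Rightarrow> nichols_el (2 * n) (NXi i) | DXi' i \<Rightarrow> nichols_el (2 * n) (NXi (n + i)))
    = (\<lambda>x. N.e (gen_proj x))"
    by (auto simp: nichols_el_def fun_eq_iff split: dk_gen.splits)
  then show ?thesis by (simp add: dk_proj_def Let_def nichols_alg_def)
qed

text \<open>The images of \<open>K\<close> and \<open>K'\<close> coincide, so
  \<open>1 - K K'\<close> goes to 0 and the mixed relation becomes an anticommutation relation; the
  shift by \<open>n\<close> keeps its two generators distinct.\<close>

lemma proj_satisfies: "satisfies N.A (\<lambda>x. N.e (gen_proj x)) (dk_rels n)"
proof -
  have "N.e \<in> nichols_gens (2 * n) \<rightarrow> carrier N.A" using N.gen_closed by auto
  note rel = satisfies_nicholsD[OF N.algebra_A this N.gen_satisfies]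
  have [simp]: "\<one>\<^bsub>N.A\<^esub> \<ominus>\<^bsub>N.A\<^esub> \<one>\<^bsub>N.A\<^esub> = \<zero>\<^bsub>N.A\<^esub>" by (simp add: N.tp.A.r_right_minus_eq)
  show ?thesis
    by (subst satisfies_dk[OF N.algebra_A]) (auto simp: rel N.gen_closed)
qed

sublocale proj: presented_map "dk_gens n" "dk_rels n" N.A "\<lambda>x. N.e (gen_proj x)"
  by (intro presented_map.intro presented_map_axioms.intro D.presentation_axioms N.algebra_A proj_satisfies)
    (simp add: N.gen_closed)

section \<open>The pullback functor\<close>

abbreviation "prj \<equiv> dk_proj n"
abbreviation "F \<equiv> pullback D.H prj"

lemma prj_hom: "prj \<in> alg_hom D.A N.A"
  using proj.alg_map_hom by (simp add: dk_proj_eq)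

lemma prj_gen: "x \<in> dk_gens n \<Longrightarrow> prj (D.e x) = N.e (gen_proj x)"
  using proj.alg_map_gen by (simp add: dk_proj_eq)

lemma prj_closed: "h \<in> carrier D.A \<Longrightarrow> prj h \<in> carrier N.A"
  using alg_homD(1)[OF prj_hom] .

lemma fst_F [simp]: "fst (F M) = fst M"
  by (simp add: pullback_def)

lemma snd_F: "h \<in> carrier D.A \<Longrightarrow> snd (F M) h = snd M (prj h)"
  by (simp add: pullback_def)

lemma F_md: "N.md M \<Longrightarrow> D.md (F M)"
  unfolding D.fd_module_iff N.fd_module_iff pullback_def
  using alg_hom_restrict[OF alg_hom_compose[OF prj_hom, of "snd M"] D.algebra_A] by auto

lemma F_gen: "x \<in> dk_gens n \<Longrightarrow> snd (F M) (D.e x) = snd M (N.e (gen_proj x))"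
  by (simp add: snd_F D.gen_closed prj_gen)

lemma F_inj:
  assumes "N.md M" "N.md M'" "F M = F M'"
  shows "M = M'"
proof (rule N.module_ext[OF assms(1,2)])
  show "fst M = fst M'" using assms(3) by (metis fst_F)
  fix y assume "y \<in> nichols_gens (2 * n)"
  then obtain x where x: "x \<in> dk_gens n" "gen_proj x = y" by (rule gen_proj_surj)
  then show "snd M (N.e y) = snd M' (N.e y)" using F_gen[of x M] F_gen[of x M'] assms(3) by simp
qed

text \<open>The pullback is fully faithful: commuting with generators suffices, and every generator
  of the Nichols algebra is hit by one of the double.\<close>

lemma F_intw:
  assumes "N.md M" "N.md M'"
  shows "D.iw (F M) (F M') P \<longleftrightarrow> N.iw M M' P"
proof
  assume P: "D.iw (F M) (F M') P"
  show "N.iw M M' P"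
  proof (rule N.intwI[OF assms])
    show "P \<in> carrier_mat (fst M') (fst M)" using intw_carrier[OF P] by simp
    fix y assume "y \<in> nichols_gens (2 * n)"
    then obtain x where x: "x \<in> dk_gens n" "gen_proj x = y" by (rule gen_proj_surj)
    have "P * snd (F M) (D.e x) = snd (F M') (D.e x) * P"
      using P x D.gen_closed by (simp add: intw_def)
    then show "P * snd M (N.e y) = snd M' (N.e y) * P" using x by (simp add: F_gen)
  qed
next
  assume "N.iw M M' P"
  then show "D.iw (F M) (F M') P" by (simp add: intw_def snd_F prj_closed)
qed

lemma F_iso:
  assumes "N.md M" "N.md M'"
  shows "D.miso (F M) (F M') \<longleftrightarrow> N.miso M M'"
  using assms by (simp add: N.mod_iso_iff D.mod_iso_iff F_md F_intw)

lemma F_sum: "F (mod_sum N.H M M') = mod_sum D.H (F M) (F M')"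
  by (auto simp: pullback_def mod_sum_def prj_closed fun_eq_iff)

text \<open>Both sides are modules over the double, so they are compared on generators; there they
  agree because \<open>K\<close> and \<open>K'\<close> go to the same group-like. Compatibility of
  the projection with the coproduct enters only in this form.\<close>

lemma F_tensor:
  assumes M: "N.md M" "N.md M'"
  shows "F (mod_tensor N.H M M') = mod_tensor D.H (F M) (F M')"
proof (rule D.module_ext)
  fix x assume x: "x \<in> dk_gens n"
  then show "snd (F (mod_tensor N.H M M')) (D.e x) = snd (mod_tensor D.H (F M) (F M')) (D.e x)"
  proof (cases rule: dk_gensE)
  qed (use M x gen_proj_closed[OF x] D.sigma_closed[OF x] in \<open>simp_all add: F_gen N.mod_tensor_gen D.mod_tensor_gen F_md dk_prim_def dk_sigma_def\<close>)
qed (use M in \<open>simp_all add: F_md N.mod_tensor_md D.mod_tensor_md\<close>)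

lemma F_unit: "F (mod_unit N.H) = mod_unit D.H"
proof (rule D.module_ext)
  fix x assume x: "x \<in> dk_gens n"
  then show "snd (F (mod_unit N.H)) (D.e x) = snd (mod_unit D.H) (D.e x)"
  proof (cases rule: dk_gensE)
  qed (use x gen_proj_closed[OF x] in \<open>simp_all add: F_gen N.mod_unit_gen D.mod_unit_gen dk_prim_def\<close>)
qed (simp_all add: F_md N.mod_unit_md D.mod_unit_md)

section \<open>Modules that come from the Nichols algebra\<close>

lemma K_eq_K'_iff:
  assumes "D.md M"
  shows "K_eq_K' n M \<longleftrightarrow> snd M (D.e DK) = snd M (D.e DK')"
  unfolding K_eq_K'_def mod_act_def dk_el_def
  using mat_eq_if_mult_vec_eq[OF D.act_carrier[OF assms D.gen_in_H[OF DK_gens(1)]] D.act_carrier[OF assms D.gen_in_H[OF DK_gens(2)]]]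
  by auto

lemma K_eq_K'_F: "N.md M \<Longrightarrow> K_eq_K' n (F M)"
  by (simp add: K_eq_K'_iff F_md F_gen)

text \<open>If the two group-likes act by the same matrix, then \<open>K K'\<close> acts by \<open>K\<^sup>2 = 1\<close> and the
  commutation relations between \<open>\<xi>\<^sub>i\<close> and \<open>\<xi>'\<^sub>j\<close> become those of the Nichols algebra.\<close>

lemma descent:
  assumes M: "D.md M" and eq: "snd M (D.e DK) = snd M (D.e DK')"
  obtains W where "N.md W" "F W = M"
proof -
  define d where "d = fst M"
  interpret B: assoc_algebra "mat_alg d" by (rule assoc_algebra_mat)
  \<comment> \<open>Indices above \<open>n\<close> belong to the barred generators, shifted by
    \<open>n\<close>. The value at \<open>NK\<close> can be read off from either group-like, as they
    act equally.\<close>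
  define f where "f = (\<lambda>y. case y of NK \<Rightarrow> snd M (D.e DK)
    | NXi i \<Rightarrow> if i \<le> n then snd M (D.e (DXi i)) else snd M (D.e (DXi' (i - n))))"
  have fp: "f (gen_proj x) = snd M (D.e x)" if "x \<in> dk_gens n" for x
    using that by (cases rule: dk_gensE) (auto simp: f_def eq)
  have mc: "snd M (D.e x) \<in> carrier_mat d d" if "x \<in> dk_gens n" for x
    using D.act_carrier[OF M D.gen_in_H[OF that]] by (simp add: d_def)
  have fc: "f \<in> nichols_gens (2 * n) \<rightarrow> carrier_mat d d"
    using fp mc gen_proj_surj by (metis Pi_I)
  have fcM: "(\<lambda>x. snd M (D.e x)) \<in> dk_gens n \<rightarrow> carrier (mat_alg d)" using mc by auto
  have hom: "snd M \<in> alg_hom D.A (mat_alg d)" using M by (simp add: D.fd_module_iff d_def)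
  note rel = satisfies_dkD[OF assoc_algebra_mat fcM D.gen_image_satisfies[OF assoc_algebra_mat hom], unfolded mat_alg_simps]
  let ?m = "\<lambda>x. snd M (D.e x)"
  note KK = rel(1) and KX = rel(4)[of DK, OF insertI1] and XX = rel(5) and XY = rel(6)
  have X'X: "?m (DXi' i) * ?m (DXi j) + ?m (DXi j) * ?m (DXi' i) = 0\<^sub>m d d" if "i \<in> {1..n}" "j \<in> {1..n}" for i j
  proof -
    have "1\<^sub>m d \<ominus>\<^bsub>mat_alg d\<^esub> 1\<^sub>m d = 0\<^sub>m d d"
      using B.r_right_minus_eq[of "1\<^sub>m d" "1\<^sub>m d"] by simp
    then have "1\<^sub>m d \<ominus>\<^bsub>mat_alg d\<^esub> ?m DK * ?m DK' = 0\<^sub>m d d" using KK eq by simp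
    then show ?thesis using rel(7)[OF that] by simp
  qed
  have fX: "\<exists>x\<in>{DXi, DXi'}. \<exists>k\<in>{1..n}. f (NXi i) = ?m (x k)" if "i \<in> {1..2 * n}" for i
  proof (cases "i \<le> n")
    case True
    then show ?thesis using that by (intro bexI[of _ DXi] bexI[of _ i]) (auto simp: f_def)
  next
    case False
    then show ?thesis using that by (intro bexI[of _ DXi'] bexI[of _ "i - n"]) (auto simp: f_def)
  qed
  have "satisfies (mat_alg d) f (nichols_rels (2 * n))"
  proof (subst satisfies_nichols[OF assoc_algebra_mat])
    show "f \<in> nichols_gens (2 * n) \<rightarrow> carrier (mat_alg d)" using fc by simp
    show "f NK \<otimes>\<^bsub>mat_alg d\<^esub> f NK = \<one>\<^bsub>mat_alg d\<^esub> \<and>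
      (\<forall>i\<in>{1..2 * n}. f (NXi i) \<otimes>\<^bsub>mat_alg d\<^esub> f (NXi i) = \<zero>\<^bsub>mat_alg d\<^esub>) \<and>
      (\<forall>i\<in>{1..2 * n}. f NK \<otimes>\<^bsub>mat_alg d\<^esub> f (NXi i) \<oplus>\<^bsub>mat_alg d\<^esub> f (NXi i) \<otimes>\<^bsub>mat_alg d\<^esub> f NK = \<zero>\<^bsub>mat_alg d\<^esub>) \<and>
      (\<forall>i\<in>{1..2 * n}. \<forall>j\<in>{1..2 * n}. i \<noteq> j \<longrightarrow>
        f (NXi i) \<otimes>\<^bsub>mat_alg d\<^esub> f (NXi j) \<oplus>\<^bsub>mat_alg d\<^esub> f (NXi j) \<otimes>\<^bsub>mat_alg d\<^esub> f (NXi i) = \<zero>\<^bsub>mat_alg d\<^esub>)"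
      unfolding mat_alg_simps
    proof (intro conjI ballI impI)
      show "f NK * f NK = 1\<^sub>m d" using KK by (simp add: f_def)
    next
      fix i assume i: "i \<in> {1..2 * n}"
      obtain x k where xk: "x \<in> {DXi, DXi'}" "k \<in> {1..n}" "f (NXi i) = ?m (x k)" using fX[OF i] by blast
      show "f (NXi i) * f (NXi i) = 0\<^sub>m d d" unfolding xk(3) using XX[OF xk(1,2)] .
      show "f NK * f (NXi i) + f (NXi i) * f NK = 0\<^sub>m d d"
        unfolding xk(3) using KX[OF xk(1,2)] by (simp add: f_def)
      fix j assume j: "j \<in> {1..2 * n}" and ij: "i \<noteq> j"
      \<comment> \<open>The mixed relation has the barred generator first; the other order of the
        indices requires its two summands to be swapped.\<close>
      have mix: "?m (DXi k) * ?m (DXi' l) + ?m (DXi' l) * ?m (DXi k) = 0\<^sub>m d d" if "k \<in> {1..n}" "l \<in> {1..n}" for k l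
        using X'X[OF that(2,1)] mc[OF DK_gens(3)[OF that(1)]] mc[OF DK_gens(4)[OF that(2)]]
        by (subst comm_add_mat[of _ d d]) auto
      have ran: "k \<le> n \<Longrightarrow> k \<in> {1..n}" "\<not> k \<le> n \<Longrightarrow> k - n \<in> {1..n}" if "k \<in> {1..2 * n}" for k
        using that by auto
      note r = ran[OF i] ran[OF j]
      show "f (NXi i) * f (NXi j) + f (NXi j) * f (NXi i) = 0\<^sub>m d d"
      proof (cases "i \<le> n"; cases "j \<le> n")
        assume c: "i \<le> n" "j \<le> n"
        then show ?thesis using XY[of DXi i j] r(1)[OF c(1)] r(3)[OF c(2)] ij by (simp add: f_def)
      next
        assume c: "i \<le> n" "\<not> j \<le> n"
        then show ?thesis using mix[OF r(1)[OF c(1)] r(4)[OF c(2)]] by (simp add: f_def)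
      next
        assume c: "\<not> i \<le> n" "j \<le> n"
        then show ?thesis using X'X[OF r(2)[OF c(1)] r(3)[OF c(2)]] by (simp add: f_def)
      next
        assume c: "\<not> i \<le> n" "\<not> j \<le> n"
        then have "i - n \<noteq> j - n" using ij by auto
        then show ?thesis using XY[of DXi' "i - n" "j - n"] r(2)[OF c(1)] r(4)[OF c(2)] c by (simp add: f_def)
      qed
    qed
  qed
  note W = N.module_of_gens[OF fc this]
  show thesis
  proof (rule that[OF W(1)])
    show "F (d, restrict (alg_map (mat_alg d) f) (carrier N.A)) = M"
    proof (rule D.module_ext[OF F_md[OF W(1)] M])
      fix x assume x: "x \<in> dk_gens n"
      then show "snd (F (d, restrict (alg_map (mat_alg d) f) (carrier N.A))) (D.e x) = snd M (D.e x)"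
        using W(2)[OF gen_proj_closed[OF x]] fp by (simp only: F_gen)
    qed (simp add: d_def)
  qed
qed

end

section \<open>The summand on which the two group-likes agree\<close>

context nichols_double_pair
begin

abbreviation dk_mult (infixl "\<star>" 70) where "x \<star> y \<equiv> x \<otimes>\<^bsub>D.A\<^esub> y"
abbreviation dk_add (infixl "\<boxplus>" 65) where "x \<boxplus> y \<equiv> x \<oplus>\<^bsub>D.A\<^esub> y"

text \<open>As \<open>K K'\<close> is a central involution, this is a central idempotent; it projects every module
  onto its largest submodule on which \<open>K\<close> and \<open>K'\<close> agree.\<close>

definition half :: "(dk_gen list \<Rightarrow>\<^sub>0 complex) set"
  where "half = (1 / 2) \<odot>\<^bsub>D.A\<^esub> (\<one>\<^bsub>D.A\<^esub> \<boxplus> D.e DK \<star> D.e DK')"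

lemmas DK_closed [simp] = D.gen_closed[OF DK_gens(1)] D.gen_closed[OF DK_gens(2)]

lemma dk_gens_Pi: "D.e \<in> dk_gens n \<rightarrow> carrier D.A"
  using D.gen_closed by auto

lemmas dk_gen_relations = satisfies_dkD[OF D.algebra_A dk_gens_Pi D.gen_satisfies]

lemma half_closed [simp]: "half \<in> carrier D.A"
  unfolding half_def by (intro D.tp.A.smult_closed D.tp.A.a_closed D.tp.A.m_closed D.tp.A.one_closed DK_closed)

lemma DK_DK'_square:
  "(D.e DK \<star> D.e DK') \<star> (D.e DK \<star> D.e DK') = \<one>\<^bsub>D.A\<^esub>"
proof -
  have "(D.e DK \<star> D.e DK') \<star> (D.e DK \<star> D.e DK') =
    D.e DK \<star> (D.e DK' \<star> D.e DK) \<star> D.e DK'"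
    by (simp add: D.tp.A.m_assoc)
  also have "\<dots> = (D.e DK \<star> D.e DK) \<star> (D.e DK' \<star> D.e DK')"
    unfolding dk_gen_relations(3)[symmetric] by (simp add: D.tp.A.m_assoc)
  finally show ?thesis by (simp add: dk_gen_relations(1-3))
qed

text \<open>With \<open>c = K K'\<close> and \<open>c c = 1\<close>, the square of
  \<open>1 + c\<close> is twice \<open>1 + c\<close>; this is the origin of the factor
  \<open>1 / 2\<close>.\<close>

lemma half_idempotent: "half \<star> half = half"
proof -
  define c where "c = D.e DK \<star> D.e DK'"
  have c [simp]: "c \<in> carrier D.A" by (simp add: c_def)
  have "(\<one>\<^bsub>D.A\<^esub> \<boxplus> c) \<star> (\<one>\<^bsub>D.A\<^esub> \<boxplus> c) = (\<one>\<^bsub>D.A\<^esub> \<boxplus> c) \<boxplus> (c \<boxplus> c \<star> c)"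
    by (simp add: D.tp.A.l_distr D.tp.A.r_distr)
  also have "c \<boxplus> c \<star> c = \<one>\<^bsub>D.A\<^esub> \<boxplus> c"
    using DK_DK'_square by (simp add: D.tp.A.a_comm flip: c_def)
  also have "(\<one>\<^bsub>D.A\<^esub> \<boxplus> c) \<boxplus> (\<one>\<^bsub>D.A\<^esub> \<boxplus> c) = 2 \<odot>\<^bsub>D.A\<^esub> (\<one>\<^bsub>D.A\<^esub> \<boxplus> c)"
    using D.tp.A.smult_l_distr[of "\<one>\<^bsub>D.A\<^esub> \<boxplus> c" 1 1] by simp
  finally show ?thesis
    unfolding half_def c_def[symmetric]
    by (simp add: D.tp.A.smult_mult_l D.tp.A.smult_mult_r flip: D.tp.A.smult_assoc)
qed

text \<open>Multiplication by \<open>K K'\<close> exchanges \<open>K\<close> and \<open>K'\<close>,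
  so both sides are half of \<open>K + K'\<close>.\<close>

lemma DK_half: "D.e DK \<star> half = D.e DK' \<star> half"
proof -
  have "D.e DK \<star> (D.e DK \<star> D.e DK') = D.e DK'"
    using dk_gen_relations(1) by (simp flip: D.tp.A.m_assoc)
  moreover have "D.e DK' \<star> (D.e DK \<star> D.e DK') = D.e DK"
    unfolding dk_gen_relations(3) using dk_gen_relations(2) by (simp flip: D.tp.A.m_assoc)
  ultimately show ?thesis
    by (simp add: half_def D.tp.A.smult_mult_r D.tp.A.r_distr D.tp.A.a_comm)
qed

text \<open>\<open>K\<close> and \<open>K'\<close> pick up the same sign when moved past a
  generator, and the two signs cancel.\<close>

lemma DK_DK'_central_gen:
  assumes x: "x \<in> dk_gens n"
  shows "(D.e DK \<star> D.e DK') \<star> D.e x = D.e x \<star> (D.e DK \<star> D.e DK')"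
proof -
  let ?k = "D.e DK" and ?k' = "D.e DK'"
  note [simp] = D.gen_closed[OF x]
  \<comment> \<open>The witness \<open>s\<close> is 1 for the group-likes and -1 for the other
    generators.\<close>
  have "\<exists>s. (\<forall>k\<in>{DK, DK'}. D.e k \<star> D.e x = s \<odot>\<^bsub>D.A\<^esub> (D.e x \<star> D.e k)) \<and> s * s = 1"
    using x
  proof (cases rule: dk_gensE)
    case (3 i)
    have "D.e k \<star> D.e x = (- 1) \<odot>\<^bsub>D.A\<^esub> (D.e x \<star> D.e k)" if "k \<in> {DK, DK'}" for k
    proof -
      have k [simp]: "D.e k \<in> carrier D.A" using that by auto
      have "\<ominus>\<^bsub>D.A\<^esub> (D.e x \<star> D.e k) = D.e k \<star> D.e x"
        using dk_gen_relations(4)[OF that, of DXi i] 3 by (intro D.tp.A.minus_equality D.tp.A.m_closed D.gen_closed[OF x] k) simp_all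
      then show ?thesis by (simp add: D.tp.A.smult_minus)
    qed
    then show ?thesis by (intro exI[of _ "- 1"]) simp
  next
    case (4 i)
    have "D.e k \<star> D.e x = (- 1) \<odot>\<^bsub>D.A\<^esub> (D.e x \<star> D.e k)" if "k \<in> {DK, DK'}" for k
    proof -
      have k [simp]: "D.e k \<in> carrier D.A" using that by auto
      have "\<ominus>\<^bsub>D.A\<^esub> (D.e x \<star> D.e k) = D.e k \<star> D.e x"
        using dk_gen_relations(4)[OF that, of DXi' i] 4 by (intro D.tp.A.minus_equality D.tp.A.m_closed D.gen_closed[OF x] k) simp_all
      then show ?thesis by (simp add: D.tp.A.smult_minus)
    qed
    then show ?thesis by (intro exI[of _ "- 1"]) simp
  next
    case 1
    then show ?thesis using dk_gen_relations(3)[symmetric] by (intro exI[of _ 1]) simp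
  next
    case 2
    then show ?thesis using dk_gen_relations(3)[symmetric] by (intro exI[of _ 1]) simp
  qed
  then obtain s where s: "?k \<star> D.e x = s \<odot>\<^bsub>D.A\<^esub> (D.e x \<star> ?k)"
    "?k' \<star> D.e x = s \<odot>\<^bsub>D.A\<^esub> (D.e x \<star> ?k')" "s * s = 1"
    by auto
  have "(?k \<star> ?k') \<star> D.e x = s \<odot>\<^bsub>D.A\<^esub> ((?k \<star> D.e x) \<star> ?k')"
    by (simp add: D.tp.A.m_assoc s(2) D.tp.A.smult_mult_r)
  also have "\<dots> = (s * s) \<odot>\<^bsub>D.A\<^esub> (D.e x \<star> (?k \<star> ?k'))"
    by (simp add: D.tp.A.m_assoc s(1) D.tp.A.smult_mult_l D.tp.A.smult_assoc)
  finally show ?thesis using s(3) by simp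
qed

lemma half_central: "h \<in> carrier D.A \<Longrightarrow> half \<star> h = h \<star> half"
proof (induction rule: D.presented_induct)
  case (gen x)
  then show ?case using DK_DK'_central_gen[OF gen] D.gen_closed[OF gen]
    by (simp add: half_def D.tp.A.smult_mult_l D.tp.A.smult_mult_r D.tp.A.l_distr D.tp.A.r_distr)
next
  case (mult a b)
  then show ?case by (metis D.tp.A.m_assoc half_closed)
qed (simp_all add: D.tp.A.l_distr D.tp.A.r_distr D.tp.A.smult_mult_l D.tp.A.smult_mult_r)

text \<open>A splitting of the idempotent \<open>half\<close> among modules over the double, through
  an object pulled back from \<open>W\<close>. It is a relation because a splitting is determined
  only up to isomorphism.\<close>

definition is_plus where
  "is_plus M W \<longleftrightarrow> D.md M \<and> N.md W \<and> (\<exists>U V. D.iw (F W) M U \<and> D.iw M (F W) V \<and>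
    V * U = 1\<^sub>m (fst W) \<and> U * V = snd M half)"

text \<open>The image of the idempotent matrix becomes a module by letting \<open>h\<close> act as
  \<open>V h U\<close>. This is multiplicative because \<open>half\<close> is central, and it
  descends because \<open>K\<close> and \<open>K'\<close> agree after multiplication by
  \<open>half\<close>.\<close>

lemma plus_exists:
  assumes M: "D.md M"
  obtains W where "is_plus M W"
proof -
  define d where "d = fst M"
  define E where "E = snd M half"
  note s = D.act_simps[OF M, simplified]
  have Mc: "snd M h \<in> carrier_mat d d" if "h \<in> carrier D.A" for h
    using D.act_carrier[OF M, of h] that by (simp add: d_def)
  have E: "E \<in> carrier_mat d d" using Mc by (simp add: E_def)
  have EE: "E * E = E" using s(1)[of half half] half_idempotent by (simp add: E_def)
  obtain r U V where UV: "U \<in> carrier_mat d r" "V \<in> carrier_mat r d" "U * V = E" "V * U = 1\<^sub>m r"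
    using idempotent_splits[OF E EE] by metis
  note [simp] = carrier_matD[OF UV(1)] carrier_matD[OF UV(2)] carrier_matD[OF E]
    carrier_matD(1)[OF Mc] carrier_matD(2)[OF Mc]
  have com: "E * snd M h = snd M h * E" if "h \<in> carrier D.A" for h
    using s(1)[of half h] s(1)[of h half] half_central[OF that] that by (simp add: E_def)
  have EU: "E * U = U"
  proof -
    have "E * U = U * (V * U)" unfolding UV(3)[symmetric] by (simp add: mat_assoc_dim)
    then show ?thesis using UV by simp
  qed
  have VE: "V * E = V"
  proof -
    have "V * E = (V * U) * V" unfolding UV(3)[symmetric] by (simp add: mat_assoc_dim)
    then show ?thesis using UV by simp
  qed
  define \<rho> where "\<rho> = (\<lambda>h. V * snd M h * U)"
  define M' where "M' = (r, restrict \<rho> (carrier D.A))"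
  have rho: "snd M' h = V * (snd M h * U)" if "h \<in> carrier D.A" for h
    using that by (simp add: M'_def \<rho>_def mat_assoc_dim)
  have M': "D.md M'"
  proof -
    have "D.md (r, restrict \<rho> (carrier D.H))"
    proof (rule D.fd_moduleI)
      fix x y assume "x \<in> carrier D.H" "y \<in> carrier D.H"
      then have xy: "x \<in> carrier D.A" "y \<in> carrier D.A" by simp_all
      note [simp] = xy
      \<comment> \<open>The factor \<open>U * V = E\<close> between the two actions moves to the
        right by centrality and is absorbed by \<open>U\<close>.\<close>
      have "\<rho> x * \<rho> y = V * (snd M x * ((U * V) * (snd M y * U)))"
        by (simp add: \<rho>_def mat_assoc_dim)
      also have "\<dots> = V * (snd M x * ((E * snd M y) * U))"
        unfolding UV(3) by (simp add: mat_assoc_dim)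
      also have "\<dots> = V * (snd M x * (snd M y * (E * U)))"
        unfolding com[OF xy(2)] by (simp add: mat_assoc_dim)
      also have "\<dots> = \<rho> (x \<otimes>\<^bsub>D.H\<^esub> y)"
        unfolding EU by (simp add: \<rho>_def s mat_assoc_dim)
      finally show "\<rho> (x \<otimes>\<^bsub>D.H\<^esub> y) = \<rho> x * \<rho> y" by simp
      show "\<rho> (x \<oplus>\<^bsub>D.H\<^esub> y) = \<rho> x + \<rho> y"
        by (simp add: \<rho>_def s add_mult_dim mult_add_dim)
    next
      fix c x assume "x \<in> carrier D.H"
      then have x: "x \<in> carrier D.A" by simp
      note Mx = Mc[OF x]
      have "\<rho> (c \<odot>\<^bsub>D.H\<^esub> x) = V * (c \<cdot>\<^sub>m snd M x) * U" using x by (simp add: \<rho>_def s)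
      also have "\<dots> = c \<cdot>\<^sub>m \<rho> x"
        unfolding mult_smult_distrib[OF UV(2) Mx] \<rho>_def
        by (rule mult_smult_assoc_mat[OF mult_carrier_mat[OF UV(2) Mx] UV(1)])
      finally show "\<rho> (c \<odot>\<^bsub>D.H\<^esub> x) = c \<cdot>\<^sub>m \<rho> x" .
      show "\<rho> x \<in> carrier_mat r r" using UV Mx by (auto simp: \<rho>_def)
    qed (use s(4) UV in \<open>auto simp: \<rho>_def d_def\<close>)
    then show ?thesis by (simp add: M'_def)
  qed
  have U: "D.iw M' M U"
    unfolding intw_def
  proof (intro conjI ballI)
    show "U \<in> carrier_mat (fst M) (fst M')" using UV by (simp add: M'_def d_def)
    fix h assume "h \<in> carrier D.H"
    then have h: "h \<in> carrier D.A" by simp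
    have "U * snd M' h = (U * V) * (snd M h * U)" using h by (simp add: rho mat_assoc_dim)
    also have "\<dots> = (E * snd M h) * U" using h by (simp add: UV(3) mat_assoc_dim)
    also have "\<dots> = snd M h * (E * U)" using h by (simp add: com mat_assoc_dim)
    finally show "U * snd M' h = snd M h * U" by (simp add: EU)
  qed
  have V: "D.iw M M' V"
    unfolding intw_def
  proof (intro conjI ballI)
    show "V \<in> carrier_mat (fst M') (fst M)" using UV by (simp add: M'_def d_def)
    fix h assume "h \<in> carrier D.H"
    then have h: "h \<in> carrier D.A" by simp
    have "snd M' h * V = V * (snd M h * (U * V))" using h by (simp add: rho mat_assoc_dim)
    also have "\<dots> = V * (E * snd M h)" using h by (simp add: UV(3) com)
    also have "\<dots> = (V * E) * snd M h" using h by (simp add: mat_assoc_dim)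
    finally show "V * snd M h = snd M' h * V" by (simp add: VE)
  qed
  \<comment> \<open>The idempotent fixes the image of \<open>U\<close>, so on it \<open>k\<close>
    may be replaced by its product with \<open>half\<close>, where \<open>K\<close> and
    \<open>K'\<close> coincide.\<close>
  have "snd M (D.e k) * U = snd M (D.e k \<star> half) * U" if "k \<in> {DK, DK'}" for k
  proof -
    have k: "D.e k \<in> carrier D.A" using that by auto
    then have "snd M (D.e k \<star> half) * U = snd M (D.e k) * (E * U)"
      by (simp add: s mat_assoc_dim flip: E_def)
    then show ?thesis by (simp add: EU)
  qed
  then have "snd M (D.e DK) * U = snd M (D.e DK') * U"
    using DK_half by (metis insertCI)
  then have "snd M' (D.e DK) = snd M' (D.e DK')" by (simp add: rho)
  then obtain W where W: "N.md W" "F W = M'" using descent[OF M'] by metis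
  have "fst W = r" using W(2) by (metis fst_F M'_def fst_conv)
  then have "is_plus M W"
    unfolding is_plus_def W(2) using M W(1) U V UV E_def by metis
  then show thesis by (rule that)
qed

lemma is_plusE:
  assumes "is_plus M W"
  obtains U V where "D.iw (F W) M U" "D.iw M (F W) V" "V * U = 1\<^sub>m (fst W)" "U * V = snd M half"
    "D.md M" "N.md W" "D.md (F W)"
  using assms F_md by (auto simp: is_plus_def)

text \<open>On a pullback \<open>K K'\<close> acts as the square of \<open>K\<close>, which is 1, so
  \<open>half\<close> acts as the identity and is split by identity matrices.\<close>

lemma plus_F: assumes M: "N.md M" shows "is_plus (F M) M"
proof -
  note s = D.act_simps[OF F_md[OF M], simplified]
  let ?a = "snd (F M) (D.e DK)"
  have eq: "snd (F M) (D.e DK') = ?a" by (simp add: F_gen)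
  have "?a * ?a = 1\<^sub>m (fst M)"
    using s(1)[of "D.e DK" "D.e DK"] s(4) by (simp add: dk_gen_relations(1-3))
  then have "snd (F M) half = (1 / 2) \<cdot>\<^sub>m (1\<^sub>m (fst M) + 1\<^sub>m (fst M))"
    using s(4) by (simp add: half_def s eq)
  also have "\<dots> = 1\<^sub>m (fst M)" by (rule eq_matI) auto
  finally have "snd (F M) half = 1\<^sub>m (fst M)" .
  then show ?thesis
    using M F_md[OF M] D.intw_id[OF F_md[OF M]] unfolding is_plus_def
    by (intro conjI exI[of _ "1\<^sub>m (fst M)"]) simp_all
qed

text \<open>Two splittings of one idempotent are related by \<open>V' * U\<close> and
  \<open>V * U'\<close>. The isomorphism is found over the double and reflected back by the fully
  faithful pullback.\<close>

lemma plus_unique: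
  assumes W: "is_plus M W" and W': "is_plus M W'"
  shows "N.miso W W'"
proof -
  obtain U V where UV: "D.iw (F W) M U" "D.iw M (F W) V" "V * U = 1\<^sub>m (fst W)" "U * V = snd M half"
    "D.md M" "N.md W" "D.md (F W)" using W by (rule is_plusE)
  obtain U' V' where UV': "D.iw (F W') M U'" "D.iw M (F W') V'" "V' * U' = 1\<^sub>m (fst W')" "U' * V' = snd M half"
    "D.md M" "N.md W'" "D.md (F W')" using W' by (rule is_plusE)
  note [simp] = intw_dim[OF UV(1)] intw_dim[OF UV(2)] intw_dim[OF UV'(1)] intw_dim[OF UV'(2)]
  note c = intw_carrier[OF UV(1)] intw_carrier[OF UV(2)] intw_carrier[OF UV'(1)] intw_carrier[OF UV'(2)]
  have 1: "(V' * U) * (V * U') = 1\<^sub>m (fst W')"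
  proof -
    have "(V' * U) * (V * U') = V' * ((U * V) * U')" by (simp add: mat_assoc_dim)
    also have "\<dots> = (V' * U') * (V' * U')" unfolding UV(4) UV'(4)[symmetric] by (simp add: mat_assoc_dim)
    finally show ?thesis by (simp add: UV'(3))
  qed
  have 2: "(V * U') * (V' * U) = 1\<^sub>m (fst W)"
  proof -
    have "(V * U') * (V' * U) = V * ((U' * V') * U)" by (simp add: mat_assoc_dim)
    also have "\<dots> = (V * U) * (V * U)" unfolding UV'(4) UV(4)[symmetric] by (simp add: mat_assoc_dim)
    finally show ?thesis by (simp add: UV(3))
  qed
  have "D.miso (F W) (F W')"
    using 1 2 UV UV'
    by (intro D.mod_isoI[of _ _ "V' * U" "V * U'"] D.intw_comp[of _ M]) simp_all
  then show ?thesis using UV UV' by (simp add: F_iso)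
qed

text \<open>An isomorphism conjugates the splitting. Together with uniqueness this makes the summand
  a function on isomorphism classes.\<close>

lemma plus_transport:
  assumes M: "D.md M" and iso: "D.miso M M'" and W: "is_plus M' W"
  shows "is_plus M W"
proof -
  obtain U V where UV: "D.iw (F W) M' U" "D.iw M' (F W) V" "V * U = 1\<^sub>m (fst W)" "U * V = snd M' half"
    "D.md M'" "N.md W" "D.md (F W)" using W by (rule is_plusE)
  obtain P Q where PQ: "D.iw M M' P" "D.iw M' M Q" "P * Q = 1\<^sub>m (fst M')" "Q * P = 1\<^sub>m (fst M)"
    using iso D.mod_iso_iff[OF M UV(5)] by blast
  note [simp] = intw_dim[OF UV(1)] intw_dim[OF UV(2)] intw_dim[OF PQ(1)] intw_dim[OF PQ(2)]
  note c = intw_carrier[OF UV(1)] intw_carrier[OF UV(2)] intw_carrier[OF PQ(1)] intw_carrier[OF PQ(2)]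
  have 1: "(V * P) * (Q * U) = 1\<^sub>m (fst W)"
  proof -
    have "(V * P) * (Q * U) = V * ((P * Q) * U)" by (simp add: mat_assoc_dim)
    then show ?thesis using c by (simp add: PQ(3) UV(3))
  qed
  have Mc: "snd M half \<in> carrier_mat (fst M) (fst M)" using D.act_carrier[OF M] by simp
  note [simp] = carrier_matD[OF Mc]
  have 2: "(Q * U) * (V * P) = snd M half"
  proof -
    have "(Q * U) * (V * P) = Q * ((U * V) * P)" by (simp add: mat_assoc_dim)
    also have "\<dots> = Q * (P * snd M half)" using PQ(1) by (simp add: UV(4) intw_def)
    also have "\<dots> = (Q * P) * snd M half" by (simp add: mat_assoc_dim)
    finally show ?thesis using Mc by (simp add: PQ(4))
  qed
  show ?thesis
    unfolding is_plus_def using 1 2 M UV PQ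
    by (intro conjI exI[of _ "Q * U"] exI[of _ "V * P"] D.intw_comp[of _ M']) simp_all
qed

text \<open>The two splittings add up, since the inclusions commute with the action of
  \<open>half\<close>. This is the additivity that carries relations over the double to relations
  over the Nichols algebra.\<close>

lemma plus_sum:
  assumes W: "is_plus M W" and W': "is_plus M' W'"
  shows "is_plus (mod_sum D.H M M') (mod_sum N.H W W')"
proof -
  obtain U V where UV: "D.iw (F W) M U" "D.iw M (F W) V" "V * U = 1\<^sub>m (fst W)" "U * V = snd M half"
    "D.md M" "N.md W" "D.md (F W)" using W by (rule is_plusE)
  obtain U' V' where UV': "D.iw (F W') M' U'" "D.iw M' (F W') V'" "V' * U' = 1\<^sub>m (fst W')" "U' * V' = snd M' half"
    "D.md M'" "N.md W'" "D.md (F W')" using W' by (rule is_plusE)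
  define Y Z where "Y = mod_sum D.H M M'" and "Z = mod_sum D.H (F W) (F W')"
  have YZ: "D.md Y" "D.md Z" using UV UV' by (simp_all add: Y_def Z_def D.mod_sum_md)
  obtain i j p q where Y: "biproduct D.H M M' Y i j p q"
    unfolding Y_def using D.mod_sum_biproduct[OF UV(5) UV'(5)] .
  obtain i' j' p' q' where Z: "biproduct D.H (F W) (F W') Z i' j' p' q'"
    unfolding Z_def using D.mod_sum_biproduct[OF UV(7) UV'(7)] .
  have iw: "D.iw M Y i" "D.iw M' Y j" "D.iw Y M p" "D.iw Y M' q"
    "D.iw (F W) Z i'" "D.iw (F W') Z j'" "D.iw Z (F W) p'" "D.iw Z (F W') q'"
    using Y Z by (auto simp: biproduct_def)
  have c: "i \<in> carrier_mat (fst Y) (fst M)" "j \<in> carrier_mat (fst Y) (fst M')"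
    "p \<in> carrier_mat (fst M) (fst Y)" "q \<in> carrier_mat (fst M') (fst Y)"
    "i' \<in> carrier_mat (fst Z) (fst W)" "j' \<in> carrier_mat (fst Z) (fst W')"
    "p' \<in> carrier_mat (fst W) (fst Z)" "q' \<in> carrier_mat (fst W') (fst Z)"
    "U \<in> carrier_mat (fst M) (fst W)" "V \<in> carrier_mat (fst W) (fst M)"
    "U' \<in> carrier_mat (fst M') (fst W')" "V' \<in> carrier_mat (fst W') (fst M')"
    using iw[THEN intw_carrier] intw_carrier[OF UV(1)] intw_carrier[OF UV(2)]
      intw_carrier[OF UV'(1)] intw_carrier[OF UV'(2)] by simp_all
  have Yc: "snd Y half \<in> carrier_mat (fst Y) (fst Y)" using D.act_carrier[OF YZ(1)] by simp
  note [simp] = c[THEN carrier_matD(1)] c[THEN carrier_matD(2)] carrier_matD[OF Yc]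
  \<comment> \<open>The middle pair passes through \<open>Z\<close>, where the projections and
    inclusions of the two pullbacks are orthogonal, so no mixed terms remain.\<close>
  have "(i * U * p' + j * U' * q') * (i' * (V * p) + j' * (V' * q)) = i * U * (V * p) + j * U' * (V' * q)"
    using Z c by (intro biproduct_mult[of _ "fst Y" "fst W" _ "fst W'" _ "fst Z" _ _ _ _ "fst Y"])
      (auto simp: biproduct_def)
  also have "\<dots> = i * (U * V) * p + j * (U' * V') * q" by (simp add: mat_assoc_dim)
  also have "\<dots> = snd Y half * i * p + snd Y half * j * q"
    using iw(1,2) by (simp add: UV(4) UV'(4) intw_def)
  also have "\<dots> = snd Y half * (i * p + j * q)" by (simp add: mat_assoc_dim add_mult_dim)
  also have "\<dots> = snd Y half" using Y Yc by (simp add: biproduct_def)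
  finally have 1: "(i * U * p' + j * U' * q') * (i' * (V * p) + j' * (V' * q)) = snd Y half" .
  have "(i' * V * p + j' * V' * q) * (i * (U * p') + j * (U' * q')) = i' * V * (U * p') + j' * V' * (U' * q')"
    using Y c by (intro biproduct_mult[of _ "fst Z" "fst M" _ "fst M'" _ "fst Y" _ _ _ _ "fst Z"])
      (auto simp: biproduct_def)
  also have "\<dots> = i' * (V * U) * p' + j' * (V' * U') * q'" by (simp add: mat_assoc_dim)
  also have "\<dots> = 1\<^sub>m (fst Z)" using Z c by (simp add: UV(3) UV'(3) biproduct_def)
  finally have 2: "(i' * V * p + j' * V' * q) * (i * (U * p') + j * (U' * q')) = 1\<^sub>m (fst Z)" .
  have "D.iw Z Y (i * (U * p') + j * (U' * q'))"
    by (intro D.intw_add YZ D.intw_comp[OF YZ(2) UV(5) YZ(1) D.intw_comp[OF YZ(2) UV(7) UV(5) iw(7) UV(1)] iw(1)]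
      D.intw_comp[OF YZ(2) UV'(5) YZ(1) D.intw_comp[OF YZ(2) UV'(7) UV'(5) iw(8) UV'(1)] iw(2)])
  moreover have "D.iw Y Z (i' * (V * p) + j' * (V' * q))"
    by (intro D.intw_add YZ D.intw_comp[OF YZ(1) UV(7) YZ(2) D.intw_comp[OF YZ(1) UV(5) UV(7) iw(3) UV(2)] iw(5)]
      D.intw_comp[OF YZ(1) UV'(7) YZ(2) D.intw_comp[OF YZ(1) UV'(5) UV'(7) iw(4) UV'(2)] iw(6)])
  moreover have "F (mod_sum N.H W W') = Z" by (simp add: Z_def F_sum)
  ultimately show ?thesis
    unfolding is_plus_def Y_def[symmetric] using 1 2 YZ UV UV'
    by (intro conjI exI[of _ "i * (U * p') + j * (U' * q')"] exI[of _ "i' * (V * p) + j' * (V' * q)"])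
      (simp_all add: mat_assoc_dim N.mod_sum_md Z_def)
qed

end

section \<open>Comparison of the Green rings\<close>

context nichols_double_pair
begin

text \<open>The chosen representative does not affect the class, since the pullback preserves
  isomorphisms.\<close>

definition pullback_class where
  "pullback_class C = D.cls (F (SOME M. N.md M \<and> C = N.cls M))"

text \<open>The representative and the splitting are chosen at once; transport and uniqueness make
  the class independent of both.\<close>

definition plus_class where
  "plus_class C = N.cls (SOME W. \<exists>M. C = D.cls M \<and> is_plus M W)"

lemma pullback_class_cls:
  assumes M: "N.md M"
  shows "pullback_class (N.cls M) = D.cls (F M)"
proof -
  define M' where "M' = (SOME M'. N.md M' \<and> N.cls M = N.cls M')"
  have "N.md M' \<and> N.cls M = N.cls M'" unfolding M'_def by (rule someI[of _ M]) (use M in simp)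
  then have M': "N.md M'" "N.miso M' M"
    using N.cls_eq_iff[of M' M] M by simp_all
  then have "D.cls (F M') = D.cls (F M)" using M by (simp add: D.cls_eq_iff F_md F_iso)
  then show ?thesis by (simp add: pullback_class_def M'_def)
qed

lemma plus_class_cls:
  assumes W: "is_plus M W"
  shows "plus_class (D.cls M) = N.cls W"
proof -
  define W' where "W' = (SOME W'. \<exists>M'. D.cls M = D.cls M' \<and> is_plus M' W')"
  have "\<exists>M'. D.cls M = D.cls M' \<and> is_plus M' W'" unfolding W'_def
    by (rule someI[of _ W], rule exI[of _ M]) (simp add: W)
  then obtain M' where M': "D.cls M = D.cls M'" "is_plus M' W'" by blast
  have md: "D.md M" "D.md M'" "N.md W" "N.md W'" using W M'(2) by (auto simp: is_plus_def)
  have "D.miso M M'" using M'(1) D.cls_eq_iff[OF md(1,2)] by simp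
  then have "is_plus M W'" by (rule plus_transport[OF md(1) _ M'(2)])
  then have "N.miso W' W" using W by (rule plus_unique)
  then show ?thesis
    unfolding plus_class_def W'_def[symmetric] using N.cls_eq_iff[OF md(4,3)] by simp
qed

section \<open>Maps between the free rings on isomorphism classes\<close>

abbreviation "push \<equiv> D.class_map pullback_class"
abbreviation "plus_map \<equiv> N.class_map plus_class"

lemma pullback_class_closed: "pullback_class \<in> carrier N.IM \<rightarrow> carrier D.IM"
  by (auto simp: N.iso_monoid_carrier pullback_class_cls F_md)

lemma plus_class_closed: "plus_class \<in> carrier D.IM \<rightarrow> carrier N.IM"
proof
  fix C assume "C \<in> carrier D.IM"
  then obtain M where M: "D.md M" "C = D.cls M" by (auto simp: D.iso_monoid_carrier)
  obtain W where W: "is_plus M W" using plus_exists[OF M(1)] .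
  then have "N.md W" by (simp add: is_plus_def)
  then show "plus_class C \<in> carrier N.IM" using plus_class_cls[OF W] M(2) by simp
qed

lemmas push_simps = D.class_map_closed[OF pullback_class_closed] D.class_map_add[OF pullback_class_closed]
  D.class_map_single[OF pullback_class_closed]

lemmas plus_map_simps = N.class_map_closed[OF plus_class_closed] N.class_map_add[OF plus_class_closed]
  N.class_map_single[OF plus_class_closed]

lemma push_basis: "N.md M \<Longrightarrow> push (N.basis M) = D.basis (F M)"
  by (simp add: push_simps(3) pullback_class_cls)

text \<open>This holds already in the free rings, before any relation is divided out, because a
  pullback is its own summand.\<close>

lemma plus_map_push:
  assumes "p \<in> carrier N.FG"
  shows "plus_map (push p) = p"
proof -
  have "keys p \<subseteq> carrier N.IM" using assms by simp
  then show ?thesis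
  proof (induction rule: poly_mapping_keys_induct)
    case zero
    show ?case by (simp add: N.class_map_zero D.class_map_zero)
  next
    case (single C c)
    then obtain M where M: "N.md M" "C = N.cls M" by (auto simp: N.iso_monoid_carrier)
    have "plus_map (push (single C c)) = plus_map (single (D.cls (F M)) c)"
      using single M by (simp add: push_simps(3) pullback_class_cls)
    also have "\<dots> = single C c"
      using M plus_class_cls[OF plus_F[OF M(1)]] by (simp add: plus_map_simps(3) F_md)
    finally show ?case .
  next
    case (add p q)
    then show ?case
      using push_simps(1)[of p] push_simps(1)[of q] by (simp add: push_simps(2) plus_map_simps(2))
  qed
qed

lemma push_green_sub:
  assumes "p \<in> green_sub N.H"
  shows "push p \<in> green_sub D.H"
proof (rule additive_generate_subset[OF N.abelian_group_FG D.abelian_group_FG _ _ N.green_rels_closed _ D.subgroup_green_sub])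
  show "p \<in> generate (add_monoid N.FG) (green_rels N.H)" using assms by (simp only: green_sub_def)
  fix s assume "s \<in> green_rels N.H"
  then obtain M M' where M: "N.md M" "N.md M'" and s: "s = N.basis (mod_sum N.H M M') - N.basis M - N.basis M'"
    unfolding green_rels_def by auto
  have "push s = D.basis (mod_sum D.H (F M) (F M')) - D.basis (F M) - D.basis (F M')"
    unfolding s using M D.class_map_relation[OF pullback_class_closed N.cls_closed N.cls_closed N.cls_closed]
    by (simp only: N.mod_sum_md pullback_class_cls F_sum)
  then show "push s \<in> green_sub D.H"
    using M by (auto intro!: D.green_sub_rel D.mod_iso_refl D.mod_sum_md F_md)
qed (use push_simps in simp_all)

text \<open>By \<open>plus_sum\<close>, a splitting of a direct sum can be assembled from splittings
  of the summands, so a defining relation goes to a defining relation.\<close>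

lemma plus_map_green_sub:
  assumes "p \<in> green_sub D.H"
  shows "plus_map p \<in> green_sub N.H"
proof (rule additive_generate_subset[OF D.abelian_group_FG N.abelian_group_FG _ _ D.green_rels_closed _ N.subgroup_green_sub])
  show "p \<in> generate (add_monoid D.FG) (green_rels D.H)" using assms by (simp only: green_sub_def)
  fix s assume "s \<in> green_rels D.H"
  then obtain M M' where M: "D.md M" "D.md M'" and s: "s = D.basis (mod_sum D.H M M') - D.basis M - D.basis M'"
    unfolding green_rels_def by auto
  obtain W W' where W: "is_plus M W" "is_plus M' W'" using M plus_exists by metis
  then have md: "N.md W" "N.md W'" by (simp_all add: is_plus_def)
  have "plus_map s = N.basis (mod_sum N.H W W') - N.basis W - N.basis W'"
    unfolding s using M N.class_map_relation[OF plus_class_closed D.cls_closed D.cls_closed D.cls_closed]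
    by (simp only: D.mod_sum_md plus_class_cls[OF W(1)] plus_class_cls[OF W(2)] plus_class_cls[OF plus_sum[OF W]])
  then show "plus_map s \<in> green_sub N.H"
    using md by (auto intro!: N.green_sub_rel N.mod_iso_refl N.mod_sum_md)
qed (use plus_map_simps in simp_all)

text \<open>If \<open>push p\<close> is a relation, then so is \<open>p = plus_map (push p)\<close>.
  This is the injectivity of the map between Green rings.\<close>

lemma push_mem_green_sub_iff: "p \<in> carrier N.FG \<Longrightarrow> push p \<in> green_sub D.H \<longleftrightarrow> p \<in> green_sub N.H"
  using push_green_sub plus_map_green_sub plus_map_push by metis

text \<open>On classes, multiplicativity is the equality of the pullback of a tensor product with
  the tensor product of the pullbacks.\<close>

lemma push_hom: "push \<in> Ring.ring_hom N.FG D.FG"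
  unfolding D.class_map_def
proof (subst (1) free_green_def, rule assoc_algebra.linext_ring_hom[OF D.algebra_FG N.monoid_iso_monoid
      D.class_map_basis_closed[OF pullback_class_closed]])
  fix x y assume "x \<in> carrier N.IM" "y \<in> carrier N.IM"
  then obtain M M' where M: "N.md M" "N.md M'" "x = N.cls M" "y = N.cls M'"
    by (auto simp: N.iso_monoid_carrier)
  then show "single (pullback_class (x \<otimes>\<^bsub>N.IM\<^esub> y)) 1 =
    single (pullback_class x) 1 \<otimes>\<^bsub>D.FG\<^esub> single (pullback_class y) 1"
    by (simp add: N.iso_monoid_mult N.mod_tensor_md pullback_class_cls D.FG_mult_basis F_md F_tensor)
next
  show "single (pullback_class \<one>\<^bsub>N.IM\<^esub>) 1 = \<one>\<^bsub>D.FG\<^esub>"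
    by (simp add: N.iso_monoid_one pullback_class_cls N.mod_unit_md F_unit)
      (simp add: free_green_def D.iso_monoid_one)
qed

section \<open>The map of Green rings, its kernel and its image\<close>

abbreviation "DG \<equiv> green_ring D.H"

definition green_map where "green_map p = green_sub D.H +>\<^bsub>D.FG\<^esub> push p"

lemma green_map_hom: "ring_hom_ring N.FG DG green_map"
proof (rule ring_hom_ringI2[OF N.ring_FG D.ring_green_ring])
  have "(+>\<^bsub>D.FG\<^esub>) (green_sub D.H) \<in> Ring.ring_hom D.FG DG"
    unfolding green_ring_def by (rule ideal.rcos_ring_hom[OF D.ideal_green_sub])
  from ring_hom_trans[OF push_hom this] show "green_map \<in> Ring.ring_hom N.FG DG"
    by (simp add: green_map_def[abs_def] comp_def)
qed

lemma kernel_green_map: "a_kernel N.FG DG green_map = green_sub N.H"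
proof -
  interpret I: ideal "green_sub D.H" D.FG by (rule D.ideal_green_sub)
  have "green_map p = \<zero>\<^bsub>DG\<^esub> \<longleftrightarrow> p \<in> green_sub N.H" if p: "p \<in> carrier N.FG" for p
  proof -
    have z: "\<zero>\<^bsub>DG\<^esub> = green_sub D.H" by (simp add: green_ring_def FactRing_def)
    have pc: "push p \<in> carrier D.FG" using push_simps(1)[of p] p by simp
    have "green_sub D.H +>\<^bsub>D.FG\<^esub> push p = green_sub D.H \<longleftrightarrow> push p \<in> green_sub D.H"
      using I.rcos_const_imp_mem[OF pc] I.a_rcos_const by blast
    then show ?thesis using push_mem_green_sub_iff[OF p] by (simp only: z green_map_def)
  qed
  then show ?thesis
    unfolding a_kernel_def' using N.green_sub_closed by blast
qed

text \<open>By descent the generators of the subgroup are exactly the images of the classes.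
  Homomorphisms commute with generation, and the classes generate the free ring additively.\<close>

lemma image_green_map: "green_map ` carrier N.FG = green_ring_DK0 n"
proof -
  interpret h: ring_hom_ring N.FG DG green_map by (rule green_map_hom)
  interpret g: group_hom "add_monoid N.FG" "add_monoid DG" green_map
    by (rule h.a_group_hom)
  have sub: "{N.basis M | M. N.md M} \<subseteq> carrier (add_monoid N.FG)" by auto
  have "green_map ` {N.basis M | M. N.md M} = {green_class D.H M | M. D.md M \<and> K_eq_K' n M}"
  proof (intro equalityI subsetI)
    fix x assume "x \<in> green_map ` {N.basis M | M. N.md M}"
    then obtain M where M: "N.md M" "x = green_map (N.basis M)" by blast
    then have "x = green_class D.H (F M)" by (simp only: green_map_def push_basis green_class_def)
    then show "x \<in> {green_class D.H M | M. D.md M \<and> K_eq_K' n M}"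
      using F_md[OF M(1)] K_eq_K'_F[OF M(1)] by blast
  next
    fix x assume "x \<in> {green_class D.H M | M. D.md M \<and> K_eq_K' n M}"
    then obtain M where M: "D.md M" "K_eq_K' n M" "x = green_class D.H M" by blast
    obtain W where W: "N.md W" "F W = M" using descent[OF M(1)] M(2) K_eq_K'_iff[OF M(1)] by blast
    then have "x = green_map (N.basis W)" using M(3) by (simp only: green_map_def push_basis green_class_def)
    then show "x \<in> green_map ` {N.basis M | M. N.md M}" using W(1) by blast
  qed
  then have "green_ring_DK0 n = generate (add_monoid DG) (green_map ` {N.basis M | M. N.md M})"
    by (simp only: green_ring_DK0_def dk_eq)
  also have "\<dots> = green_map ` generate (add_monoid N.FG) {N.basis M | M. N.md M}"
    by (rule g.generate_img[OF sub])
  finally show ?thesis by (subst N.carrier_FG_generated) (rule sym)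
qed

text \<open>The additive span is closed under products because it is the image of a ring.\<close>

lemma subring_DK0: "subring (green_ring_DK0 n) DG"
  using ring_hom_ring.img_is_subring[OF green_map_hom ring.carrier_is_subring[OF N.ring_FG]]
  by (simp only: image_green_map)

text \<open>The first isomorphism theorem for \<open>green_map\<close>.\<close>

lemma green_ring_iso: "green_ring N.H \<simeq> DG\<lparr>carrier := green_ring_DK0 n\<rparr>"
  using ring_hom_ring.FactRing_iso_set_aux[OF green_map_hom]
  unfolding kernel_green_map image_green_map green_ring_def[of N.H, symmetric] is_ring_iso_def by blast

section \<open>Indecomposable modules\<close>

lemma K_eq_K'_retract:
  assumes "D.md M" "D.md Y" "D.iw M Y i" "D.iw Y M p" "p * i = 1\<^sub>m (fst M)" "K_eq_K' n Y"
  shows "K_eq_K' n M"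
  using D.act_eq_if_retract[OF assms(1,2,3) intw_carrier[OF assms(4)] assms(5) D.gen_in_H[OF DK_gens(1)] D.gen_in_H[OF DK_gens(2)]]
    assms K_eq_K'_iff by blast

text \<open>Direct summands are retracts. This excludes that a pullback decomposes over the double
  into pieces that are not pullbacks.\<close>

lemma K_eq_K'_summands:
  assumes M: "D.md M" "K_eq_K' n M" and PQ: "D.md P" "D.md Q" and iso: "D.miso M (mod_sum D.H P Q)"
  shows "K_eq_K' n P" "K_eq_K' n Q"
proof -
  note Y = D.mod_sum_md[OF PQ]
  obtain f g where fg: "D.iw M (mod_sum D.H P Q) f" "D.iw (mod_sum D.H P Q) M g" "f * g = 1\<^sub>m (fst (mod_sum D.H P Q))"
    using iso D.mod_iso_iff[OF M(1) Y] by blast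
  have KY: "K_eq_K' n (mod_sum D.H P Q)" by (rule K_eq_K'_retract[OF Y M(1) fg(2) fg(1) fg(3) M(2)])
  obtain i j p q where b: "biproduct D.H P Q (mod_sum D.H P Q) i j p q"
    using D.mod_sum_biproduct[OF PQ] .
  show "K_eq_K' n P" "K_eq_K' n Q"
    using b PQ Y KY by (auto simp: biproduct_def intro: K_eq_K'_retract[of P _ i p] K_eq_K'_retract[of Q _ j q])
qed

text \<open>A decomposition over the Nichols algebra is pulled back; one over the double has
  summands on which \<open>K\<close> and \<open>K'\<close> agree, so they descend.\<close>

lemma indecomposable_F_iff:
  assumes M: "N.md M"
  shows "indecomposable D.H (F M) \<longleftrightarrow> indecomposable N.H M"
proof
  assume ind: "indecomposable D.H (F M)"
  show "indecomposable N.H M"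
    unfolding indecomposable_def
  proof (intro conjI allI impI M)
    show "fst M \<noteq> 0" using ind by (simp add: indecomposable_def)
    fix P Q assume "N.md P \<and> N.md Q \<and> N.miso M (mod_sum N.H P Q)"
    then have PQ: "N.md P" "N.md Q" "N.miso M (mod_sum N.H P Q)" by blast+
    then have "D.miso (F M) (mod_sum D.H (F P) (F Q))"
      using M by (simp add: F_iso N.mod_sum_md flip: F_sum)
    then show "fst P = 0 \<or> fst Q = 0"
      using ind F_md[OF PQ(1)] F_md[OF PQ(2)] unfolding indecomposable_def by (metis fst_F)
  qed
next
  assume ind: "indecomposable N.H M"
  show "indecomposable D.H (F M)"
    unfolding indecomposable_def
  proof (intro conjI allI impI F_md[OF M])
    show "fst (F M) \<noteq> 0" using ind by (simp add: indecomposable_def)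
    fix P Q assume "D.md P \<and> D.md Q \<and> D.miso (F M) (mod_sum D.H P Q)"
    then have PQ: "D.md P" "D.md Q" "D.miso (F M) (mod_sum D.H P Q)" by blast+
    note K = K_eq_K'_summands[OF F_md[OF M] K_eq_K'_F[OF M] PQ]
    obtain P' where P': "N.md P'" "F P' = P" using descent[OF PQ(1)] K(1) K_eq_K'_iff[OF PQ(1)] by blast
    obtain Q' where Q': "N.md Q'" "F Q' = Q" using descent[OF PQ(2)] K(2) K_eq_K'_iff[OF PQ(2)] by blast
    have "N.miso M (mod_sum N.H P' Q')"
      using PQ(3) M P' Q' by (simp add: N.mod_sum_md F_sum flip: F_iso)
    then show "fst P = 0 \<or> fst Q = 0"
      using ind P' Q' unfolding indecomposable_def by (metis fst_F)
  qed
qed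

text \<open>The pullback keeps dimension and matrices, so injectivity holds for modules themselves
  and not only up to isomorphism. Surjectivity is descent.\<close>

lemma bij_indecomposable:
  "bij_betw F {M. indecomposable N.H M} {M. indecomposable D.H M \<and> K_eq_K' n M}"
proof (rule bij_betw_imageI)
  show "inj_on F {M. indecomposable N.H M}"
  proof (rule inj_onI)
    fix M M' assume "M \<in> {M. indecomposable N.H M}" "M' \<in> {M. indecomposable N.H M}" and eq: "F M = F M'"
    then have "N.md M" "N.md M'" by (simp_all add: indecomposable_def)
    then show "M = M'" using eq by (rule F_inj)
  qed
  show "F ` {M. indecomposable N.H M} = {M. indecomposable D.H M \<and> K_eq_K' n M}"
  proof (intro equalityI subsetI)
    fix x assume "x \<in> F ` {M. indecomposable N.H M}"
    then obtain M where M: "indecomposable N.H M" "x = F M" by blast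
    then have "N.md M" by (simp add: indecomposable_def)
    then show "x \<in> {M. indecomposable D.H M \<and> K_eq_K' n M}"
      using M indecomposable_F_iff K_eq_K'_F by blast
  next
    fix x assume "x \<in> {M. indecomposable D.H M \<and> K_eq_K' n M}"
    then have x: "indecomposable D.H x" "K_eq_K' n x" by blast+
    then have md: "D.md x" by (simp add: indecomposable_def)
    obtain W where W: "N.md W" "F W = x" using descent[OF md] x(2) K_eq_K'_iff[OF md] by blast
    then have "indecomposable N.H W" using x(1) indecomposable_F_iff by blast
    then show "x \<in> F ` {M. indecomposable N.H M}" using W(2) by blast
  qed
qed

end

theorem theorem4p6:
  fixes n :: nat
  assumes "n \<ge> 1"
  shows "(ring (green_ring (nichols (2 * n)))
      \<and> ring (green_ring (nichols_double n))
      \<and> subring (green_ring_DK0 n) (green_ring (nichols_double n))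
      \<and> green_ring (nichols (2 * n)) \<simeq>
          (green_ring (nichols_double n))\<lparr>carrier := green_ring_DK0 n\<rparr>)
    \<and> bij_betw (pullback (nichols_double n) (dk_proj n))
        {M. indecomposable (nichols (2 * n)) M}
        {M. indecomposable (nichols_double n) M \<and> K_eq_K' n M}"
proof -
  interpret nichols_double_pair n .
  show ?thesis
    unfolding nichols_eq dk_eq
    using N.ring_green_ring D.ring_green_ring subring_DK0 green_ring_iso bij_indecomposable by blast
qed

end
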